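(* Let $m$ be an integer and let $u\in\mathcal{S}'(\mathbf{R}^n)$ satisfy $Pu=f$ in $\mathbf{R}^n$, where $f\in\mathcal{E}'(\mathbf{R}^n)$ and $P$ is the multiplier operator with symbol $p$ described in the context, and let the circle $\mathcal{C}$ lie in the complement of the singular support of $f$. Then $$\lim_{\varrho\to\infty}\widehat{U}^{\mathcal{C}}_{\varrho,m}=\widehat{U}^{\mathcal{C}}_m.$$
   Context: Let $n\ge2$ be an integer. $\mathcal{F}$ (also $\widehat{\cdot}$) is the Fourier transform on $\mathcal{S}'(\mathbf{R}^n)$, with convention $\widehat{\phi}(\xi)=\int e^{-ix\cdot\xi}\phi(x)\,dx$, and $\mathcal{F}^{-1}$ is its inverse; $\mathcal{E}'(\mathbf{R}^n)$ is the space of compactly supported distributions. $\langle x\rangle=(1+|x|^2)^{1/2}$. The symbol $p\in C^\infty(\mathbf{R}^n)$ is an elliptic symbol of class $S^\mu(\mathbf{R}^n)$ for some real $\mu$: for each multi-index $\alpha$ there is $C_\alpha$ with $|\partial^\alpha p(\xi)|\le C_\alpha\langle\xi\rangle^{\mu-|\alpha|}$ for all $\xi$, and there are positive constants $C,R_0$ with $|p(\xi)|\ge C\langle\xi\rangle^\mu$ for $|\xi|\ge R_0$. Moreover $p(\xi)=g(\xi)\prod_{j=1}^N(|\xi|-r_j)^{q_j}$, where $N$ is a natural number, $0<r_1<\dots<r_N$, the $q_j$ are positive integers, and $g\in C^\infty(\mathbf{R}^n\setminus\{0\})$ with $|g(\xi)|$ bounded from below by a positive constant, bounded from above as $|\xi|\to0$,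 and at most polynomially increasing as $|\xi|\to\infty$. The operator $P:\mathcal{S}'(\mathbf{R}^n)\to\mathcal{S}'(\mathbf{R}^n)$ is $Pu=\mathcal{F}^{-1}(p\widehat{u})$. For orthonormal $e_1,e_2\in\mathbf{R}^n$ and $R>0$, $\mathcal{C}=\{e_1R\cos\theta+e_2R\sin\theta:\theta\in[0,2\pi]\}$. Since $p$ is elliptic and $\mathcal{C}$ avoids the singular support of $f$, $u$ is smooth in an open neighborhood of $\mathcal{C}$, and $$\widehat{U}^{\mathcal{C}}_m=\int_0^{2\pi}e^{-im\theta}u(e_1R\cos\theta+e_2R\sin\theta)\,d\theta.$$ Fix $\chi\in C_0^\infty(\mathbf{R}^n)$ with $\chi(\xi)=1$ for $|\xi|\le1$ and $\chi(\xi)=0$ for $|\xi|\ge2$. For $\varrho>0$, $u_\varrho=\mathcal{F}^{-1}(\chi(\cdot/\varrho)\widehat{u})$, which is a smooth function on $\mathbf{R}^n$, and $$\widehat{U}^{\mathcal{C}}_{\varrho,m}=\int_0^{2\pi}e^{-im\theta}u_\varrho(e_1R\cos\theta+e_2R\sin\theta)\,d\theta.$$ *)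

theory Defs
  imports "HOL-Analysis.Analysis"
begin

section \<open>Smooth functions on Euclidean space\<close>

definition partial_deriv :: "'n::finite \<Rightarrow> (real^'n \<Rightarrow> complex) \<Rightarrow> real^'n \<Rightarrow> complex" where
  "partial_deriv i f x = frechet_derivative f (at x) (axis i 1)"

text \<open>A multi-index is encoded as a list of coordinate directions, its order being the length of
  the list. For smooth functions the order of the entries is irrelevant, so quantifying over such
  lists amounts to quantifying over multi-indices.\<close>

primrec iter_deriv :: "'n::finite list \<Rightarrow> (real^'n \<Rightarrow> complex) \<Rightarrow> real^'n \<Rightarrow> complex" where
  "iter_deriv [] f = f"
| "iter_deriv (i # \<alpha>) f = partial_deriv i (iter_deriv \<alpha> f)"

text \<open>For open \<open>S\<close> this is the class $C^\infty(S)$: total differentiability of all iterated partial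
  derivatives is the same as their existence and continuity.\<close>

definition smooth_on :: "(real^'n::finite) set \<Rightarrow> (real^'n \<Rightarrow> complex) \<Rightarrow> bool" where
  "smooth_on S f \<longleftrightarrow> (\<forall>\<alpha>. \<forall>x\<in>S. iter_deriv \<alpha> f differentiable (at x))"

definition japanese :: "real^'n::finite \<Rightarrow> real" where
  "japanese x = sqrt (1 + (norm x)\<^sup>2)"

definition test_functions :: "(real^'n::finite) set \<Rightarrow> (real^'n \<Rightarrow> complex) set" where
  "test_functions W = {\<phi>. smooth_on UNIV \<phi> \<and> compact (closure {x. \<phi> x \<noteq> 0})
     \<and> closure {x. \<phi> x \<noteq> 0} \<subseteq> W}"

section \<open>Tempered distributions\<close>

definition schwartz_space :: "(real^'n::finite \<Rightarrow> complex) set" where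
  "schwartz_space = {\<phi>. smooth_on UNIV \<phi> \<and>
     (\<forall>k \<alpha>. bounded (range (\<lambda>x. japanese x ^ k * norm (iter_deriv \<alpha> \<phi> x))))}"

definition schwartz_seminorm :: "nat \<Rightarrow> 'n::finite list \<Rightarrow> (real^'n \<Rightarrow> complex) \<Rightarrow> real" where
  "schwartz_seminorm k \<alpha> \<phi> = (SUP x. japanese x ^ k * norm (iter_deriv \<alpha> \<phi> x))"

text \<open>Functionals are taken extensional on the Schwartz space, so that equality of elements of
  \<open>tempered_distributions\<close> is equality of distributions.\<close>

definition tempered_distributions :: "((real^'n::finite \<Rightarrow> complex) \<Rightarrow> complex) set" where
  "tempered_distributions = {u \<in> extensional schwartz_space.
     (\<forall>\<phi>\<in>schwartz_space. \<forall>\<psi>\<in>schwartz_space. u (\<lambda>x. \<phi> x + \<psi> x) = u \<phi> + u \<psi>) \<and>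
     (\<forall>c. \<forall>\<phi>\<in>schwartz_space. u (\<lambda>x. c * \<phi> x) = c * u \<phi>) \<and>
     (\<exists>C K. \<forall>\<phi>\<in>schwartz_space.
        norm (u \<phi>) \<le> C * (\<Sum>k\<le>K. \<Sum>\<alpha> | length \<alpha> \<le> K. schwartz_seminorm k \<alpha> \<phi>))}"

definition dist_support :: "((real^'n::finite \<Rightarrow> complex) \<Rightarrow> complex) \<Rightarrow> (real^'n) set" where
  "dist_support u = {x. \<not> (\<exists>W. open W \<and> x \<in> W \<and> (\<forall>\<phi>\<in>test_functions W. u \<phi> = 0))}"

text \<open>The space $\mathcal{E}'$, viewed inside $\mathcal{S}'$.\<close>

definition compactly_supported_distributions :: "((real^'n::finite \<Rightarrow> complex) \<Rightarrow> complex) set" where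
  "compactly_supported_distributions = {u \<in> tempered_distributions. compact (dist_support u)}"

text \<open>\<open>represents_on W v u\<close>: on the open set \<open>W\<close> the distribution \<open>u\<close> is the smooth function \<open>v\<close>.\<close>

definition represents_on ::
  "(real^'n::finite) set \<Rightarrow> (real^'n \<Rightarrow> complex) \<Rightarrow> ((real^'n \<Rightarrow> complex) \<Rightarrow> complex) \<Rightarrow> bool" where
  "represents_on W v u \<longleftrightarrow> open W \<and> smooth_on W v \<and>
     (\<forall>\<phi>\<in>test_functions W. u \<phi> = (LINT x|lborel. v x * \<phi> x))"

definition singular_support :: "((real^'n::finite \<Rightarrow> complex) \<Rightarrow> complex) \<Rightarrow> (real^'n) set" where
  "singular_support u = {x. \<not> (\<exists>W v. x \<in> W \<and> represents_on W v u)}"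

text \<open>The value of a distribution at a point outside its singular support, that is, the value there
  of the smooth function it coincides with near that point; unspecified on the singular support.\<close>

definition dist_value :: "((real^'n::finite \<Rightarrow> complex) \<Rightarrow> complex) \<Rightarrow> real^'n \<Rightarrow> complex" where
  "dist_value u x = (THE c. \<exists>W v. x \<in> W \<and> represents_on W v u \<and> v x = c)"

section \<open>Fourier transform and Fourier multipliers\<close>

definition fourier :: "(real^'n::finite \<Rightarrow> complex) \<Rightarrow> real^'n \<Rightarrow> complex" where
  "fourier \<phi> \<xi> = (LINT x|lborel. exp (- (\<i> * of_real (x \<bullet> \<xi>))) * \<phi> x)"

definition inv_fourier :: "(real^'n::finite \<Rightarrow> complex) \<Rightarrow> real^'n \<Rightarrow> complex" where
  "inv_fourier = inv_into schwartz_space fourier"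

text \<open>The operators on tempered distributions are the transposes of those on Schwartz functions.\<close>

definition fourier_dist ::
  "((real^'n::finite \<Rightarrow> complex) \<Rightarrow> complex) \<Rightarrow> (real^'n \<Rightarrow> complex) \<Rightarrow> complex" where
  "fourier_dist u = (\<lambda>\<phi>\<in>schwartz_space. u (fourier \<phi>))"

definition inv_fourier_dist ::
  "((real^'n::finite \<Rightarrow> complex) \<Rightarrow> complex) \<Rightarrow> (real^'n \<Rightarrow> complex) \<Rightarrow> complex" where
  "inv_fourier_dist u = (\<lambda>\<phi>\<in>schwartz_space. u (inv_fourier \<phi>))"

definition mult_dist :: "(real^'n::finite \<Rightarrow> complex) \<Rightarrow>
    ((real^'n \<Rightarrow> complex) \<Rightarrow> complex) \<Rightarrow> (real^'n \<Rightarrow> complex) \<Rightarrow> complex" where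
  "mult_dist a u = (\<lambda>\<phi>\<in>schwartz_space. u (\<lambda>x. a x * \<phi> x))"

definition multiplier_op :: "(real^'n::finite \<Rightarrow> complex) \<Rightarrow>
    ((real^'n \<Rightarrow> complex) \<Rightarrow> complex) \<Rightarrow> (real^'n \<Rightarrow> complex) \<Rightarrow> complex" where
  "multiplier_op a u = inv_fourier_dist (mult_dist a (fourier_dist u))"

definition symbol_class :: "real \<Rightarrow> (real^'n::finite \<Rightarrow> complex) set" where
  "symbol_class \<mu> = {p. smooth_on UNIV p \<and>
     (\<forall>\<alpha>. \<exists>C. \<forall>\<xi>. norm (iter_deriv \<alpha> p \<xi>) \<le> C * japanese \<xi> powr (\<mu> - real (length \<alpha>)))}"

definition elliptic :: "real \<Rightarrow> (real^'n::finite \<Rightarrow> complex) \<Rightarrow> bool" where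
  "elliptic \<mu> p \<longleftrightarrow> (\<exists>C>0. \<exists>R\<^sub>0>0. \<forall>\<xi>. norm \<xi> \<ge> R\<^sub>0 \<longrightarrow> norm (p \<xi>) \<ge> C * japanese \<xi> powr \<mu>)"

section \<open>Fourier coefficients on a circle\<close>

definition circle_point :: "real^'n::finite \<Rightarrow> real^'n \<Rightarrow> real \<Rightarrow> real \<Rightarrow> real^'n" where
  "circle_point e1 e2 R \<theta> = (R * cos \<theta>) *\<^sub>R e1 + (R * sin \<theta>) *\<^sub>R e2"

definition circle_in :: "real^'n::finite \<Rightarrow> real^'n \<Rightarrow> real \<Rightarrow> (real^'n) set" where
  "circle_in e1 e2 R = circle_point e1 e2 R ` {0..2 * pi}"

definition circle_coeff ::
  "real^'n::finite \<Rightarrow> real^'n \<Rightarrow> real \<Rightarrow> int \<Rightarrow> ((real^'n \<Rightarrow> complex) \<Rightarrow> complex) \<Rightarrow> complex" where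
  "circle_coeff e1 e2 R m u =
     integral {0..2 * pi} (\<lambda>\<theta>. exp (- (\<i> * of_int m * of_real \<theta>))
       * dist_value u (circle_point e1 e2 R \<theta>))"

end

theory Submission
  imports Defs
begin

text \<open>With \<open>\<kappa>\<close> the cutoff, the function \<open>u\<^sub>\<rho>\<close> is up to a constant \<open>x \<mapsto> \<langle>\<kappa>(\<cdot>/\<rho>) e\<^sub>x, F u\<rangle>\<close>, where
  \<open>e\<^sub>x(\<xi>) = exp(i x\<cdot>\<xi>)\<close>, and for large \<open>\<rho> \<le> \<rho>'\<close> ellipticity gives \<open>u\<^sub>\<rho>\<^sub>' - u\<^sub>\<rho> = b(D) f\<close> with
  \<open>b = (\<kappa>(\<cdot>/\<rho>') - \<kappa>(\<cdot>/\<rho>)) / p\<close>. These symbols are of size \<open>1/\<rho>\<close> in a symbol class of order \<open>1 - \<mu>\<close>.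
  Near a point where \<open>f\<close> is smooth, \<open>b(D) f\<close> is controlled by finitely many symbol seminorms of \<open>b\<close> of any
  prescribed order: the part of \<open>f\<close> away from the point sees only the rapid off-diagonal decay of the kernel
  of \<open>b(D)\<close>, the part near it is a test function. Applied to \<open>\<xi>\<^sup>\<beta> b\<close>, this shows that \<open>u\<^sub>\<rho>\<close> converges with all
  derivatives, uniformly near the circle; as also \<open>u\<^sub>\<rho> \<rightarrow> u\<close> weakly, the limit is the smooth function \<open>u\<close>,
  and the Fourier coefficients converge. Fourier inversion is proved from the cutoff itself: any Schwartz
  function with value \<open>1\<close> at the origin can replace the Gaussian.\<close>

section \<open>Iterated partial derivatives\<close>

text \<open>Distributions act on Schwartz functions only, so a plane wave can be tested only after
  multiplication by a Schwartz symbol. Hence everything is expressed through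
  \<open>wave_value\<close>: the pairing of \<open>u\<close> with the kernel
  \<open>fourier a\<close> translated by \<open>x\<close>. The only continuity available is a bound
  by finitely many seminorms. Differentiation in \<open>x\<close> and the exchange of
  \<open>u\<close> with an integral are therefore proved by estimating, in those seminorms, a Taylor
  remainder and a Riemann sum error. One predicate, \<open>sym_bound\<close>, carries the estimates:
  a symbol satisfies it for its own order, a Schwartz function for every order, and results are
  linear in its constant. This is how the factor 1/\<rho> travels unchanged from symbol to solution.
  That factor has an elementary source: the band symbol vanishes for frequencies below \<rho>, and
  above \<rho> one power of the weight can be traded for 1/\<rho>. The lost order is harmless
  because pseudolocality accepts any order. An explicit rate, rather than bare convergence, makes
  the Cauchy property in the continuous parameter \<rho> immediate for all derivatives at
  once.\<close>

lemma partial_deriv_eq: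
  assumes "(f has_derivative f') (at x)"
  shows "partial_deriv i f x = f' (axis i 1)"
  using frechet_derivative_at[OF assms] by (simp add: partial_deriv_def)

text \<open>Linearity and the expansion of \<open>h\<close> in the standard basis. Later derivatives
  are all stated in this coordinate form, from which \<open>sum_axis_scaleR\<close> reads off the
  partials.\<close>

lemma has_derivative_partial_deriv:
  fixes f :: "real^'n::finite \<Rightarrow> complex"
  assumes "f differentiable (at x)"
  shows "(f has_derivative (\<lambda>h. \<Sum>i\<in>UNIV. h $ i *\<^sub>R partial_deriv i f x)) (at x)"
proof -
  let ?D = "frechet_derivative f (at x)"
  have D: "(f has_derivative ?D) (at x)"
    using assms frechet_derivative_works by blast
  then have lin: "linear ?D"
    by (simp add: has_derivative_linear)
  have "?D h = (\<Sum>i\<in>UNIV. h $ i *\<^sub>R partial_deriv i f x)" for h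
  proof -
    have "?D h = ?D (\<Sum>i\<in>UNIV. h $ i *\<^sub>R axis i 1)"
      using basis_expansion[of h] by (simp add: scalar_mult_eq_scaleR)
    also have "\<dots> = (\<Sum>i\<in>UNIV. h $ i *\<^sub>R ?D (axis i 1))"
      using lin by (simp add: linear_sum linear_cmul)
    finally show ?thesis by (simp add: partial_deriv_def)
  qed
  then have "?D = (\<lambda>h. \<Sum>i\<in>UNIV. h $ i *\<^sub>R partial_deriv i f x)"
    by (rule ext)
  with D show ?thesis by simp
qed

lemma has_derivative_cong_open:
  assumes "open S" "x \<in> S" "\<And>y. y \<in> S \<Longrightarrow> f y = g y"
  shows "(f has_derivative f') (at x) \<longleftrightarrow> (g has_derivative f') (at x)"
  using assms has_derivative_transform_within_open[of f f' x UNIV S g]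
    has_derivative_transform_within_open[of g f' x UNIV S f] by auto

lemma differentiable_cong_open:
  assumes "open S" "x \<in> S" "\<And>y. y \<in> S \<Longrightarrow> f y = g y"
  shows "f differentiable (at x) \<longleftrightarrow> g differentiable (at x)"
  using has_derivative_cong_open[OF assms] by (simp add: differentiable_def)

lemma partial_deriv_cong_open:
  assumes "open S" "x \<in> S" "\<And>y. y \<in> S \<Longrightarrow> f y = g y"
  shows "partial_deriv i f x = partial_deriv i g x"
  using has_derivative_cong_open[OF assms] by (simp add: partial_deriv_def frechet_derivative_def)

text \<open>The induction needs equality on the whole open set, since the next derivative looks at
  neighbouring values. This locality is what allows functions to be glued from two open
  pieces.\<close>

lemma iter_deriv_cong_open:
  assumes "open S" "x \<in> S" "\<And>y. y \<in> S \<Longrightarrow> f y = g y"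
  shows "iter_deriv \<alpha> f x = iter_deriv \<alpha> g x"
  using assms(2)
proof (induction \<alpha> arbitrary: x)
  case Nil
  then show ?case using assms by simp
next
  case (Cons i \<alpha>)
  then show ?case
    using partial_deriv_cong_open[OF assms(1) Cons.prems Cons.IH] by simp
qed

lemma smooth_on_cong:
  assumes "open S" "\<And>y. y \<in> S \<Longrightarrow> f y = g y" "smooth_on S f"
  shows "smooth_on S g"
  unfolding smooth_on_def
proof (intro allI ballI)
  fix \<alpha> x assume x: "x \<in> S"
  have "iter_deriv \<alpha> f differentiable (at x)"
    using assms x by (auto simp: smooth_on_def)
  moreover have "iter_deriv \<alpha> f y = iter_deriv \<alpha> g y" if "y \<in> S" for y
    using iter_deriv_cong_open[OF assms(1) that assms(2)] .
  ultimately show "iter_deriv \<alpha> g differentiable (at x)"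
    using differentiable_cong_open[OF assms(1) x] by blast
qed

lemma smooth_on_subset: "smooth_on S f \<Longrightarrow> T \<subseteq> S \<Longrightarrow> smooth_on T f"
  by (auto simp: smooth_on_def)

lemma smooth_on_Un: "smooth_on S f \<Longrightarrow> smooth_on T f \<Longrightarrow> smooth_on (S \<union> T) f"
  by (auto simp: smooth_on_def)

lemma iter_deriv_append: "iter_deriv (\<alpha> @ \<beta>) f = iter_deriv \<alpha> (iter_deriv \<beta> f)"
  by (induction \<alpha>) auto

lemma smooth_on_iter_deriv: "smooth_on S f \<Longrightarrow> smooth_on S (iter_deriv \<beta> f)"
  unfolding smooth_on_def by (metis iter_deriv_append)

lemma smooth_on_partial_deriv: "smooth_on S f \<Longrightarrow> smooth_on S (partial_deriv i f)"
  using smooth_on_iter_deriv[of S f "[i]"] by simp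

lemma smooth_on_differentiable:
  "smooth_on S f \<Longrightarrow> x \<in> S \<Longrightarrow> iter_deriv \<alpha> f differentiable (at x)"
  by (auto simp: smooth_on_def)

lemma smooth_on_continuous_on: "smooth_on S f \<Longrightarrow> continuous_on S (iter_deriv \<alpha> f)"
  by (meson smooth_on_differentiable continuous_at_imp_continuous_on differentiable_imp_continuous_within)

lemma iter_deriv_const:
  "iter_deriv \<alpha> (\<lambda>_::real^'n::finite. c) = (\<lambda>_. if \<alpha> = [] then c else 0)"
proof (induction \<alpha>)
  case (Cons i \<alpha>)
  then show ?case
    by (auto intro!: ext simp: partial_deriv_eq[OF has_derivative_const])
qed auto

lemma smooth_on_const [simp]: "smooth_on S (\<lambda>_::real^'n::finite. c)"
  by (simp add: smooth_on_def iter_deriv_const)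

text \<open>\<open>h\<close> is only real-linear, so that multiplication by a complex constant and
  complex conjugation are both instances.\<close>

lemma iter_deriv_bounded_linear:
  fixes f :: "real^'n::finite \<Rightarrow> complex"
  assumes S: "open S" and f: "smooth_on S f" and h: "bounded_linear h" and x: "x \<in> S"
  shows "iter_deriv \<alpha> (\<lambda>x. h (f x)) x = h (iter_deriv \<alpha> f x)"
  using x
proof (induction \<alpha> arbitrary: x)
  case (Cons i \<alpha>)
  have "partial_deriv i (iter_deriv \<alpha> (\<lambda>x. h (f x))) x = partial_deriv i (\<lambda>x. h (iter_deriv \<alpha> f x)) x"
    by (rule partial_deriv_cong_open[OF S Cons.prems]) (rule Cons.IH)
  also have "\<dots> = h (partial_deriv i (iter_deriv \<alpha> f) x)"
    using partial_deriv_eq[OF bounded_linear.has_derivative[OF h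
        has_derivative_partial_deriv[OF smooth_on_differentiable[OF f Cons.prems]]], of i \<alpha>]
      partial_deriv_eq[OF has_derivative_partial_deriv[OF smooth_on_differentiable[OF f Cons.prems]], of i \<alpha>]
    by simp
  finally show ?case by simp
qed auto

lemma smooth_on_bounded_linear:
  fixes f :: "real^'n::finite \<Rightarrow> complex"
  assumes S: "open S" and f: "smooth_on S f" and h: "bounded_linear h"
  shows "smooth_on S (\<lambda>x. h (f x))"
  unfolding smooth_on_def
proof (intro allI ballI)
  fix \<alpha> x assume x: "x \<in> S"
  have "(\<lambda>x. h (iter_deriv \<alpha> f x)) differentiable (at x)"
    using bounded_linear.has_derivative[OF h
        has_derivative_partial_deriv[OF smooth_on_differentiable[OF f x]]]
    by (auto simp: differentiable_def)
  then show "iter_deriv \<alpha> (\<lambda>x. h (f x)) differentiable (at x)"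
    using differentiable_cong_open[OF S x, of "iter_deriv \<alpha> (\<lambda>x. h (f x))" "\<lambda>x. h (iter_deriv \<alpha> f x)"]
      iter_deriv_bounded_linear[OF S f h] by simp
qed

lemma iter_deriv_cmult:
  fixes f :: "real^'n::finite \<Rightarrow> complex"
  assumes "open S" "smooth_on S f" "x \<in> S"
  shows "iter_deriv \<alpha> (\<lambda>x. c * f x) x = c * iter_deriv \<alpha> f x"
  using iter_deriv_bounded_linear[OF assms(1,2) bounded_linear_mult_right assms(3)] .

lemma smooth_on_cmult:
  fixes f :: "real^'n::finite \<Rightarrow> complex"
  assumes "open S" "smooth_on S f"
  shows "smooth_on S (\<lambda>x. c * f x)"
  using smooth_on_bounded_linear[OF assms bounded_linear_mult_right] .

lemma iter_deriv_add:
  fixes f g :: "real^'n::finite \<Rightarrow> complex"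
  assumes S: "open S" and f: "smooth_on S f" and g: "smooth_on S g" and x: "x \<in> S"
  shows "iter_deriv \<alpha> (\<lambda>x. f x + g x) x = iter_deriv \<alpha> f x + iter_deriv \<alpha> g x"
  using x
proof (induction \<alpha> arbitrary: x)
  case (Cons i \<alpha>)
  note df = has_derivative_partial_deriv[OF smooth_on_differentiable[OF f Cons.prems], of \<alpha>]
   and dg = has_derivative_partial_deriv[OF smooth_on_differentiable[OF g Cons.prems], of \<alpha>]
  have "partial_deriv i (iter_deriv \<alpha> (\<lambda>x. f x + g x)) x
      = partial_deriv i (\<lambda>x. iter_deriv \<alpha> f x + iter_deriv \<alpha> g x) x"
    by (rule partial_deriv_cong_open[OF S Cons.prems]) (rule Cons.IH)
  also have "\<dots> = partial_deriv i (iter_deriv \<alpha> f) x + partial_deriv i (iter_deriv \<alpha> g) x"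
    using partial_deriv_eq[OF has_derivative_add[OF df dg], of i] partial_deriv_eq[OF df, of i]
      partial_deriv_eq[OF dg, of i] by simp
  finally show ?case by simp
qed auto

lemma smooth_on_add:
  fixes f g :: "real^'n::finite \<Rightarrow> complex"
  assumes S: "open S" and f: "smooth_on S f" and g: "smooth_on S g"
  shows "smooth_on S (\<lambda>x. f x + g x)"
  unfolding smooth_on_def
proof (intro allI ballI)
  fix \<alpha> x assume x: "x \<in> S"
  have "(\<lambda>x. iter_deriv \<alpha> f x + iter_deriv \<alpha> g x) differentiable (at x)"
    using smooth_on_differentiable[OF f x] smooth_on_differentiable[OF g x]
    by (intro differentiable_add)
  then show "iter_deriv \<alpha> (\<lambda>x. f x + g x) differentiable (at x)"
    using differentiable_cong_open[OF S x, of "iter_deriv \<alpha> (\<lambda>x. f x + g x)"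
        "\<lambda>x. iter_deriv \<alpha> f x + iter_deriv \<alpha> g x"]
      iter_deriv_add[OF S f g] by simp
qed

lemma smooth_on_sum:
  fixes f :: "'i \<Rightarrow> real^'n::finite \<Rightarrow> complex"
  assumes "open S" "\<And>i. i \<in> I \<Longrightarrow> smooth_on S (f i)"
  shows "smooth_on S (\<lambda>x. \<Sum>i\<in>I. f i x)"
  using assms(2) by (induction I rule: infinite_finite_induct) (auto intro!: smooth_on_add[OF assms(1)])

lemma iter_deriv_sum:
  fixes f :: "'i \<Rightarrow> real^'n::finite \<Rightarrow> complex"
  assumes "open S" "\<And>i. i \<in> I \<Longrightarrow> smooth_on S (f i)" "x \<in> S"
  shows "iter_deriv \<alpha> (\<lambda>x. \<Sum>i\<in>I. f i x) x = (\<Sum>i\<in>I. iter_deriv \<alpha> (f i) x)"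
  using assms(2)
proof (induction I rule: infinite_finite_induct)
  case (insert j I)
  then show ?case
    by (simp add: iter_deriv_add[OF assms(1) _ smooth_on_sum[OF assms(1)] assms(3)])
qed (auto simp: iter_deriv_const)

lemma smooth_on_diff:
  fixes f g :: "real^'n::finite \<Rightarrow> complex"
  assumes "open S" "smooth_on S f" "smooth_on S g"
  shows "smooth_on S (\<lambda>x. f x - g x)"
  using smooth_on_add[OF assms(1,2) smooth_on_cmult[OF assms(1,3), of "-1"]] by simp

lemma iter_deriv_diff:
  fixes f g :: "real^'n::finite \<Rightarrow> complex"
  assumes "open S" "smooth_on S f" "smooth_on S g" "x \<in> S"
  shows "iter_deriv \<alpha> (\<lambda>x. f x - g x) x = iter_deriv \<alpha> f x - iter_deriv \<alpha> g x"
  using iter_deriv_add[OF assms(1,2) smooth_on_cmult[OF assms(1,3), of "-1"] assms(4), of \<alpha>]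
    iter_deriv_cmult[OF assms(1,3,4), of \<alpha> "-1"] by simp

section \<open>Translations, dilations and reflections\<close>

lemma has_derivative_affine:
  fixes f :: "real^'n::finite \<Rightarrow> complex"
  assumes "f differentiable (at (c *\<^sub>R x + b))"
  shows "((\<lambda>x. f (c *\<^sub>R x + b)) has_derivative
    (\<lambda>h. \<Sum>i\<in>UNIV. (c * h $ i) *\<^sub>R partial_deriv i f (c *\<^sub>R x + b))) (at x)"
proof -
  have "((\<lambda>x. c *\<^sub>R x + b) has_derivative (\<lambda>h. c *\<^sub>R h)) (at x)"
    by (auto intro!: derivative_eq_intros)
  from has_derivative_compose[OF this has_derivative_partial_deriv[OF assms]]
  show ?thesis by simp
qed

lemma partial_deriv_affine:
  fixes f :: "real^'n::finite \<Rightarrow> complex"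
  assumes "f differentiable (at (c *\<^sub>R x + b))"
  shows "partial_deriv i (\<lambda>x. f (c *\<^sub>R x + b)) x = of_real c * partial_deriv i f (c *\<^sub>R x + b)"
proof -
  have *: "(\<Sum>j\<in>UNIV. (c * axis i 1 $ j) *\<^sub>R partial_deriv j f (c *\<^sub>R x + b))
    = (\<Sum>j\<in>UNIV. if j = i then c *\<^sub>R partial_deriv j f (c *\<^sub>R x + b) else 0)"
    by (intro sum.cong) (auto simp: axis_def)
  show ?thesis
    unfolding partial_deriv_eq[OF has_derivative_affine[OF assms]] *
    by (simp add: scaleR_conv_of_real)
qed

lemma iter_deriv_affine:
  fixes f :: "real^'n::finite \<Rightarrow> complex"
  assumes f: "smooth_on UNIV f"
  shows "iter_deriv \<alpha> (\<lambda>x. f (c *\<^sub>R x + b)) = (\<lambda>x. of_real c ^ length \<alpha> * iter_deriv \<alpha> f (c *\<^sub>R x + b))"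
proof (induction \<alpha>)
  case (Cons i \<alpha>)
  have "iter_deriv (i # \<alpha>) (\<lambda>x. f (c *\<^sub>R x + b)) x
     = of_real c ^ length (i # \<alpha>) * iter_deriv (i # \<alpha>) f (c *\<^sub>R x + b)" for x
  proof -
    note d = smooth_on_differentiable[OF f, of _ \<alpha>, simplified]
    have d': "(\<lambda>x. iter_deriv \<alpha> f (c *\<^sub>R x + b)) differentiable (at x)"
      using has_derivative_affine[OF d] by (auto simp: differentiable_def)
    note D = has_derivative_partial_deriv[OF d']
    have "partial_deriv i (\<lambda>x. of_real c ^ length \<alpha> * iter_deriv \<alpha> f (c *\<^sub>R x + b)) x
        = of_real c ^ length \<alpha> * partial_deriv i (\<lambda>x. iter_deriv \<alpha> f (c *\<^sub>R x + b)) x"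
      using partial_deriv_eq[OF has_derivative_mult_right[OF D, of "of_real c ^ length \<alpha>"], of i]
        partial_deriv_eq[OF D, of i] by simp
    then show ?thesis
      by (simp add: Cons partial_deriv_affine[OF d])
  qed
  then show ?case by blast
qed simp

lemma smooth_on_affine:
  fixes f :: "real^'n::finite \<Rightarrow> complex"
  assumes f: "smooth_on UNIV f"
  shows "smooth_on UNIV (\<lambda>x. f (c *\<^sub>R x + b))"
  unfolding smooth_on_def iter_deriv_affine[OF f]
proof (intro allI ballI)
  fix \<alpha> x
  have "(\<lambda>x. iter_deriv \<alpha> f (c *\<^sub>R x + b)) differentiable (at x)"
    using has_derivative_affine[OF smooth_on_differentiable[OF f UNIV_I], of \<alpha> c b x]
    unfolding differentiable_def by blast
  then show "(\<lambda>x. of_real c ^ length \<alpha> * iter_deriv \<alpha> f (c *\<^sub>R x + b)) differentiable (at x)"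
    by (intro differentiable_mult) auto
qed

text \<open>All ways of sending each derivative of a list to one of two factors. Repetitions are
  kept, so the binomial coefficients of the Leibniz rule appear as multiplicities.\<close>

primrec splits :: "'n list \<Rightarrow> ('n list \<times> 'n list) list" where
  "splits [] = [([], [])]"
| "splits (i # \<alpha>) = map (\<lambda>(\<beta>, \<gamma>). (i # \<beta>, \<gamma>)) (splits \<alpha>) @ map (\<lambda>(\<beta>, \<gamma>). (\<beta>, i # \<gamma>)) (splits \<alpha>)"

lemma length_splits: "length (splits \<alpha>) = 2 ^ length \<alpha>"
  by (induction \<alpha>) auto

lemma splits_length: "(\<beta>, \<gamma>) \<in> set (splits \<alpha>) \<Longrightarrow> length \<beta> + length \<gamma> = length \<alpha>"
  by (induction \<alpha> arbitrary: \<beta> \<gamma>) auto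

lemma has_derivative_sum_list:
  assumes "\<And>a. a \<in> set as \<Longrightarrow> (f a has_derivative f' a) F"
  shows "((\<lambda>x. \<Sum>a\<leftarrow>as. f a x) has_derivative (\<lambda>h. \<Sum>a\<leftarrow>as. f' a h)) F"
  using assms by (induction as) (auto intro!: has_derivative_add)

lemma sum_axis_scaleR:
  fixes c :: "'n::finite \<Rightarrow> complex"
  shows "(\<Sum>j\<in>UNIV. axis i 1 $ j *\<^sub>R c j) = c i"
proof -
  have "(\<Sum>j\<in>UNIV. axis i 1 $ j *\<^sub>R c j) = (\<Sum>j\<in>UNIV. if j = i then c j else 0)"
    by (intro sum.cong) (auto simp: axis_def)
  then show ?thesis by simp
qed

text \<open>Only derivatives up to order \<open>L\<close> are assumed, because the induction for
  reciprocals knows no more than that at each stage. Formula and differentiability are proved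
  together: the step differentiates the formula.\<close>

lemma iter_deriv_mult_aux:
  fixes f g :: "real^'n::finite \<Rightarrow> complex"
  assumes S: "open S"
    and f: "\<And>\<beta> y. length \<beta> \<le> L \<Longrightarrow> y \<in> S \<Longrightarrow> iter_deriv \<beta> f differentiable (at y)"
    and g: "\<And>\<beta> y. length \<beta> \<le> L \<Longrightarrow> y \<in> S \<Longrightarrow> iter_deriv \<beta> g differentiable (at y)"
    and "length \<alpha> \<le> L" "x \<in> S"
  shows "iter_deriv \<alpha> (\<lambda>x. f x * g x) x = (\<Sum>(\<beta>, \<gamma>)\<leftarrow>splits \<alpha>. iter_deriv \<beta> f x * iter_deriv \<gamma> g x)
    \<and> iter_deriv \<alpha> (\<lambda>x. f x * g x) differentiable (at x)"
  using assms(4,5)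
proof (induction \<alpha> arbitrary: x)
  have D: "((\<lambda>x. \<Sum>(\<beta>, \<gamma>)\<leftarrow>splits \<alpha>. iter_deriv \<beta> f x * iter_deriv \<gamma> g x) has_derivative
      (\<lambda>h. \<Sum>(\<beta>, \<gamma>)\<leftarrow>splits \<alpha>. iter_deriv \<beta> f x * (\<Sum>i\<in>UNIV. h $ i *\<^sub>R partial_deriv i (iter_deriv \<gamma> g) x)
       + (\<Sum>i\<in>UNIV. h $ i *\<^sub>R partial_deriv i (iter_deriv \<beta> f) x) * iter_deriv \<gamma> g x)) (at x)"
    if "x \<in> S" "length \<alpha> \<le> L" for x \<alpha>
    unfolding case_prod_beta
    using splits_length[of _ _ \<alpha>] that
    by (intro has_derivative_sum_list has_derivative_mult has_derivative_partial_deriv f g that)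
      (force dest: splits_length)+
  {
    case Nil
    show ?case
      using differentiable_mult[OF f[of "[]" x] g[of "[]" x]] Nil by simp
  next
    case (Cons i \<alpha>)
    have eq: "iter_deriv (i # \<alpha>) (\<lambda>x. f x * g x) x
      = (\<Sum>(\<beta>, \<gamma>)\<leftarrow>splits (i # \<alpha>). iter_deriv \<beta> f x * iter_deriv \<gamma> g x)" if "x \<in> S" for x
    proof -
      have "iter_deriv (i # \<alpha>) (\<lambda>x. f x * g x) x
        = partial_deriv i (\<lambda>x. \<Sum>(\<beta>, \<gamma>)\<leftarrow>splits \<alpha>. iter_deriv \<beta> f x * iter_deriv \<gamma> g x) x"
        unfolding iter_deriv.simps
        by (rule partial_deriv_cong_open[OF S that]) (use Cons.IH Cons.prems in auto)
      \<comment> \<open>The product rule turns each term into two, with \<open>i\<close> going to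
        one factor or the other; these are the two halves of
        \<open>splits (i # \<alpha>)\<close>.\<close>
      also have "\<dots> = (\<Sum>(\<beta>, \<gamma>)\<leftarrow>splits (i # \<alpha>). iter_deriv \<beta> f x * iter_deriv \<gamma> g x)"
        using Cons.prems
        by (subst partial_deriv_eq[OF D[OF that]])
          (auto simp: sum_axis_scaleR o_def case_prod_unfold sum_list_addf add.commute)
      finally show ?thesis .
    qed
    moreover have "iter_deriv (i # \<alpha>) (\<lambda>x. f x * g x) differentiable (at x)"
    proof -
      have "(\<lambda>x. \<Sum>(\<beta>, \<gamma>)\<leftarrow>splits (i # \<alpha>). iter_deriv \<beta> f x * iter_deriv \<gamma> g x) differentiable (at x)"
        using D[of x "i # \<alpha>"] Cons.prems unfolding differentiable_def by blast
      then show ?thesis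
        using differentiable_cong_open[of S x "iter_deriv (i # \<alpha>) (\<lambda>x. f x * g x)"
            "\<lambda>x. \<Sum>(\<beta>, \<gamma>)\<leftarrow>splits (i # \<alpha>). iter_deriv \<beta> f x * iter_deriv \<gamma> g x"] S Cons.prems eq
        by blast
    qed
    ultimately show ?case using Cons.prems by blast
  }
qed

lemma iter_deriv_mult:
  fixes f g :: "real^'n::finite \<Rightarrow> complex"
  assumes "open S" "smooth_on S f" "smooth_on S g" "x \<in> S"
  shows "iter_deriv \<alpha> (\<lambda>x. f x * g x) x = (\<Sum>(\<beta>, \<gamma>)\<leftarrow>splits \<alpha>. iter_deriv \<beta> f x * iter_deriv \<gamma> g x)"
  using iter_deriv_mult_aux[OF assms(1) smooth_on_differentiable[OF assms(2)]
      smooth_on_differentiable[OF assms(3)] order.refl assms(4)] by blast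

lemma smooth_on_mult:
  fixes f g :: "real^'n::finite \<Rightarrow> complex"
  assumes "open S" "smooth_on S f" "smooth_on S g"
  shows "smooth_on S (\<lambda>x. f x * g x)"
  using iter_deriv_mult_aux[OF assms(1) smooth_on_differentiable[OF assms(2)]
      smooth_on_differentiable[OF assms(3)] order.refl] by (auto simp: smooth_on_def)

text \<open>A bootstrap: the formula for the first partials expresses derivatives of 1/p of order
  \<open>L + 1\<close> by derivatives of order \<open>L\<close> of a product of two copies of 1/p
  with a partial of \<open>p\<close>.\<close>

lemma
  fixes p :: "real^'n::finite \<Rightarrow> complex"
  assumes S: "open S" and p: "smooth_on S p" and nz: "\<And>x. x \<in> S \<Longrightarrow> p x \<noteq> 0"
  shows partial_deriv_inverse:
      "x \<in> S \<Longrightarrow> partial_deriv i (\<lambda>x. inverse (p x)) x = (-1) * (inverse (p x) * (inverse (p x) * partial_deriv i p x))"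
    and smooth_on_inverse: "smooth_on S (\<lambda>x. inverse (p x))"
proof -
  have D: "((\<lambda>x. inverse (p x)) has_derivative
      (\<lambda>h. - (inverse (p x) * (\<Sum>i\<in>UNIV. h $ i *\<^sub>R partial_deriv i p x) * inverse (p x)))) (at x)"
    if "x \<in> S" for x
    using Deriv.has_derivative_inverse[OF nz[OF that] has_derivative_partial_deriv[OF smooth_on_differentiable[OF p that, of "[]", simplified]]]
    by simp
  have pd: "partial_deriv i (\<lambda>x. inverse (p x)) x = (-1) * (inverse (p x) * (inverse (p x) * partial_deriv i p x))"
    if "x \<in> S" for x i
    unfolding partial_deriv_eq[OF D[OF that]] sum_axis_scaleR by (simp add: algebra_simps)
  then show "x \<in> S \<Longrightarrow> partial_deriv i (\<lambda>x. inverse (p x)) x = (-1) * (inverse (p x) * (inverse (p x) * partial_deriv i p x))" .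
  have d: "length \<alpha> \<le> L \<Longrightarrow> x \<in> S \<Longrightarrow> iter_deriv \<alpha> (\<lambda>x. inverse (p x)) differentiable (at x)" for L \<alpha> x
  proof (induction L arbitrary: \<alpha> x)
    case 0
    then show ?case using D by (auto simp: differentiable_def)
  next
    case (Suc L)
    show ?case
    \<comment> \<open>The last entry of the list is the derivative applied first, and it is this
      innermost one that the formula for the first partials replaces.\<close>
    proof (cases \<alpha> rule: rev_exhaust)
      case Nil
      then show ?thesis using D Suc.prems by (auto simp: differentiable_def)
    next
      case (snoc \<beta> i)
      let ?g = "\<lambda>x. inverse (p x) * partial_deriv i p x"
      have g: "iter_deriv \<gamma> ?g differentiable (at y)" if "length \<gamma> \<le> L" "y \<in> S" for \<gamma> y
        using iter_deriv_mult_aux[OF S Suc.IH smooth_on_differentiable[OF smooth_on_partial_deriv[OF p]] that] by blast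
      have h: "iter_deriv \<gamma> (\<lambda>x. inverse (p x) * ?g x) differentiable (at y)" if "length \<gamma> \<le> L" "y \<in> S" for \<gamma> y
        using iter_deriv_mult_aux[OF S Suc.IH g that] by blast
      have "iter_deriv \<beta> (\<lambda>x. (-1) * (inverse (p x) * ?g x)) differentiable (at x)"
        by (rule iter_deriv_mult_aux[THEN conjunct2, OF S smooth_on_differentiable[OF smooth_on_const] h])
          (use Suc.prems snoc in auto)
      moreover have "iter_deriv \<beta> (partial_deriv i (\<lambda>x. inverse (p x))) y
          = iter_deriv \<beta> (\<lambda>x. (-1) * (inverse (p x) * ?g x)) y" if "y \<in> S" for y
        using S that pd by (rule iter_deriv_cong_open)
      ultimately have "iter_deriv \<beta> (partial_deriv i (\<lambda>x. inverse (p x))) differentiable (at x)"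
        using differentiable_cong_open[OF S Suc.prems(2)] by blast
      then show ?thesis by (simp add: snoc iter_deriv_append)
    qed
  qed
  then show "smooth_on S (\<lambda>x. inverse (p x))"
    by (auto simp: smooth_on_def)
qed

section \<open>Symbol estimates\<close>

lemma japanese_ge_1: "1 \<le> japanese x"
  by (simp add: japanese_def)

lemma japanese_pos [simp]: "0 < japanese x"
  using japanese_ge_1[of x] by linarith

lemma japanese_neq_0 [simp]: "japanese x \<noteq> 0"
  using japanese_pos[of x] by (metis less_irrefl)

lemma japanese_nonneg [simp]: "0 \<le> japanese x"
  using japanese_pos[of x] by (rule less_imp_le)

lemma japanese_powr_pos: "0 < japanese x powr m"
  by simp

lemma norm_le_japanese: "norm x \<le> japanese x"
  unfolding japanese_def by (rule real_le_rsqrt) simp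

lemma japanese_sq: "(japanese x)\<^sup>2 = 1 + (norm x)\<^sup>2"
  by (simp add: japanese_def add_nonneg_nonneg)

text \<open>A form of Peetre's inequality with a crude constant; it moves polynomial weights across
  translations.\<close>

lemma japanese_add_le: "japanese (x + y) \<le> 2 * japanese x * japanese y"
proof (rule power2_le_imp_le)
  have "norm (x + y) ^ 2 \<le> (norm x + norm y) ^ 2"
    by (intro power_mono norm_triangle_ineq) auto
  also have "\<dots> \<le> 2 * (norm x)\<^sup>2 + 2 * (norm y)\<^sup>2"
    using sum_squares_bound[of "norm x" "norm y"] by (simp add: power2_sum)
  finally have "1 + (norm (x + y))\<^sup>2 \<le> 4 * ((1 + (norm x)\<^sup>2) * (1 + (norm y)\<^sup>2))"
    using mult_nonneg_nonneg[of "(norm x)\<^sup>2" "(norm y)\<^sup>2"] zero_le_power2[of "norm x"]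
      zero_le_power2[of "norm y"] by (simp add: distrib_left distrib_right, linarith)
  moreover have "(2 * japanese x * japanese y)\<^sup>2 = 4 * ((1 + (norm x)\<^sup>2) * (1 + (norm y)\<^sup>2))"
    unfolding power_mult_distrib japanese_sq by (simp add: algebra_simps)
  ultimately show "(japanese (x + y))\<^sup>2 \<le> (2 * japanese x * japanese y)\<^sup>2"
    by (simp only: japanese_sq)
  show "0 \<le> 2 * japanese x * japanese y"
    using japanese_pos[of x] japanese_pos[of y] by simp
qed

lemma continuous_on_japanese [continuous_intros]: "continuous_on S japanese"
  unfolding japanese_def by (intro continuous_intros)

lemma continuous_on_japanese_powr [continuous_intros]: "continuous_on S (\<lambda>x. japanese x powr m)"
  by (intro continuous_intros) (metis japanese_pos less_irrefl)

lemma japanese_powr_mono: "m \<le> m' \<Longrightarrow> japanese x powr m \<le> japanese x powr m'"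
  using japanese_ge_1[of x] by (intro powr_mono) auto

text \<open>The symbol estimate at a single point, with one constant for all orders up to
  \<open>L\<close>. Being pointwise, it can be used outside a ball, where 1/p exists, and combined
  with vanishing inside it.\<close>

definition sym_bound :: "nat \<Rightarrow> real \<Rightarrow> real \<Rightarrow> (real^'n::finite \<Rightarrow> complex) \<Rightarrow> real^'n \<Rightarrow> bool" where
  "sym_bound L m A f x \<longleftrightarrow>
     (\<forall>\<alpha>. length \<alpha> \<le> L \<longrightarrow> norm (iter_deriv \<alpha> f x) \<le> A * japanese x powr (m - real (length \<alpha>)))"

lemma sym_boundD:
  "sym_bound L m A f x \<Longrightarrow> length \<alpha> \<le> L \<Longrightarrow>
     norm (iter_deriv \<alpha> f x) \<le> A * japanese x powr (m - real (length \<alpha>))"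
  by (simp add: sym_bound_def)

lemma sym_bound_nonneg: "sym_bound L m A f x \<Longrightarrow> 0 \<le> A"
  using sym_boundD[of L m A f x "[]"] norm_ge_zero[of "f x"] japanese_powr_pos[of x m]
  by (simp, metis mult_neg_pos not_less order_trans)

lemma sym_bound_mono:
  assumes "sym_bound L m A f x" "L' \<le> L" "m \<le> m'" "A \<le> A'"
  shows "sym_bound L' m' A' f x"
  unfolding sym_bound_def
proof (intro allI impI)
  fix \<alpha> :: "'a list" assume \<alpha>: "length \<alpha> \<le> L'"
  have "norm (iter_deriv \<alpha> f x) \<le> A * japanese x powr (m - real (length \<alpha>))"
    using sym_boundD[OF assms(1)] \<alpha> assms(2) by simp
  also have "\<dots> \<le> A' * japanese x powr (m' - real (length \<alpha>))"
    using assms(3,4) sym_bound_nonneg[OF assms(1)] japanese_powr_mono[of "m - length \<alpha>" "m' - length \<alpha>" x]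
    by (intro mult_mono) auto
  finally show "norm (iter_deriv \<alpha> f x) \<le> A' * japanese x powr (m' - real (length \<alpha>))" .
qed

lemma sym_bound_cong_open:
  assumes "open S" "x \<in> S" "\<And>y. y \<in> S \<Longrightarrow> f y = g y"
  shows "sym_bound L m A f x \<longleftrightarrow> sym_bound L m A g x"
  using iter_deriv_cong_open[OF assms] by (simp add: sym_bound_def)

lemma sym_bound_zero: "0 \<le> A \<Longrightarrow> sym_bound L m A (\<lambda>_. 0) x"
  by (simp add: sym_bound_def iter_deriv_const)

lemma sym_bound_const: "sym_bound L 0 (norm c) (\<lambda>_. c) x"
  by (simp add: sym_bound_def iter_deriv_const)

lemma sym_bound_iter_deriv:
  assumes "sym_bound (L + length \<beta>) m A f x"
  shows "sym_bound L (m - real (length \<beta>)) A (iter_deriv \<beta> f) x"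
  unfolding sym_bound_def
proof (intro allI impI)
  fix \<alpha> :: "'a list" assume "length \<alpha> \<le> L"
  then show "norm (iter_deriv \<alpha> (iter_deriv \<beta> f) x) \<le> A * japanese x powr (m - real (length \<beta>) - real (length \<alpha>))"
    using sym_boundD[OF assms, of "\<alpha> @ \<beta>"] by (simp add: iter_deriv_append algebra_simps)
qed

text \<open>Splits off the innermost derivative; this is the form in which a formula for the first
  partials feeds an induction on \<open>L\<close>.\<close>

lemma sym_bound_Suc:
  assumes "norm (f x) \<le> A * japanese x powr m" "\<And>i. sym_bound L (m - 1) A (partial_deriv i f) x"
  shows "sym_bound (Suc L) m A f x"
  unfolding sym_bound_def
proof (intro allI impI)
  fix \<alpha> :: "'a list" assume \<alpha>: "length \<alpha> \<le> Suc L"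
  show "norm (iter_deriv \<alpha> f x) \<le> A * japanese x powr (m - real (length \<alpha>))"
  proof (cases \<alpha> rule: rev_exhaust)
    case Nil
    then show ?thesis using assms(1) by simp
  next
    case (snoc \<beta> i)
    then show ?thesis
      using sym_boundD[OF assms(2)[of i], of \<beta>] \<alpha> by (simp add: iter_deriv_append algebra_simps)
  qed
qed

lemma sym_bound_add:
  assumes "open S" "smooth_on S f" "smooth_on S g" "x \<in> S"
    and f: "sym_bound L m A f x" and g: "sym_bound L m B g x"
  shows "sym_bound L m (A + B) (\<lambda>x. f x + g x) x"
  unfolding sym_bound_def iter_deriv_add[OF assms(1-4)]
  using sym_boundD[OF f] sym_boundD[OF g]
  by (auto intro!: order.trans[OF norm_triangle_ineq] add_mono simp: distrib_right)

lemma sym_bound_sum: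
  assumes "open S" "\<And>i. i \<in> I \<Longrightarrow> smooth_on S (f i)" "x \<in> S"
    and f: "\<And>i. i \<in> I \<Longrightarrow> sym_bound L m (A i) (f i) x"
  shows "sym_bound L m (\<Sum>i\<in>I. A i) (\<lambda>x. \<Sum>i\<in>I. f i x) x"
  using assms(2,4)
proof (induction I rule: infinite_finite_induct)
  case (insert i I)
  have "sym_bound L m (A i + (\<Sum>i\<in>I. A i)) (\<lambda>x. f i x + (\<Sum>i\<in>I. f i x)) x"
    using insert by (intro sym_bound_add[OF assms(1) _ smooth_on_sum[OF assms(1)] assms(3)]) auto
  with insert show ?case by simp
qed (auto simp: sym_bound_zero)

lemma sym_bound_cmult:
  assumes "open S" "smooth_on S f" "x \<in> S" and f: "sym_bound L m A f x"
  shows "sym_bound L m (norm c * A) (\<lambda>x. c * f x) x"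
  unfolding sym_bound_def iter_deriv_cmult[OF assms(1-3)]
  using sym_boundD[OF f] by (auto simp: norm_mult mult.assoc intro!: mult_left_mono)

lemma norm_sum_list_le:
  assumes "\<And>a. a \<in> set as \<Longrightarrow> norm (f a) \<le> (B::real)"
  shows "norm (\<Sum>a\<leftarrow>as. f a) \<le> real (length as) * B"
  using assms
proof (induction as)
  case (Cons a as)
  have "norm (f a + (\<Sum>a\<leftarrow>as. f a)) \<le> B + real (length as) * B"
    using Cons by (intro order.trans[OF norm_triangle_ineq] add_mono) auto
  then show ?case by (simp add: distrib_right)
qed auto

text \<open>At most 2^L Leibniz terms occur. In each of them the two losses of order add up to the
  length of the multi-index, so no decay is wasted.\<close>

lemma sym_bound_mult:
  assumes "open S" "smooth_on S f" "smooth_on S g" "x \<in> S"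
    and f: "sym_bound L m A f x" and g: "sym_bound L m' B g x"
  shows "sym_bound L (m + m') (2 ^ L * A * B) (\<lambda>x. f x * g x) x"
  unfolding sym_bound_def
proof (intro allI impI)
  fix \<alpha> :: "'a list" assume \<alpha>: "length \<alpha> \<le> L"
  define J where "J = A * B * japanese x powr (m + m' - real (length \<alpha>))"
  have AB: "0 \<le> A" "0 \<le> B" using sym_bound_nonneg f g by blast+
  have "norm (iter_deriv \<alpha> (\<lambda>x. f x * g x) x)
      \<le> real (length (splits \<alpha>)) * J"
    unfolding iter_deriv_mult[OF assms(1-4)]
  proof (intro norm_sum_list_le, safe)
    fix \<beta> \<gamma> assume *: "(\<beta>, \<gamma>) \<in> set (splits \<alpha>)"
    note len = splits_length[OF *]
    have "norm (iter_deriv \<beta> f x * iter_deriv \<gamma> g x)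
       \<le> (A * japanese x powr (m - real (length \<beta>))) * (B * japanese x powr (m' - real (length \<gamma>)))"
      unfolding norm_mult using len \<alpha> AB
      by (intro mult_mono sym_boundD[OF f] sym_boundD[OF g]) auto
    also have "\<dots> = J"
      using len by (simp add: J_def powr_add[symmetric] algebra_simps flip: len)
    finally show "norm (iter_deriv \<beta> f x * iter_deriv \<gamma> g x) \<le> J" .
  qed
  also have "\<dots> \<le> 2 ^ L * J"
    using \<alpha> AB by (intro mult_right_mono) (auto simp: length_splits J_def)
  finally show "norm (iter_deriv \<alpha> (\<lambda>x. f x * g x) x)
      \<le> 2 ^ L * A * B * japanese x powr (m + m' - real (length \<alpha>))"
    by (simp add: J_def mult.assoc)
qed

lemma
  fixes i :: "'n::finite"
  shows sym_bound_coord: "sym_bound L 1 1 (\<lambda>x. of_real (x $ i)) x"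
    and smooth_on_coord: "smooth_on UNIV (\<lambda>x. of_real (x $ i))"
proof -
  have D: "((\<lambda>x::real^'n. complex_of_real (x $ i)) has_derivative (\<lambda>h. of_real (h $ i))) (at x)" for x
    by (intro bounded_linear_imp_has_derivative bounded_linear_compose[OF bounded_linear_of_real]
        bounded_linear_vec_nth)
  have d: "partial_deriv j (\<lambda>x. of_real (x $ i)) = (\<lambda>_. if i = j then 1 else 0)" for j
    by (rule ext, subst partial_deriv_eq[OF D]) (simp add: axis_def eq_commute)
  have d1: "iter_deriv (\<alpha> @ [j]) (\<lambda>x. of_real (x $ i)) = (\<lambda>_. if \<alpha> = [] \<and> i = j then 1 else 0)" for \<alpha> j
    by (auto intro!: ext simp: iter_deriv_append d iter_deriv_const)
  have "iter_deriv \<alpha> (\<lambda>x. of_real (x $ i)) differentiable (at x)" for \<alpha> and x :: "real^'n"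
    by (cases \<alpha> rule: rev_exhaust) (use D in \<open>auto simp: d1 differentiable_def\<close>)
  then show "smooth_on UNIV (\<lambda>x. of_real (x $ i))"
    by (simp add: smooth_on_def)
  have "norm (iter_deriv \<alpha> (\<lambda>x. of_real (x $ i)) x) \<le> 1 * japanese x powr (1 - real (length \<alpha>))" for \<alpha>
    using order.trans[OF component_le_norm_cart norm_le_japanese, of x i]
    by (cases \<alpha> rule: rev_exhaust) (auto simp: d1)
  then show "sym_bound L 1 1 (\<lambda>x. of_real (x $ i)) x"
    by (simp add: sym_bound_def)
qed

text \<open>The derivatives of \<open>1 / p\<close> are controlled through \<open>\<partial>\<^sub>i (1 / p) = - (1 / p)\<^sup>2 \<partial>\<^sub>i p\<close>.\<close>

lemma sym_bound_inverse:
  fixes p :: "real^'n::finite \<Rightarrow> complex"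
  assumes S: "open S" and p: "smooth_on S p" and c: "0 < c"
    and low: "\<And>x. x \<in> S \<Longrightarrow> c * japanese x powr m \<le> norm (p x)"
    and up: "\<And>x. x \<in> S \<Longrightarrow> sym_bound L m A p x"
  shows "\<exists>B. \<forall>x\<in>S. sym_bound L (- m) B (\<lambda>x. inverse (p x)) x"
  using up
proof (induction L)
  have nz: "p x \<noteq> 0" if "x \<in> S" for x
  proof -
    have "0 < c * japanese x powr m" using c by (intro mult_pos_pos) auto
    then show ?thesis using low[OF that] by auto
  qed
  have inv: "norm (inverse (p x)) \<le> (1/c) * japanese x powr - m" if "x \<in> S" for x
  proof -
    have "inverse (norm (p x)) \<le> inverse (c * japanese x powr m)"
      using c by (intro le_imp_inverse_le low[OF that] mult_pos_pos) auto
    then show ?thesis by (simp add: norm_inverse powr_minus divide_inverse)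
  qed
  {
    case 0
    show ?case
      using inv by (auto simp: sym_bound_def intro!: exI[of _ "1/c"])
  next
    case (Suc L)
    have upL: "sym_bound L m A p x" if "x \<in> S" for x
      using sym_bound_mono[OF Suc.prems[OF that]] by simp
    obtain B where B: "\<And>x. x \<in> S \<Longrightarrow> sym_bound L (- m) B (\<lambda>x. inverse (p x)) x"
      using Suc.IH[OF upL] by blast
    note si = smooth_on_inverse[OF S p nz]
    \<comment> \<open>The first entry bounds 1/p itself; the second is the constant produced by two
      uses of the product estimate on a product of three factors.\<close>
    define B' where "B' = max (1/c) (2 ^ L * B * (2 ^ L * B * A))"
    have "sym_bound (Suc L) (- m) B' (\<lambda>x. inverse (p x)) x" if x: "x \<in> S" for x
    proof (rule sym_bound_Suc)
      have "norm (inverse (p x)) \<le> (1/c) * japanese x powr - m" by (rule inv[OF x])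
      also have "\<dots> \<le> B' * japanese x powr - m" by (intro mult_right_mono) (auto simp: B'_def)
      finally show "norm (inverse (p x)) \<le> B' * japanese x powr - m" .
      fix i
      have pi: "sym_bound L (m - 1) A (partial_deriv i p) x"
        using sym_bound_iter_deriv[of L "[i]" m A p x] Suc.prems[OF x] by simp
      note sp = smooth_on_partial_deriv[OF p, of i]
      have 1: "sym_bound L (- m + (m - 1)) (2 ^ L * B * A) (\<lambda>x. inverse (p x) * partial_deriv i p x) x"
        by (rule sym_bound_mult[OF S si sp x B[OF x] pi])
      have 2: "sym_bound L (- m + (- m + (m - 1))) (2 ^ L * B * (2 ^ L * B * A))
          (\<lambda>x. inverse (p x) * (inverse (p x) * partial_deriv i p x)) x"
        by (rule sym_bound_mult[OF S si smooth_on_mult[OF S si sp] x B[OF x] 1])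
      have 3: "sym_bound L (- m + (- m + (m - 1))) (norm (-1::complex) * (2 ^ L * B * (2 ^ L * B * A)))
          (\<lambda>x. (-1) * (inverse (p x) * (inverse (p x) * partial_deriv i p x))) x"
        by (rule sym_bound_cmult[OF S smooth_on_mult[OF S si smooth_on_mult[OF S si sp]] x 2])
      have 4: "sym_bound L (- m + (- m + (m - 1))) (norm (-1::complex) * (2 ^ L * B * (2 ^ L * B * A)))
          (partial_deriv i (\<lambda>x. inverse (p x))) x"
        using 3 by (subst sym_bound_cong_open[OF S x]) (use partial_deriv_inverse[OF S p nz] in auto)
      \<comment> \<open>The orders -m, -m and m - 1 of the three factors add up to -m - 1.\<close>
      show "sym_bound L (- m - 1) B' (partial_deriv i (\<lambda>x. inverse (p x))) x"
        by (rule sym_bound_mono[OF 4]) (auto simp: B'_def)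
    qed
    then show ?case by blast
  }
qed

section \<open>Symbol classes and the Schwartz space in terms of symbol bounds\<close>

lemma finite_multi_indices: "finite {\<alpha> :: 'n::finite list. length \<alpha> \<le> L}"
  using finite_lists_length_le[of "UNIV :: 'n set"] by simp

lemma symbol_class_sym_bound:
  assumes "p \<in> symbol_class m"
  obtains A where "\<And>x. sym_bound L m A p x"
proof -
  obtain C where C: "\<And>\<alpha> \<xi>. norm (iter_deriv \<alpha> p \<xi>) \<le> C \<alpha> * japanese \<xi> powr (m - real (length \<alpha>))"
    using assms unfolding symbol_class_def by (auto dest!: choice)
  define A where "A = Max (C ` {\<alpha>. length \<alpha> \<le> L})"
  have "sym_bound L m A p x" for x
    unfolding sym_bound_def
  proof (intro allI impI)
    fix \<alpha> :: "'a list" assume "length \<alpha> \<le> L"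
    then have "C \<alpha> \<le> A" unfolding A_def by (intro Max_ge) (auto intro: finite_imageI finite_multi_indices)
    then show "norm (iter_deriv \<alpha> p x) \<le> A * japanese x powr (m - real (length \<alpha>))"
      by (intro order.trans[OF C] mult_right_mono) auto
  qed
  then show ?thesis by (rule that)
qed

lemma smooth_on_symbol_class: "p \<in> symbol_class m \<Longrightarrow> smooth_on UNIV p"
  by (simp add: symbol_class_def)

text \<open>Schwartz functions are the symbols of order minus infinity. In this description, closure
  under the operations follows from the calculus of symbol bounds.\<close>

lemma schwartz_iff_sym_bound:
  "\<phi> \<in> schwartz_space \<longleftrightarrow> smooth_on UNIV \<phi> \<and> (\<forall>L m. \<exists>A. \<forall>x. sym_bound L m A \<phi> x)"
proof safe
  assume \<phi>: "\<phi> \<in> schwartz_space"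
  then show "smooth_on UNIV \<phi>" by (simp add: schwartz_space_def)
  fix L m
  \<comment> \<open>A derivative of order at most \<open>L\<close> is to be bounded by the weight to
    the power \<open>m\<close> minus that order. The worst exponent is \<open>m - L\<close>, so a
    decay of power \<open>k\<close> suffices for all of them.\<close>
  obtain k :: nat where k: "real k \<ge> real L - m" using real_arch_simple by blast
  have "\<exists>A. \<forall>x. norm (japanese x ^ k * norm (iter_deriv \<alpha> \<phi> x)) \<le> A" for \<alpha>
    using \<phi> by (auto simp: schwartz_space_def bounded_iff)
  then obtain A where A: "\<And>\<alpha> x. norm (japanese x ^ k * norm (iter_deriv \<alpha> \<phi> x)) \<le> A \<alpha>"
    by metis
  define B where "B = Max (A ` {\<alpha>. length \<alpha> \<le> L})"
  have "sym_bound L m B \<phi> x" for x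
    unfolding sym_bound_def
  proof (intro allI impI)
    fix \<alpha> :: "'a list" assume \<alpha>: "length \<alpha> \<le> L"
    have "A \<alpha> \<le> B" unfolding B_def using \<alpha> by (intro Max_ge) (auto intro: finite_imageI finite_multi_indices)
    then have 1: "japanese x ^ k * norm (iter_deriv \<alpha> \<phi> x) \<le> B"
      using A[of x \<alpha>] by (auto simp: abs_le_iff)
    then have "0 \<le> B"
      using order.trans[of 0 "japanese x ^ k * norm (iter_deriv \<alpha> \<phi> x)" B] less_imp_le[OF japanese_pos[of x]] by simp
    have "norm (iter_deriv \<alpha> \<phi> x) \<le> B * japanese x powr (- real k)"
      using 1 by (simp add: powr_minus powr_realpow field_simps)
    also have "\<dots> \<le> B * japanese x powr (m - real (length \<alpha>))"
      using k \<alpha> \<open>0 \<le> B\<close> by (intro mult_left_mono japanese_powr_mono) auto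
    finally show "norm (iter_deriv \<alpha> \<phi> x) \<le> B * japanese x powr (m - real (length \<alpha>))" .
  qed
  then show "\<exists>A. \<forall>x. sym_bound L m A \<phi> x" by blast
next
  assume \<phi>: "smooth_on UNIV \<phi>" and b: "\<forall>L m. \<exists>A. \<forall>x. sym_bound L m A \<phi> x"
  have "bounded (range (\<lambda>x. japanese x ^ k * norm (iter_deriv \<alpha> \<phi> x)))" for k \<alpha>
  proof -
    obtain A where A: "\<And>x. sym_bound (length \<alpha>) (real (length \<alpha>) - real k) A \<phi> x" using b by blast
    have "norm (japanese x ^ k * norm (iter_deriv \<alpha> \<phi> x)) \<le> A" for x
      using sym_boundD[OF A, of \<alpha> x] japanese_pos[of x]
      by (simp add: powr_minus powr_realpow field_simps abs_mult)
    then show ?thesis by (auto simp: bounded_iff)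
  qed
  with \<phi> show "\<phi> \<in> schwartz_space" by (simp add: schwartz_space_def)
qed

lemma schwartz_sym_bound:
  assumes "\<phi> \<in> schwartz_space"
  obtains A where "\<And>x. sym_bound L m A \<phi> x"
  using assms unfolding schwartz_iff_sym_bound by blast

lemma schwartz_smooth: "\<phi> \<in> schwartz_space \<Longrightarrow> smooth_on UNIV \<phi>"
  by (simp add: schwartz_space_def)

text \<open>The order may depend on \<open>L\<close>. This admits plane waves, whose derivatives
  gain no decay and which therefore have no order valid for all \<open>L\<close>.\<close>

lemma schwartz_mult_symbol:
  assumes p: "smooth_on UNIV p" and b: "\<And>L. \<exists>m A. \<forall>x. sym_bound L m A p x" and \<phi>: "\<phi> \<in> schwartz_space"
  shows "(\<lambda>x. p x * \<phi> x) \<in> schwartz_space"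
  unfolding schwartz_iff_sym_bound
proof (intro conjI allI)
  show "smooth_on UNIV (\<lambda>x. p x * \<phi> x)"
    by (rule smooth_on_mult[OF open_UNIV p schwartz_smooth[OF \<phi>]])
  fix L m
  obtain m' A where A: "\<And>x. sym_bound L m' A p x" using b by blast
  obtain B where B: "\<And>x. sym_bound L (m - m') B \<phi> x" using schwartz_sym_bound[OF \<phi>] by blast
  show "\<exists>A. \<forall>x. sym_bound L m A (\<lambda>x. p x * \<phi> x) x"
    using sym_bound_mult[OF open_UNIV p schwartz_smooth[OF \<phi>] UNIV_I A B] by auto
qed

lemma schwartz_mult_symbol_class:
  assumes "p \<in> symbol_class m" "\<phi> \<in> schwartz_space"
  shows "(\<lambda>x. p x * \<phi> x) \<in> schwartz_space"
  using assms by (intro schwartz_mult_symbol smooth_on_symbol_class) (assumption | metis symbol_class_sym_bound)+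

lemma schwartz_mult:
  "\<phi> \<in> schwartz_space \<Longrightarrow> \<psi> \<in> schwartz_space \<Longrightarrow> (\<lambda>x. \<phi> x * \<psi> x) \<in> schwartz_space"
  by (rule schwartz_mult_symbol[OF schwartz_smooth]) (assumption | metis schwartz_sym_bound)+

lemma schwartz_coord_mult: "\<phi> \<in> schwartz_space \<Longrightarrow> (\<lambda>x. of_real (x $ i) * \<phi> x) \<in> schwartz_space"
  by (rule schwartz_mult_symbol[OF smooth_on_coord]) (use sym_bound_coord in blast)

lemma schwartz_cmult: "\<phi> \<in> schwartz_space \<Longrightarrow> (\<lambda>x. c * \<phi> x) \<in> schwartz_space"
  by (rule schwartz_mult_symbol[OF smooth_on_const]) (use sym_bound_const in blast)

lemma schwartz_add:
  assumes "\<phi> \<in> schwartz_space" "\<psi> \<in> schwartz_space"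
  shows "(\<lambda>x. \<phi> x + \<psi> x) \<in> schwartz_space"
  unfolding schwartz_iff_sym_bound
proof (intro conjI allI)
  note s = schwartz_smooth[OF assms(1)] schwartz_smooth[OF assms(2)]
  show "smooth_on UNIV (\<lambda>x. \<phi> x + \<psi> x)"
    by (rule smooth_on_add[OF open_UNIV s])
  fix L m
  obtain A where A: "\<And>x. sym_bound L m A \<phi> x" using schwartz_sym_bound[OF assms(1)] by blast
  obtain B where B: "\<And>x. sym_bound L m B \<psi> x" using schwartz_sym_bound[OF assms(2)] by blast
  show "\<exists>A. \<forall>x. sym_bound L m A (\<lambda>x. \<phi> x + \<psi> x) x"
    using sym_bound_add[OF open_UNIV s UNIV_I A B] by auto
qed

lemma schwartz_zero: "(\<lambda>_. 0) \<in> schwartz_space"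
  unfolding schwartz_iff_sym_bound using sym_bound_zero[of 0] by auto

lemma schwartz_sum:
  "(\<And>i. i \<in> I \<Longrightarrow> \<phi> i \<in> schwartz_space) \<Longrightarrow> (\<lambda>x. \<Sum>i\<in>I. \<phi> i x) \<in> schwartz_space"
  by (induction I rule: infinite_finite_induct) (auto simp: schwartz_zero intro!: schwartz_add)

lemma schwartz_diff:
  "\<phi> \<in> schwartz_space \<Longrightarrow> \<psi> \<in> schwartz_space \<Longrightarrow> (\<lambda>x. \<phi> x - \<psi> x) \<in> schwartz_space"
  using schwartz_add[of \<phi> "\<lambda>x. (-1) * \<psi> x"] schwartz_cmult[of \<psi> "-1"] by simp

lemma schwartz_iter_deriv: 
  assumes "\<phi> \<in> schwartz_space"
  shows "iter_deriv \<alpha> \<phi> \<in> schwartz_space"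
  unfolding schwartz_iff_sym_bound
proof (intro conjI allI)
  show "smooth_on UNIV (iter_deriv \<alpha> \<phi>)" by (rule smooth_on_iter_deriv[OF schwartz_smooth[OF assms]])
  fix L m
  obtain A where "\<And>x. sym_bound (L + length \<alpha>) (m + real (length \<alpha>)) A \<phi> x"
    using schwartz_sym_bound[OF assms] by blast
  then show "\<exists>A. \<forall>x. sym_bound L m A (iter_deriv \<alpha> \<phi>) x"
    using sym_bound_iter_deriv[of L \<alpha> "m + real (length \<alpha>)"] by fastforce
qed

lemma schwartz_partial_deriv: "\<phi> \<in> schwartz_space \<Longrightarrow> partial_deriv i \<phi> \<in> schwartz_space"
  using schwartz_iter_deriv[of \<phi> "[i]"] by simp

lemma schwartz_cnj:
  assumes "\<phi> \<in> schwartz_space"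
  shows "(\<lambda>x. cnj (\<phi> x)) \<in> schwartz_space"
  using assms smooth_on_bounded_linear[OF open_UNIV schwartz_smooth[OF assms] bounded_linear_cnj]
    iter_deriv_bounded_linear[OF open_UNIV schwartz_smooth[OF assms] bounded_linear_cnj UNIV_I]
  by (simp add: schwartz_space_def)

text \<open>Undo the affine map: Peetre's inequality removes the shift, and the maximum with 1
  covers dilations and contractions alike.\<close>

lemma japanese_le_affine:
  assumes "c \<noteq> 0"
  shows "japanese x \<le> 2 * max 1 (1 / \<bar>c\<bar>) * japanese b * japanese (c *\<^sub>R x + b)"
proof -
  let ?y = "c *\<^sub>R x + b" and ?M = "max 1 (1 / \<bar>c\<bar>)"
  have s: "japanese ((1/c) *\<^sub>R z) \<le> ?M * japanese z" for z :: "real^'n"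
  proof (rule power2_le_imp_le)
    have "1 \<le> ?M\<^sup>2" by simp
    moreover have "(1 / \<bar>c\<bar>)\<^sup>2 \<le> ?M\<^sup>2" by (intro power_mono) auto
    ultimately have "1 * 1 + (1 / \<bar>c\<bar>)\<^sup>2 * (norm z)\<^sup>2 \<le> ?M\<^sup>2 * 1 + ?M\<^sup>2 * (norm z)\<^sup>2"
      by (intro add_mono mult_right_mono) auto
    then show "(japanese ((1/c) *\<^sub>R z))\<^sup>2 \<le> (?M * japanese z)\<^sup>2"
      by (simp add: japanese_sq power_mult_distrib distrib_left power_divide)
    show "0 \<le> ?M * japanese z" using japanese_pos[of z] by simp
  qed
  have "japanese x = japanese ((1/c) *\<^sub>R (?y + (- b)))"
    using assms by simp
  also have "\<dots> \<le> ?M * japanese (?y + (- b))" by (rule s)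
  also have "\<dots> \<le> ?M * (2 * japanese ?y * japanese (- b))"
    by (intro mult_left_mono japanese_add_le) auto
  finally show ?thesis by (simp add: japanese_def mult_ac)
qed

lemma schwartz_affine:
  assumes \<phi>: "\<phi> \<in> schwartz_space" and c: "c \<noteq> 0"
  shows "(\<lambda>x. \<phi> (c *\<^sub>R x + b)) \<in> schwartz_space"
  unfolding schwartz_space_def
proof (intro CollectI conjI allI)
  note s = schwartz_smooth[OF \<phi>]
  show "smooth_on UNIV (\<lambda>x. \<phi> (c *\<^sub>R x + b))" by (rule smooth_on_affine[OF s])
  fix k \<alpha>
  obtain A where A: "\<And>x. norm (japanese x ^ k * norm (iter_deriv \<alpha> \<phi> x)) \<le> A"
    using \<phi> unfolding schwartz_space_def bounded_iff by blast
  define M where "M = 2 * max 1 (1 / \<bar>c\<bar>) * japanese b"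
  have M0: "0 \<le> M" using japanese_pos[of b] by (simp add: M_def)
  have "norm (japanese x ^ k * norm (iter_deriv \<alpha> (\<lambda>x. \<phi> (c *\<^sub>R x + b)) x)) \<le> M ^ k * (\<bar>c\<bar> ^ length \<alpha> * A)" for x
  proof -
    let ?y = "c *\<^sub>R x + b"
    have "japanese x ^ k \<le> (M * japanese ?y) ^ k"
      using japanese_le_affine[OF c, of x b] less_imp_le[OF japanese_pos] by (intro power_mono) (auto simp: M_def)
    then have "japanese x ^ k * (\<bar>c\<bar> ^ length \<alpha> * norm (iter_deriv \<alpha> \<phi> ?y))
      \<le> (M * japanese ?y) ^ k * (\<bar>c\<bar> ^ length \<alpha> * norm (iter_deriv \<alpha> \<phi> ?y))"
      by (intro mult_right_mono) auto
    also have "\<dots> = M ^ k * (\<bar>c\<bar> ^ length \<alpha> * (japanese ?y ^ k * norm (iter_deriv \<alpha> \<phi> ?y)))"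
      by (simp add: power_mult_distrib)
    also have "\<dots> \<le> M ^ k * (\<bar>c\<bar> ^ length \<alpha> * A)"
      using A[of ?y] M0 by (intro mult_left_mono) (auto simp: abs_le_iff)
    finally show ?thesis
      using less_imp_le[OF japanese_pos[of x]] by (simp add: iter_deriv_affine[OF s] norm_mult norm_power abs_mult)
  qed
  then show "bounded (range (\<lambda>x. japanese x ^ k * norm (iter_deriv \<alpha> (\<lambda>x. \<phi> (c *\<^sub>R x + b)) x)))"
    unfolding bounded_iff by blast
qed

lemma schwartz_translate: "\<phi> \<in> schwartz_space \<Longrightarrow> (\<lambda>x. \<phi> (x - b)) \<in> schwartz_space"
  using schwartz_affine[of \<phi> 1 "- b"] by simp

lemma schwartz_scale: "\<phi> \<in> schwartz_space \<Longrightarrow> c \<noteq> 0 \<Longrightarrow> (\<lambda>x. \<phi> (c *\<^sub>R x)) \<in> schwartz_space"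
  using schwartz_affine[of \<phi> c 0] by simp

lemma schwartz_reflect: "\<phi> \<in> schwartz_space \<Longrightarrow> (\<lambda>x. \<phi> (- x)) \<in> schwartz_space"
  using schwartz_scale[of \<phi> "-1"] by simp

lemma iter_deriv_zero_outside:
  assumes "x \<notin> closure {x. \<phi> x \<noteq> 0}"
  shows "iter_deriv \<alpha> \<phi> x = 0"
proof -
  have "iter_deriv \<alpha> \<phi> x = iter_deriv \<alpha> (\<lambda>_. 0) x"
    using assms closure_subset[of "{x. \<phi> x \<noteq> 0}"]
    by (intro iter_deriv_cong_open[of "- closure {x. \<phi> x \<noteq> 0}"]) auto
  then show ?thesis by (simp add: iter_deriv_const)
qed

lemma test_functions_schwartz:
  assumes "\<phi> \<in> test_functions W"
  shows "\<phi> \<in> schwartz_space"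
proof -
  let ?K = "closure {x. \<phi> x \<noteq> 0}"
  have s: "smooth_on UNIV \<phi>" and K: "compact ?K"
    using assms by (auto simp: test_functions_def)
  have "bounded (range (\<lambda>x. japanese x ^ k * norm (iter_deriv \<alpha> \<phi> x)))" for k \<alpha>
  proof -
    have "continuous_on ?K (\<lambda>x. japanese x ^ k * norm (iter_deriv \<alpha> \<phi> x))"
      by (intro continuous_intros continuous_on_subset[OF smooth_on_continuous_on[OF s]]) auto
    then have "bounded ((\<lambda>x. japanese x ^ k * norm (iter_deriv \<alpha> \<phi> x)) ` ?K)"
      using compact_continuous_image[OF _ K] compact_imp_bounded by blast
    then have "bounded (insert 0 ((\<lambda>x. japanese x ^ k * norm (iter_deriv \<alpha> \<phi> x)) ` ?K))"
      by simp
    then show ?thesis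
    proof (rule bounded_subset, safe)
      fix x assume "japanese x ^ k * norm (iter_deriv \<alpha> \<phi> x) \<notin> (\<lambda>x. japanese x ^ k * norm (iter_deriv \<alpha> \<phi> x)) ` ?K"
      then have "x \<notin> ?K" by blast
      then show "japanese x ^ k * norm (iter_deriv \<alpha> \<phi> x) = 0"
        by (simp add: iter_deriv_zero_outside)
    qed
  qed
  with s show ?thesis by (simp add: schwartz_space_def)
qed

section \<open>Integration of rapidly decreasing functions\<close>

text \<open>Space is covered by concentric balls rather than shells, so each volume is a full power
  n of the radius. The exponent n + 2 leaves the summable series of inverse squares.\<close>

lemma integrable_japanese_powr:
  "integrable lborel (\<lambda>x::real^'n::finite. japanese x powr (- (real CARD('n) + 2)))"
proof (rule integrableI_bounded)
  let ?n = "CARD('n)" and ?J = "\<lambda>x::real^'n. japanese x powr (- (real CARD('n) + 2))"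
  show "?J \<in> borel_measurable lborel"
    using borel_measurable_continuous_onI[OF continuous_on_japanese_powr] by simp
  \<comment> \<open>If the norm of x lies between k and k + 1, then \<open>japanese x\<close> is at
    least (k + 1)/2; \<open>c k\<close> is the resulting bound for the weight.\<close>
  define c where "c k = 2 ^ (?n + 2) * (1 / (real k + 1) ^ (?n + 2))" for k
  have c0: "0 \<le> c k" for k by (simp add: c_def)
  have "ennreal (norm (?J x)) \<le> (\<Sum>k. ennreal (c k) * indicator (cball 0 (real k + 1)) x)" for x
  proof -
    define k where "k = nat \<lfloor>norm x\<rfloor>"
    have k: "real k \<le> norm x" "norm x \<le> real k + 1"
      by (auto simp: k_def)
    \<comment> \<open>For k = 0 the norm gives nothing and \<open>japanese_ge_1\<close> is used; for
      k at least 1, half of k + 1 is at most k.\<close>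
    have "(real k + 1) / 2 \<le> japanese x"
    proof (cases "k = 0")
      case True
      then show ?thesis using japanese_ge_1[of x] by simp
    next
      case False
      then have "(real k + 1) / 2 \<le> real k" by simp
      then show ?thesis using k(1) norm_le_japanese[of x] by linarith
    qed
    then have "inverse (japanese x ^ (?n + 2)) \<le> inverse (((real k + 1) / 2) ^ (?n + 2))"
      by (intro le_imp_inverse_le power_mono) auto
    moreover have "?J x = inverse (japanese x ^ (?n + 2))"
    proof -
      have "- (real ?n + 2) = - real (?n + 2)" by simp
      then show ?thesis by (simp only: powr_minus powr_realpow[OF japanese_pos])
    qed
    moreover have "inverse (((real k + 1) / 2) ^ (?n + 2)) = c k"
      by (simp only: c_def power_divide inverse_divide) simp
    ultimately have "?J x \<le> c k" by simp
    then have "ennreal (norm (?J x)) \<le> ennreal (c k) * indicator (cball 0 (real k + 1)) x"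
      using k by (simp add: ennreal_leI)
    also have "\<dots> \<le> (\<Sum>j. ennreal (c j) * indicator (cball 0 (real j + 1)) x)"
    proof -
      define F where "F j = ennreal (c j) * indicator (cball 0 (real j + 1)) x" for j
      have "sum F {k} \<le> suminf F"
        by (rule sum_le_suminf) auto
      then have "F k \<le> suminf F" by simp
      then show ?thesis unfolding F_def .
    qed
    finally show ?thesis .
  qed
  then have "(\<integral>\<^sup>+ x. ennreal (norm (?J x)) \<partial>lborel)
     \<le> (\<integral>\<^sup>+ x. (\<Sum>k. ennreal (c k) * indicator (cball (0::real^'n) (real k + 1)) x) \<partial>lborel)"
    by (intro nn_integral_mono)
  also have "\<dots> = (\<Sum>k. ennreal (c k) * emeasure lborel (cball (0::real^'n) (real k + 1)))"
    by (subst nn_integral_suminf)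
      (auto simp: nn_integral_cmult_indicator intro!: borel_measurable_times_ennreal borel_measurable_indicator)
  also have "\<dots> = (\<Sum>k. ennreal (2 ^ (?n + 2) * unit_ball_vol (real ?n) * (1 / (real k + 1)\<^sup>2)))"
  proof (intro suminf_cong)
    fix k
    have "c k * (unit_ball_vol (real ?n) * (real k + 1) ^ ?n)
        = 2 ^ (?n + 2) * unit_ball_vol (real ?n) * ((real k + 1) ^ ?n / ((real k + 1) ^ ?n * (real k + 1)\<^sup>2))"
      by (simp add: c_def power_add power2_eq_square)
    also have "(real k + 1) ^ ?n / ((real k + 1) ^ ?n * (real k + 1)\<^sup>2) = 1 / (real k + 1)\<^sup>2"
      by simp
    finally have *: "c k * (unit_ball_vol (real ?n) * (real k + 1) ^ ?n)
        = 2 ^ (?n + 2) * unit_ball_vol (real ?n) * (1 / (real k + 1)\<^sup>2)" .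
    have "ennreal (c k) * emeasure lborel (cball (0::real^'n) (real k + 1))
        = ennreal (c k * (unit_ball_vol (real ?n) * (real k + 1) ^ ?n))"
      using c0 by (subst emeasure_cball) (auto simp: ennreal_mult)
    then show "ennreal (c k) * emeasure lborel (cball (0::real^'n) (real k + 1))
        = ennreal (2 ^ (?n + 2) * unit_ball_vol (real ?n) * (1 / (real k + 1)\<^sup>2))"
      by (simp only: *)
  qed
  also have "\<dots> < \<infinity>"
  proof -
    have "summable (\<lambda>k. 1 / (real (k + 1))\<^sup>2)"
      using inverse_power_summable[of 2, where 'a=real] by (subst summable_iff_shift) (simp add: inverse_eq_divide)
    then have "summable (\<lambda>k. 2 ^ (?n + 2) * unit_ball_vol (real ?n) * (1 / (real k + 1)\<^sup>2))"
      by (intro summable_mult) (simp add: add.commute)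
    then have "(\<Sum>k. ennreal (2 ^ (?n + 2) * unit_ball_vol (real ?n) * (1 / (real k + 1)\<^sup>2))) \<noteq> top"
      by (rule ennreal_suminf_neq_top) auto
    then show ?thesis
      by (simp only: less_top infinity_ennreal_def)
  qed
  finally show "(\<integral>\<^sup>+ x. ennreal (norm (?J x)) \<partial>lborel) < \<infinity>" .
qed

text \<open>Every integral estimate below is against this one majorant, so constants depend on the
  integrand only through \<open>A\<close>, and linearly.\<close>

lemma
  fixes f :: "real^'n::finite \<Rightarrow> complex"
  assumes f: "f \<in> borel_measurable borel"
    and le: "\<And>x. norm (f x) \<le> A * japanese x powr m" and m: "m \<le> - (real CARD('n) + 2)"
  shows integrable_decay: "integrable lborel f"
    and norm_integral_decay: "norm (LINT x|lborel. f x)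
      \<le> A * (LINT x|lborel. japanese (x::real^'n) powr (- (real CARD('n) + 2)))"
proof -
  have "0 \<le> A * japanese (0::real^'n) powr m" using order.trans[OF norm_ge_zero le] .
  then have A: "0 \<le> A" by (simp add: japanese_def)
  have le': "norm (f x) \<le> A * japanese x powr (- (real CARD('n) + 2))" for x
    using A m by (intro order.trans[OF le] mult_left_mono japanese_powr_mono) auto
  have i: "integrable lborel (\<lambda>x::real^'n. A * japanese x powr (- (real CARD('n) + 2)))"
    by (intro integrable_mult_right integrable_japanese_powr)
  show *: "integrable lborel f"
    using f le' A by (intro Bochner_Integration.integrable_bound[OF i]) (auto simp: abs_of_nonneg)
  have "norm (LINT x|lborel. f x) \<le> (LINT x|lborel. norm (f x))"
    by (rule integral_norm_bound)
  also have "\<dots> \<le> (LINT x|lborel. A * japanese (x::real^'n) powr (- (real CARD('n) + 2)))"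
    by (intro integral_mono i integrable_norm * le')
  finally show "norm (LINT x|lborel. f x)
      \<le> A * (LINT x|lborel. japanese (x::real^'n) powr (- (real CARD('n) + 2)))" by simp
qed

lemma schwartz_bound:
  fixes \<phi> :: "real^'n::finite \<Rightarrow> complex"
  assumes "\<phi> \<in> schwartz_space"
  obtains A where "0 \<le> A" "\<And>x. norm (\<phi> x) \<le> A * japanese x powr m"
proof -
  obtain A where A: "\<And>x. sym_bound 0 m A \<phi> x"
    using schwartz_sym_bound[OF assms] by blast
  show thesis
    using that[of A] sym_bound_nonneg[OF A] sym_boundD[OF A, of "[]"] by simp
qed

lemma schwartz_borel:
  "\<phi> \<in> schwartz_space \<Longrightarrow> \<phi> \<in> borel_measurable borel"
  using smooth_on_continuous_on[OF schwartz_smooth, of \<phi> "[]"]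
  by (auto intro: borel_measurable_continuous_onI)

lemma schwartz_continuous_on: "\<phi> \<in> schwartz_space \<Longrightarrow> continuous_on S \<phi>"
  using smooth_on_continuous_on[OF schwartz_smooth, of \<phi> "[]"] continuous_on_subset[of UNIV \<phi> S] by auto

lemma integrable_schwartz: "\<phi> \<in> schwartz_space \<Longrightarrow> integrable lborel \<phi>"
  by (metis schwartz_bound schwartz_borel integrable_decay order.refl)

section \<open>Affine change of variables\<close>

lemma lborel_integral_affine:
  fixes f :: "real^'n::finite \<Rightarrow> complex"
  assumes f: "f \<in> borel_measurable borel" and c: "c \<noteq> 0"
  shows "(LINT x|lborel. f (b + c *\<^sub>R x)) = of_real (1 / \<bar>c\<bar> ^ CARD('n)) * (LINT x|lborel. f x)"
proof -
  have "(LINT x|lborel. f x) = (LINT x|density (distr lborel borel (\<lambda>x. b + c *\<^sub>R x)) (\<lambda>_. \<bar>c\<bar> ^ CARD('n)). f x)"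
    using lborel_affine[OF c, of b] by simp
  also have "\<dots> = (LINT x|lborel. \<bar>c\<bar> ^ CARD('n) *\<^sub>R f (b + c *\<^sub>R x))"
    using f by (subst integral_density) (auto simp: integral_distr)
  also have "\<dots> = \<bar>c\<bar> ^ CARD('n) *\<^sub>R (LINT x|lborel. f (b + c *\<^sub>R x))"
    by simp
  finally show ?thesis
    using c by (simp add: scaleR_conv_of_real)
qed

lemma lborel_integral_translate:
  fixes f :: "real^'n::finite \<Rightarrow> complex"
  assumes f: "f \<in> borel_measurable borel"
  shows "(LINT x|lborel. f (x + b)) = (LINT x|lborel. f x)"
  using lborel_integral_affine[OF f, of 1 b] by (simp add: add.commute)

lemma lborel_integral_uminus:
  fixes f :: "real^'n::finite \<Rightarrow> complex"
  assumes f: "f \<in> borel_measurable borel"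
  shows "(LINT x|lborel. f (- x)) = (LINT x|lborel. f x)"
  using lborel_integral_affine[OF f, of "-1" 0] by simp

section \<open>Mean value and Taylor estimates with explicit constants\<close>

lemma onorm_partials_le:
  fixes c :: "'n::finite \<Rightarrow> complex"
  assumes "\<And>i. norm (c i) \<le> B"
  shows "onorm (\<lambda>h::real^'n. \<Sum>i\<in>UNIV. h $ i *\<^sub>R c i) \<le> real CARD('n) * B"
proof (rule onorm_le)
  fix h :: "real^'n"
  have "norm (\<Sum>i\<in>UNIV. h $ i *\<^sub>R c i) \<le> (\<Sum>i\<in>(UNIV::'n set). norm h * B)"
    using assms by (intro sum_norm_le) (auto intro!: mult_mono component_le_norm_cart)
  then show "norm (\<Sum>i\<in>UNIV. h $ i *\<^sub>R c i) \<le> real CARD('n) * B * norm h"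
    by (simp add: mult_ac)
qed

lemma smooth_lipschitz:
  fixes f :: "real^'n::finite \<Rightarrow> complex"
  assumes f: "smooth_on UNIV f" and S: "convex S" "x \<in> S" "y \<in> S"
    and B: "\<And>i z. z \<in> S \<Longrightarrow> norm (partial_deriv i f z) \<le> B"
  shows "norm (f x - f y) \<le> real CARD('n) * B * norm (x - y)"
proof (rule differentiable_bound[OF S(1) _ _ S(2,3)])
  fix z assume "z \<in> S"
  show "(f has_derivative (\<lambda>h. \<Sum>i\<in>UNIV. h $ i *\<^sub>R partial_deriv i f z)) (at z within S)"
    using has_derivative_partial_deriv[of f z] smooth_on_differentiable[OF f, of z "[]"]
    by (simp add: has_derivative_at_withinI)
  show "onorm (\<lambda>h. \<Sum>i\<in>UNIV. h $ i *\<^sub>R partial_deriv i f z) \<le> real CARD('n) * B"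
    by (rule onorm_partials_le[OF B[OF \<open>z \<in> S\<close>]])
qed

text \<open>The mean value inequality is used twice, for the first partials and then for
  \<open>f\<close> minus its linearization. Each use costs a factor n for the operator norm, hence
  the square in the constant.\<close>

lemma smooth_taylor:
  fixes f :: "real^'n::finite \<Rightarrow> complex"
  assumes f: "smooth_on UNIV f" and S: "convex S" "x \<in> S" "y \<in> S"
    and B: "\<And>i j z. z \<in> S \<Longrightarrow> norm (partial_deriv i (partial_deriv j f) z) \<le> B"
  shows "norm (f y - f x - (\<Sum>i\<in>UNIV. (y - x) $ i *\<^sub>R partial_deriv i f x))
     \<le> (real CARD('n))\<^sup>2 * B * (norm (y - x))\<^sup>2"
proof -
  \<comment> \<open>On the segment, no point is farther from \<open>x\<close> than \<open>y\<close>
    is, which produces the second factor \<open>norm (y - x)\<close>.\<close>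
  define T where "T = closed_segment x y"
  have TS: "T \<subseteq> S" using S by (simp add: T_def closed_segment_subset)
  have 1: "x + t *\<^sub>R (y - x) \<in> T" if "t \<in> {0..1}" for t
    using that unfolding T_def by (auto simp: in_segment algebra_simps intro!: exI[of _ t])
  have 2: "(f has_derivative (\<lambda>h. \<Sum>i\<in>UNIV. h $ i *\<^sub>R partial_deriv i f z)) (at z within T)" for z
    using has_derivative_partial_deriv[of f z] smooth_on_differentiable[OF f, of z "[]"]
    by (simp add: has_derivative_at_withinI)
  have 3: "onorm ((\<lambda>h. \<Sum>i\<in>UNIV. h $ i *\<^sub>R partial_deriv i f z) - (\<lambda>h. \<Sum>i\<in>UNIV. h $ i *\<^sub>R partial_deriv i f x))
     \<le> real CARD('n) * (real CARD('n) * B * norm (y - x))" if "z \<in> T" for z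
  proof -
    have "0 \<le> B" using B[OF S(2)] order.trans[OF norm_ge_zero] by blast
    have "norm (partial_deriv i f z - partial_deriv i f x) \<le> real CARD('n) * B * norm (y - x)" for i
    proof -
      have "norm (partial_deriv i f z - partial_deriv i f x) \<le> real CARD('n) * B * norm (z - x)"
        using TS that by (intro smooth_lipschitz[OF smooth_on_partial_deriv[OF f] S(1)] B S(2)) auto
      also have "\<dots> \<le> real CARD('n) * B * norm (y - x)"
        using that \<open>0 \<le> B\<close> segment_bound(1)[of z x y] unfolding T_def
        by (intro mult_left_mono) (auto simp: norm_minus_commute)
      finally show ?thesis .
    qed
    from onorm_partials_le[of "\<lambda>i. partial_deriv i f z - partial_deriv i f x", OF this]
    show ?thesis by (simp add: fun_diff_def scaleR_diff_right sum_subtractf)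
  qed
  have "norm (f y - f x - (\<Sum>i\<in>UNIV. (y - x) $ i *\<^sub>R partial_deriv i f x))
     \<le> norm (y - x) * (real CARD('n) * (real CARD('n) * B * norm (y - x)))"
    by (rule differentiable_bound_linearization[OF 1 2 3]) (auto simp: T_def)
  then show ?thesis by (simp add: power2_eq_square mult_ac)
qed

lemma japanese_powr_shift:
  assumes "0 \<le> k"
  shows "japanese y powr - k \<le> (2 * japanese (x - y)) powr k * japanese x powr - k"
proof -
  have "japanese x \<le> 2 * japanese (x - y) * japanese y"
    using japanese_add_le[of "x - y" y] by simp
  then have "japanese x powr k \<le> (2 * japanese (x - y)) powr k * japanese y powr k"
    using assms powr_mono2[of k "japanese x" "2 * japanese (x - y) * japanese y"] by (simp add: powr_mult)
  moreover have "0 < japanese x powr k" "0 < japanese y powr k" by simp_all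
  ultimately show ?thesis by (simp add: powr_minus field_simps)
qed

text \<open>Within distance 1 the weight of the difference is at most 2, so Peetre's inequality
  costs the factor (2 * 2)^k.\<close>

lemma japanese_powr_near:
  assumes "0 \<le> k" "norm (x - y) \<le> 1"
  shows "japanese y powr - k \<le> 4 powr k * japanese x powr - k"
proof -
  have "japanese (x - y) \<le> 2"
    unfolding japanese_def using assms(2) power_le_one[of "norm (x - y)" 2] 
    by (intro real_le_lsqrt) auto
  then have "(2 * japanese (x - y)) powr k \<le> 4 powr k"
    using assms(1) by (intro powr_mono2) auto
  then show ?thesis
    using japanese_powr_shift[OF assms(1), of y x] mult_right_mono[of _ _ "japanese x powr - k"]
    by (meson order.trans powr_ge_zero)
qed

text \<open>Asking only for \<epsilon> at most 1 lets the increments of a Taylor expansion stay in a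
  unit ball.\<close>

lemma eq_0_if_norm_le_mult:
  fixes d :: "'a::real_normed_vector"
  assumes "\<And>\<epsilon>. 0 < \<epsilon> \<Longrightarrow> \<epsilon> \<le> 1 \<Longrightarrow> norm d \<le> \<epsilon> * Z"
  shows "d = 0"
proof -
  have "(\<lambda>n. inverse (real (Suc n)) * Z) \<longlonglongrightarrow> 0 * Z"
    by (intro tendsto_mult tendsto_const LIMSEQ_inverse_real_of_nat)
  moreover have "norm d \<le> inverse (real (Suc n)) * Z" for n
    by (rule assms) (simp_all add: inverse_le_1_iff)
  ultimately have "norm d \<le> 0 * Z"
    by (intro LIMSEQ_le_const) auto
  then show ?thesis by simp
qed

text \<open>By translation invariance, \<open>t \<integral> \<partial>\<^sub>i \<phi>\<close> is the integral of a second order Taylor remainder,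
  hence \<open>O(t\<^sup>2)\<close>.\<close>

lemma integral_partial_deriv_schwartz:
  fixes \<phi> :: "real^'n::finite \<Rightarrow> complex"
  assumes \<phi>: "\<phi> \<in> schwartz_space"
  shows "(LINT x|lborel. partial_deriv i \<phi> x) = 0"
proof -
  define k where "k = real CARD('n) + 2"
  obtain A where A: "\<And>x. sym_bound 2 (- k) A \<phi> x"
    using schwartz_sym_bound[OF \<phi>] by blast
  have A0: "0 \<le> A" using sym_bound_nonneg[OF A] .
  define M where "M = (real CARD('n))\<^sup>2 * (A * 4 powr k)"
  define J where "J = (LINT x|lborel. japanese (x::real^'n) powr - k)"
  have "norm (LINT x|lborel. partial_deriv i \<phi> x) \<le> t * (M * J)" if t: "0 < t" "t \<le> 1" for t
  proof -
    let ?f = "\<lambda>x. \<phi> (x + t *\<^sub>R axis i 1) - \<phi> x - t *\<^sub>R partial_deriv i \<phi> x"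
    have s: "(\<lambda>x. \<phi> (x + t *\<^sub>R axis i 1)) \<in> schwartz_space"
      using schwartz_affine[OF \<phi>, of 1] by simp
    have "norm (LINT x|lborel. ?f x) \<le> M * t\<^sup>2 * J"
      unfolding J_def k_def
    proof (rule norm_integral_decay[OF _ _ order.refl])
      have "(\<lambda>x. \<phi> (x + t *\<^sub>R axis i 1) - \<phi> x - of_real t * partial_deriv i \<phi> x) \<in> schwartz_space"
        by (intro schwartz_diff schwartz_cmult schwartz_partial_deriv \<phi> s)
      then show "?f \<in> borel_measurable borel"
        unfolding scaleR_conv_of_real by (rule schwartz_borel)
      fix x :: "real^'n"
      let ?y = "x + t *\<^sub>R axis i 1"
      have "(\<Sum>j\<in>UNIV. (?y - x) $ j *\<^sub>R partial_deriv j \<phi> x) = t *\<^sub>R partial_deriv i \<phi> x"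
        using arg_cong[OF sum_axis_scaleR[of i "\<lambda>j. partial_deriv j \<phi> x"], of "(*\<^sub>R) t"]
        by (simp add: scaleR_sum_right)
      moreover have "norm (\<phi> ?y - \<phi> x - (\<Sum>j\<in>UNIV. (?y - x) $ j *\<^sub>R partial_deriv j \<phi> x))
          \<le> (real CARD('n))\<^sup>2 * (A * (4 powr k * japanese x powr - k)) * (norm (?y - x))\<^sup>2"
      \<comment> \<open>As t is at most 1, the segment stays in the unit ball about
        \<open>x\<close>. The decay of the second derivatives there can be expressed by the weight
        at \<open>x\<close>, which makes the remainder integrable.\<close>
      proof (rule smooth_taylor[OF schwartz_smooth[OF \<phi>] convex_cball[of x 1]])
        fix j l z assume z: "z \<in> cball x 1"
        have "norm (partial_deriv j (partial_deriv l \<phi>) z) \<le> A * japanese z powr (- k - 2)"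
          using sym_boundD[OF A, of "[j, l]" z] by simp
        also have "\<dots> \<le> A * japanese z powr - k"
          by (intro mult_left_mono japanese_powr_mono A0) auto
        also have "\<dots> \<le> A * (4 powr k * japanese x powr - k)"
          using z by (intro mult_left_mono japanese_powr_near A0) (auto simp: k_def dist_norm)
        finally show "norm (partial_deriv j (partial_deriv l \<phi>) z) \<le> A * (4 powr k * japanese x powr - k)" .
      qed (use t in \<open>auto simp: dist_norm\<close>)
      ultimately show "norm (?f x) \<le> M * t\<^sup>2 * japanese x powr - (real CARD('n) + 2)"
        by (simp add: M_def k_def mult_ac)
    qed
    also have "(LINT x|lborel. ?f x) = - (t *\<^sub>R (LINT x|lborel. partial_deriv i \<phi> x))"
      using integrable_schwartz[OF \<phi>] integrable_schwartz[OF s] integrable_schwartz[OF schwartz_partial_deriv[OF \<phi>]]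
        lborel_integral_translate[OF schwartz_borel[OF \<phi>]] by simp
    finally show ?thesis
      using t by (simp add: power2_eq_square mult_ac)
  qed
  then show ?thesis by (rule eq_0_if_norm_le_mult)
qed

section \<open>The Fourier transform on the Schwartz space\<close>

definition plane_wave :: "real^'n::finite \<Rightarrow> real^'n \<Rightarrow> complex" where
  "plane_wave a x = exp (\<i> * of_real (a \<bullet> x))"

text \<open>The constant is attached to every factor: with \<i> this is the multiplier of an
  iterated derivative, with -\<i> the factor by which differentiating a Fourier transform multiplies
  the integrand.\<close>

definition monomial :: "complex \<Rightarrow> 'n::finite list \<Rightarrow> real^'n \<Rightarrow> complex" where
  "monomial c \<alpha> x = (\<Prod>i\<leftarrow>\<alpha>. c * of_real (x $ i))"

definition laplace :: "(real^'n::finite \<Rightarrow> complex) \<Rightarrow> real^'n \<Rightarrow> complex" where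
  "laplace f x = (\<Sum>i\<in>UNIV. partial_deriv i (partial_deriv i f) x)"

lemma monomial_Nil [simp]: "monomial c [] x = 1"
  and monomial_Cons [simp]: "monomial c (i # \<alpha>) x = c * of_real (x $ i) * monomial c \<alpha> x"
  by (simp_all add: monomial_def)

lemma norm_plane_wave [simp]: "norm (plane_wave a x) = 1"
  by (simp add: plane_wave_def norm_exp_i_times)

lemma plane_wave_add: "plane_wave a (x + y) = plane_wave a x * plane_wave a y"
  by (simp add: plane_wave_def inner_add_right exp_add ring_distribs)

lemma plane_wave_add_left: "plane_wave (a + b) x = plane_wave a x * plane_wave b x"
  by (simp add: plane_wave_def inner_add_left exp_add ring_distribs)

lemma cnj_plane_wave: "cnj (plane_wave a x) = plane_wave (- a) x"
  by (simp add: plane_wave_def exp_cnj)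

lemma fourier_plane_wave: "fourier \<phi> \<xi> = (LINT x|lborel. plane_wave (- \<xi>) x * \<phi> x)"
  by (simp add: fourier_def plane_wave_def inner_commute)

lemma iter_deriv_plane_wave: "iter_deriv \<alpha> (plane_wave a) = (\<lambda>x. monomial \<i> \<alpha> a * plane_wave a x)"
  and smooth_on_plane_wave: "smooth_on UNIV (plane_wave a)"
proof -
  have D: "(plane_wave a has_derivative (\<lambda>h. (\<i> * of_real (a \<bullet> h)) * plane_wave a x)) (at x)" for x
  proof -
    have "((\<lambda>x. \<i> * of_real (a \<bullet> x)) has_derivative (\<lambda>h. \<i> * of_real (a \<bullet> h))) (at x)"
      by (intro bounded_linear_imp_has_derivative bounded_linear_compose[OF bounded_linear_mult_right]
          bounded_linear_compose[OF bounded_linear_of_real] bounded_linear_inner_right)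
    from has_derivative_compose[OF this, of exp "(*) (exp (\<i> * of_real (a \<bullet> x)))"]
    show ?thesis
      using DERIV_exp[of "\<i> * complex_of_real (a \<bullet> x)"]
      by (simp add: has_field_derivative_def plane_wave_def[abs_def] mult.commute)
  qed
  have pd: "partial_deriv i (\<lambda>x. c * plane_wave a x) x = c * ((\<i> * of_real (a $ i)) * plane_wave a x)" for i c x
    using partial_deriv_eq[OF has_derivative_mult_right[OF D, of c]] by (simp add: inner_axis)
  show it: "iter_deriv \<alpha> (plane_wave a) = (\<lambda>x. monomial \<i> \<alpha> a * plane_wave a x)" for \<alpha>
    by (induction \<alpha>) (auto intro!: ext simp: pd)
  show "smooth_on UNIV (plane_wave a)"
    unfolding smooth_on_def it
    using has_derivative_mult_right[OF D] by (fastforce simp: differentiable_def)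
qed

lemma norm_monomial_le: "norm c = 1 \<Longrightarrow> norm (monomial c \<alpha> x) \<le> japanese x ^ length \<alpha>"
proof (induction \<alpha>)
  case (Cons i \<alpha>)
  then show ?case
    using order.trans[OF component_le_norm_cart norm_le_japanese, of x i]
    by (auto simp: norm_mult intro!: mult_mono)
qed simp

text \<open>Derivatives of a plane wave stay bounded but do not decay. Order \<open>L\<close> keeps
  the exponent nonnegative for all multi-indices of length at most \<open>L\<close>.\<close>

lemma sym_bound_plane_wave: "sym_bound L (real L) (japanese a ^ L) (plane_wave a) x"
  unfolding sym_bound_def
proof (intro allI impI)
  fix \<alpha> :: "'a list" assume \<alpha>: "length \<alpha> \<le> L"
  have "norm (iter_deriv \<alpha> (plane_wave a) x) \<le> japanese a ^ length \<alpha> * 1"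
    by (simp add: iter_deriv_plane_wave norm_mult norm_monomial_le)
  also have "\<dots> \<le> japanese a ^ L * japanese x powr (real L - real (length \<alpha>))"
    using \<alpha> japanese_ge_1 by (intro mult_mono power_increasing ge_one_powr_ge_zero) auto
  finally show "norm (iter_deriv \<alpha> (plane_wave a) x) \<le> japanese a ^ L * japanese x powr (real L - real (length \<alpha>))" .
qed

lemma schwartz_plane_wave_mult: "\<phi> \<in> schwartz_space \<Longrightarrow> (\<lambda>x. plane_wave a x * \<phi> x) \<in> schwartz_space"
  by (rule schwartz_mult_symbol[OF smooth_on_plane_wave]) (use sym_bound_plane_wave in blast)

lemma smooth_on_monomial: "smooth_on UNIV (monomial c \<alpha>)"
  and sym_bound_monomial: "norm c = 1 \<Longrightarrow> sym_bound L (real (length \<alpha>)) (2 ^ (L * length \<alpha>)) (monomial c \<alpha>) x"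
proof -
  have eq: "monomial c [] = (\<lambda>_. 1)" "monomial c (i # \<alpha>) = (\<lambda>x. (c * of_real (x $ i)) * monomial c \<alpha> x)" for i \<alpha>
    by auto
  note s1 = smooth_on_cmult[OF open_UNIV smooth_on_coord, of c]
  show s: "smooth_on UNIV (monomial c \<alpha>)" for \<alpha>
    by (induction \<alpha>) (auto simp only: eq intro!: smooth_on_const smooth_on_mult[OF open_UNIV s1])
  assume c: "norm c = 1"
  have b: "sym_bound L 1 1 (\<lambda>x. c * of_real (x $ i)) x" for i
  proof -
    have "sym_bound L 1 (norm c * 1) (\<lambda>x. c * of_real (x $ i)) x"
      by (rule sym_bound_cmult[OF open_UNIV smooth_on_coord UNIV_I sym_bound_coord])
    then show ?thesis using c by simp
  qed
  show "sym_bound L (real (length \<alpha>)) (2 ^ (L * length \<alpha>)) (monomial c \<alpha>) x"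
  proof (induction \<alpha>)
    case Nil
    then show ?case using sym_bound_const[of L 1 x] by (simp add: eq)
  next
    case (Cons i \<alpha>)
    show ?case
      unfolding eq using sym_bound_mult[OF open_UNIV s1 s UNIV_I b[of i] Cons]
      by (simp add: power_add add.commute)
  qed
qed

lemma schwartz_monomial_mult:
  assumes "norm c = 1" "\<phi> \<in> schwartz_space"
  shows "(\<lambda>x. monomial c \<alpha> x * \<phi> x) \<in> schwartz_space"
  by (rule schwartz_mult_symbol[OF smooth_on_monomial _ assms(2)]) (use sym_bound_monomial[OF assms(1)] in blast)

lemma schwartz_laplace: "\<phi> \<in> schwartz_space \<Longrightarrow> laplace \<phi> \<in> schwartz_space"
  unfolding laplace_def[abs_def] by (intro schwartz_sum schwartz_partial_deriv)

lemma schwartz_laplace_funpow: "\<phi> \<in> schwartz_space \<Longrightarrow> (laplace ^^ k) \<phi> \<in> schwartz_space"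
  by (induction k) (auto intro: schwartz_laplace)

lemma sym_bound_laplace:
  fixes f :: "real^'n::finite \<Rightarrow> complex"
  assumes f: "smooth_on UNIV f" and b: "sym_bound (L + 2) m A f x"
  shows "sym_bound L (m - 2) (real CARD('n) * A) (laplace f) x"
proof -
  have "sym_bound L (m - 2) A (partial_deriv i (partial_deriv i f)) x" for i
    using sym_bound_iter_deriv[of L "[i, i]" m A f x] b by simp
  moreover have "smooth_on UNIV (partial_deriv i (partial_deriv i f))" for i
    by (intro smooth_on_partial_deriv f)
  ultimately show ?thesis
    unfolding laplace_def[abs_def]
    using sym_bound_sum[OF open_UNIV, of UNIV "\<lambda>i. partial_deriv i (partial_deriv i f)" x L "m - 2" "\<lambda>_. A"] by simp
qed

text \<open>Each Laplacian consumes two of the available derivatives, sums over n directions and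
  improves the order by two.\<close>

lemma sym_bound_laplace_funpow:
  fixes f :: "real^'n::finite \<Rightarrow> complex"
  assumes f: "f \<in> schwartz_space" and b: "sym_bound (L + 2 * k) m A f x"
  shows "sym_bound L (m - 2 * real k) (real CARD('n) ^ k * A) ((laplace ^^ k) f) x"
  using b
proof (induction k arbitrary: L)
  case (Suc k)
  have "sym_bound (L + 2) (m - 2 * real k) (real CARD('n) ^ k * A) ((laplace ^^ k) f) x"
    using Suc.IH[of "L + 2"] Suc.prems by (simp add: add_ac)
  from sym_bound_laplace[OF schwartz_smooth[OF schwartz_laplace_funpow[OF f]] this]
  show ?case by (simp add: algebra_simps)
qed simp

text \<open>A quadratic remainder survives multiplication by a constant. Differentiation under an
  integral or under a distribution thus needs only an estimate for increments of norm at most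
  1.\<close>

lemma has_derivative_quadratic:
  fixes f :: "'a::real_normed_vector \<Rightarrow> 'b::real_normed_vector"
  assumes D: "bounded_linear D"
    and le: "\<And>h. norm h \<le> 1 \<Longrightarrow> norm (f (x + h) - f x - D h) \<le> C * (norm h)\<^sup>2"
  shows "(f has_derivative D) (at x)"
proof (rule has_derivativeI_sandwich[where e=1 and H="\<lambda>y. C * norm (y - x)"])
  show "((\<lambda>y. C * norm (y - x)) \<longlongrightarrow> 0) (at x)"
    by (auto intro!: tendsto_eq_intros)
  fix y assume y: "y \<noteq> x" "dist y x < 1"
  then have "norm (f y - f x - D (y - x)) \<le> C * (norm (y - x))\<^sup>2"
    using le[of "y - x"] by (simp add: dist_norm)
  then show "norm (f y - f x - D (y - x)) / norm (y - x) \<le> C * norm (y - x)"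
    using y by (simp add: divide_le_eq power2_eq_square mult_ac)
qed (use D in auto)

lemma norm_exp_i_minus_linear:
  "norm (exp (\<i> * of_real t) - 1 - \<i> * of_real t) \<le> t\<^sup>2"
  using Taylor_exp[of "\<i> * of_real t" 1] by (simp add: norm_mult power2_eq_square algebra_simps)

section \<open>The Fourier transform and differentiation\<close>

lemma integrable_schwartz_wave:
  "\<phi> \<in> schwartz_space \<Longrightarrow> integrable lborel (\<lambda>x. plane_wave a x * \<phi> x)"
  by (intro integrable_schwartz schwartz_plane_wave_mult)

lemma fourier_cmult: "fourier (\<lambda>x. c * \<phi> x) \<xi> = c * fourier \<phi> \<xi>"
proof -
  have "fourier (\<lambda>x. c * \<phi> x) \<xi> = (LINT x|lborel. c * (plane_wave (- \<xi>) x * \<phi> x))"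
    unfolding fourier_plane_wave by (intro Bochner_Integration.integral_cong) auto
  then show ?thesis by (simp add: fourier_plane_wave)
qed

lemma fourier_sum:
  assumes "\<And>i. i \<in> I \<Longrightarrow> \<phi> i \<in> schwartz_space"
  shows "fourier (\<lambda>x. \<Sum>i\<in>I. \<phi> i x) \<xi> = (\<Sum>i\<in>I. fourier (\<phi> i) \<xi>)"
  unfolding fourier_plane_wave sum_distrib_left
  using integrable_schwartz_wave[OF assms] by (subst Bochner_Integration.integral_sum) auto

lemma fourier_diff:
  assumes "\<phi> \<in> schwartz_space" "\<psi> \<in> schwartz_space"
  shows "fourier (\<lambda>x. \<phi> x - \<psi> x) \<xi> = fourier \<phi> \<xi> - fourier \<psi> \<xi>"
  unfolding fourier_plane_wave right_diff_distrib
  using integrable_schwartz_wave[OF assms(1)] integrable_schwartz_wave[OF assms(2)]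
  by (subst Bochner_Integration.integral_diff) auto

lemma has_derivative_fourier:
  fixes \<phi> :: "real^'n::finite \<Rightarrow> complex"
  assumes \<phi>: "\<phi> \<in> schwartz_space"
  shows "(fourier \<phi> has_derivative
    (\<lambda>h. \<Sum>i\<in>UNIV. h $ i *\<^sub>R fourier (\<lambda>x. (- \<i> * of_real (x $ i)) * \<phi> x) \<xi>)) (at \<xi>)"
proof -
  let ?D = "\<lambda>h. \<Sum>i\<in>UNIV. h $ i *\<^sub>R fourier (\<lambda>x. (- \<i> * of_real (x $ i)) * \<phi> x) \<xi>"
  have s: "(\<lambda>x. (- \<i> * of_real (x $ i)) * \<phi> x) \<in> schwartz_space" for i
    using schwartz_cmult[OF schwartz_coord_mult[OF \<phi>], of "-\<i>" i] by (simp add: mult.assoc)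
  \<comment> \<open>The two extra powers of decay pay for the square of h \<bullet> x left by the
    second order remainder of the exponential.\<close>
  obtain A where A: "0 \<le> A" "\<And>x. norm (\<phi> x) \<le> A * japanese x powr (- (real CARD('n) + 2) - 2)"
    using schwartz_bound[OF \<phi>] by blast
  define J where "J = (LINT x|lborel. japanese (x::real^'n) powr (- (real CARD('n) + 2)))"
  show ?thesis
  proof (rule has_derivative_quadratic[where C="A * J"])
    show "bounded_linear ?D"
      by (intro bounded_linear_sum bounded_linear_scaleR_left[THEN bounded_linear_compose] bounded_linear_vec_nth)
    fix h :: "real^'n"
    have Dh: "?D h = (LINT x|lborel. plane_wave (- \<xi>) x * ((- \<i> * of_real (h \<bullet> x)) * \<phi> x))"
    proof -
      have "?D h = (LINT x|lborel. (\<Sum>i\<in>UNIV. h $ i *\<^sub>R (plane_wave (- \<xi>) x * ((- \<i> * of_real (x $ i)) * \<phi> x))))"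
        unfolding fourier_plane_wave integral_scaleR_right[symmetric]
        by (rule Bochner_Integration.integral_sum[symmetric])
          (intro integrable_scaleR_right integrable_schwartz_wave s)
      also have "\<dots> = (LINT x|lborel. plane_wave (- \<xi>) x * ((- \<i> * of_real (h \<bullet> x)) * \<phi> x))"
        by (intro Bochner_Integration.integral_cong)
          (auto simp: inner_vec_def scaleR_conv_of_real sum_distrib_left sum_distrib_right sum_negf mult_ac)
      finally show ?thesis .
    qed
    have sh: "(\<lambda>x. (- \<i> * of_real (h \<bullet> x)) * \<phi> x) \<in> schwartz_space"
    proof -
      have "(\<lambda>x. (- \<i> * of_real (h \<bullet> x)) * \<phi> x) = (\<lambda>x. \<Sum>i\<in>UNIV. of_real (h $ i) * ((- \<i> * of_real (x $ i)) * \<phi> x))"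
        by (auto simp: inner_vec_def sum_distrib_left sum_distrib_right sum_negf mult_ac)
      then show ?thesis using s by (simp only:) (intro schwartz_sum schwartz_cmult, simp)
    qed
    let ?f = "\<lambda>x. plane_wave (- (\<xi> + h)) x * \<phi> x - plane_wave (- \<xi>) x * \<phi> x
          - plane_wave (- \<xi>) x * ((- \<i> * of_real (h \<bullet> x)) * \<phi> x)"
    have "fourier \<phi> (\<xi> + h) - fourier \<phi> \<xi> - ?D h = (LINT x|lborel. ?f x)"
      unfolding Dh unfolding fourier_plane_wave
      using integrable_schwartz_wave[OF \<phi>] integrable_schwartz_wave[OF sh] by simp
    also have "norm \<dots> \<le> A * (norm h)\<^sup>2 * J"
      unfolding J_def
    proof (rule norm_integral_decay[OF _ _ order.refl])
      show "?f \<in> borel_measurable borel"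
        by (intro borel_measurable_diff schwartz_borel schwartz_plane_wave_mult \<phi> sh)
      fix x :: "real^'n"
      have "?f x = plane_wave (- \<xi>) x * (exp (\<i> * of_real (- (h \<bullet> x))) - 1 - \<i> * of_real (- (h \<bullet> x))) * \<phi> x"
        using plane_wave_add_left[of "- \<xi>" "- h" x]
        by (simp add: plane_wave_def[of "- h"] algebra_simps)
      then have "norm (?f x) = norm (exp (\<i> * of_real (- (h \<bullet> x))) - 1 - \<i> * of_real (- (h \<bullet> x))) * norm (\<phi> x)"
        by (simp only: norm_mult norm_plane_wave mult_1_left)
      also have "\<dots> \<le> (- (h \<bullet> x))\<^sup>2 * norm (\<phi> x)"
        by (intro mult_right_mono norm_exp_i_minus_linear) auto
      also have "\<dots> \<le> (norm h * japanese x)\<^sup>2 * (A * japanese x powr (- (real CARD('n) + 2) - 2))"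
      proof (intro mult_mono A(2))
        have "\<bar>h \<bullet> x\<bar> \<le> norm h * japanese x"
          by (intro order.trans[OF Cauchy_Schwarz_ineq2] mult_left_mono norm_le_japanese) auto
        then show "(- (h \<bullet> x))\<^sup>2 \<le> (norm h * japanese x)\<^sup>2"
          using power_mono[of "\<bar>h \<bullet> x\<bar>" _ 2] by simp
      qed auto
      also have "\<dots> = A * (norm h)\<^sup>2 * (japanese x powr 2 * japanese x powr (- (real CARD('n) + 2) - 2))"
        using powr_realpow[OF japanese_pos[of x], of 2] by (simp add: power_mult_distrib)
      also have "\<dots> = A * (norm h)\<^sup>2 * japanese x powr (- (real CARD('n) + 2))"
        by (simp only: powr_add[symmetric]) (simp add: algebra_simps)
      finally show "norm (?f x) \<le> A * (norm h)\<^sup>2 * japanese x powr (- (real CARD('n) + 2))" .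
    qed
    finally show "norm (fourier \<phi> (\<xi> + h) - fourier \<phi> \<xi> - ?D h) \<le> A * J * (norm h)\<^sup>2"
      by (simp add: mult_ac)
  qed
qed

lemma iter_deriv_fourier:
  assumes \<phi>: "\<phi> \<in> schwartz_space"
  shows "iter_deriv \<alpha> (fourier \<phi>) = fourier (\<lambda>x. monomial (- \<i>) \<alpha> x * \<phi> x)"
proof (induction \<alpha>)
  case (Cons i \<alpha>)
  have s: "(\<lambda>x. monomial (- \<i>) \<alpha> x * \<phi> x) \<in> schwartz_space"
    by (rule schwartz_monomial_mult[OF _ \<phi>]) simp
  show ?case
  proof
    fix \<xi>
    show "iter_deriv (i # \<alpha>) (fourier \<phi>) \<xi> = fourier (\<lambda>x. monomial (- \<i>) (i # \<alpha>) x * \<phi> x) \<xi>"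
      by (simp only: iter_deriv.simps Cons partial_deriv_eq[OF has_derivative_fourier[OF s]]
          sum_axis_scaleR monomial_Cons mult.assoc)
  qed
qed simp

lemma smooth_on_fourier:
  assumes \<phi>: "\<phi> \<in> schwartz_space"
  shows "smooth_on UNIV (fourier \<phi>)"
  unfolding smooth_on_def iter_deriv_fourier[OF \<phi>] differentiable_def
  by (intro allI ballI exI, rule has_derivative_fourier[OF schwartz_monomial_mult[OF _ \<phi>]]) simp

text \<open>Integration by parts: the derivative of the product of \<open>\<phi>\<close> with the
  plane wave has integral zero.\<close>

lemma fourier_partial_deriv:
  fixes \<phi> :: "real^'n::finite \<Rightarrow> complex"
  assumes \<phi>: "\<phi> \<in> schwartz_space"
  shows "fourier (partial_deriv i \<phi>) \<xi> = \<i> * of_real (\<xi> $ i) * fourier \<phi> \<xi>"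
proof -
  have "partial_deriv i (\<lambda>x. plane_wave (- \<xi>) x * \<phi> x) x
     = plane_wave (- \<xi>) x * partial_deriv i \<phi> x - \<i> * of_real (\<xi> $ i) * (plane_wave (- \<xi>) x * \<phi> x)" for x
    using iter_deriv_mult[OF open_UNIV smooth_on_plane_wave schwartz_smooth[OF \<phi>] UNIV_I, of "[i]" "- \<xi>" x]
      iter_deriv_plane_wave[of "[i]" "- \<xi>"]
    by (simp add: algebra_simps)
  then have "(LINT x|lborel. plane_wave (- \<xi>) x * partial_deriv i \<phi> x - \<i> * of_real (\<xi> $ i) * (plane_wave (- \<xi>) x * \<phi> x)) = 0"
    using integral_partial_deriv_schwartz[OF schwartz_plane_wave_mult[OF \<phi>], of i "- \<xi>"] by simp
  then show ?thesis
    unfolding fourier_plane_wave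
    using integrable_schwartz_wave[OF \<phi>, of "- \<xi>"]
      integrable_schwartz_wave[OF schwartz_partial_deriv[OF \<phi>], of "- \<xi>"]
    by (simp add: Bochner_Integration.integral_diff)
qed

lemma fourier_laplace:
  fixes \<phi> :: "real^'n::finite \<Rightarrow> complex"
  assumes \<phi>: "\<phi> \<in> schwartz_space"
  shows "fourier (laplace \<phi>) \<xi> = - of_real ((norm \<xi>)\<^sup>2) * fourier \<phi> \<xi>"
proof -
  have "fourier (laplace \<phi>) \<xi> = (\<Sum>i\<in>UNIV. fourier (partial_deriv i (partial_deriv i \<phi>)) \<xi>)"
    unfolding laplace_def[abs_def] by (intro fourier_sum schwartz_partial_deriv \<phi>)
  also have "\<dots> = (\<Sum>i\<in>UNIV. - of_real ((\<xi> $ i)\<^sup>2) * fourier \<phi> \<xi>)"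
    by (intro sum.cong refl)
      (simp add: fourier_partial_deriv[OF \<phi>] fourier_partial_deriv[OF schwartz_partial_deriv[OF \<phi>]] power2_eq_square mult_ac)
  also have "\<dots> = - of_real ((norm \<xi>)\<^sup>2) * fourier \<phi> \<xi>"
  proof -
    have "(norm \<xi>)\<^sup>2 = (\<Sum>i\<in>UNIV. (\<xi> $ i)\<^sup>2)"
      unfolding power2_norm_eq_inner by (simp add: inner_vec_def power2_eq_square)
    then show ?thesis by (simp add: sum_distrib_right sum_negf)
  qed
  finally show ?thesis .
qed

lemma norm_fourier_laplace_funpow:
  fixes \<phi> :: "real^'n::finite \<Rightarrow> complex"
  assumes \<phi>: "\<phi> \<in> schwartz_space"
  shows "norm (fourier ((laplace ^^ k) \<phi>) \<xi>) = norm \<xi> ^ (2 * k) * norm (fourier \<phi> \<xi>)"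
proof (induction k)
  case (Suc k)
  then show ?case
    by (simp add: fourier_laplace[OF schwartz_laplace_funpow[OF \<phi>]] norm_mult norm_power power2_eq_square mult_ac)
qed simp

text \<open>Decay of \<open>\<partial>\<^sup>\<alpha>(F \<phi>)\<close> away from the origin is bought with symbol estimates of \<open>\<phi>\<close> of any order:
  each Laplacian lowers the order by two.\<close>

lemma fourier_deriv_bound:
  fixes \<phi> :: "real^'n::finite \<Rightarrow> complex"
  assumes \<phi>: "\<phi> \<in> schwartz_space" and A: "\<And>x. sym_bound (2 * k) m A \<phi> x"
    and m: "m + real (length \<alpha>) - 2 * real k \<le> - (real CARD('n) + 2)"
  shows "norm \<xi> ^ (2 * k) * norm (iter_deriv \<alpha> (fourier \<phi>) \<xi>)
    \<le> real CARD('n) ^ k * 2 ^ (2 * k) * 2 ^ (2 * k * length \<alpha>)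
       * (LINT x|lborel. japanese (x::real^'n) powr (- (real CARD('n) + 2))) * A"
proof -
  let ?\<psi> = "\<lambda>x. monomial (- \<i>) \<alpha> x * \<phi> x"
  have \<psi>: "?\<psi> \<in> schwartz_space" by (rule schwartz_monomial_mult[OF _ \<phi>]) simp
  have b: "sym_bound (0 + 2 * k) (real (length \<alpha>) + m) (2 ^ (2 * k) * 2 ^ (2 * k * length \<alpha>) * A) ?\<psi> x" for x
    using sym_bound_mult[OF open_UNIV smooth_on_monomial schwartz_smooth[OF \<phi>] UNIV_I sym_bound_monomial A, of "- \<i>" \<alpha> x]
    by simp
  have "norm \<xi> ^ (2 * k) * norm (iter_deriv \<alpha> (fourier \<phi>) \<xi>) = norm (fourier ((laplace ^^ k) ?\<psi>) \<xi>)"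
    by (simp add: iter_deriv_fourier[OF \<phi>] norm_fourier_laplace_funpow[OF \<psi>])
  also have "\<dots> \<le> (real CARD('n) ^ k * (2 ^ (2 * k) * 2 ^ (2 * k * length \<alpha>) * A))
      * (LINT x|lborel. japanese (x::real^'n) powr (- (real CARD('n) + 2)))"
    unfolding fourier_plane_wave
  proof (rule norm_integral_decay)
    show "(\<lambda>x. plane_wave (- \<xi>) x * (laplace ^^ k) ?\<psi> x) \<in> borel_measurable borel"
      by (intro schwartz_borel schwartz_plane_wave_mult schwartz_laplace_funpow \<psi>)
    show "norm (plane_wave (- \<xi>) x * (laplace ^^ k) ?\<psi> x)
       \<le> (real CARD('n) ^ k * (2 ^ (2 * k) * 2 ^ (2 * k * length \<alpha>) * A))
          * japanese x powr (real (length \<alpha>) + m - 2 * real k)" for x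
      using sym_boundD[OF sym_bound_laplace_funpow[OF \<psi> b], of "[]" x] by (simp add: norm_mult)
  qed (use m in simp)
  finally show ?thesis by (simp add: mult_ac)
qed

text \<open>Continuity of the Fourier transform in quantitative form: \<open>C\<close>,
  \<open>L\<close> and \<open>m\<close> are chosen before the function, and the bound is linear in
  \<open>A\<close>.\<close>

lemma fourier_decay:
  fixes K :: nat
  shows "\<exists>C L m. 0 \<le> C \<and> (\<forall>\<phi>\<in>schwartz_space. \<forall>A. (\<forall>x. sym_bound L m A \<phi> x) \<longrightarrow>
    (\<forall>\<alpha> \<xi>. length \<alpha> \<le> K \<longrightarrow> japanese \<xi> ^ K * norm (iter_deriv \<alpha> (fourier \<phi>) (\<xi>::real^'n::finite)) \<le> C * A))"
proof -
  \<comment> \<open>The summand K makes up for the growth of the monomial brought down by up to K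
    derivatives; the rest ensures integrability.\<close>
  define m where "m = - (real CARD('n) + 2) - real K"
  define c where "c k = real CARD('n) ^ k * 2 ^ (2 * k) * 2 ^ (2 * k * K)
       * (LINT x|lborel. japanese (x::real^'n) powr (- (real CARD('n) + 2)))" for k
  have c0: "0 \<le> c k" for k
    unfolding c_def by (intro mult_nonneg_nonneg) auto
  have *: "norm \<xi> ^ (2 * k) * norm (iter_deriv \<alpha> (fourier \<phi>) \<xi>) \<le> c k * A"
    if \<phi>: "\<phi> \<in> schwartz_space" and A: "\<forall>x. sym_bound (2 * K) m A \<phi> x" and \<alpha>: "length \<alpha> \<le> K" and k: "k \<le> K"
    for \<phi> A \<alpha> k and \<xi> :: "real^'n"
  proof -
    have A0: "0 \<le> A" using A sym_bound_nonneg by blast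
    have "norm \<xi> ^ (2 * k) * norm (iter_deriv \<alpha> (fourier \<phi>) \<xi>)
      \<le> real CARD('n) ^ k * 2 ^ (2 * k) * 2 ^ (2 * k * length \<alpha>)
       * (LINT x|lborel. japanese (x::real^'n) powr (- (real CARD('n) + 2))) * A"
    proof (rule fourier_deriv_bound[OF \<phi>])
      show "sym_bound (2 * k) m A \<phi> x" for x
        using sym_bound_mono[of "2 * K" m A \<phi> x] A k by auto
      show "m + real (length \<alpha>) - 2 * real k \<le> - (real CARD('n) + 2)"
        using \<alpha> by (simp add: m_def)
    qed
    also have "\<dots> \<le> c k * A"
      unfolding c_def using \<alpha> A0 by (intro mult_right_mono mult_left_mono power_increasing) auto
    finally show ?thesis .
  qed
  have "japanese \<xi> ^ K * norm (iter_deriv \<alpha> (fourier \<phi>) \<xi>) \<le> (2 ^ K * (c 0 + c K)) * A"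
    if \<phi>: "\<phi> \<in> schwartz_space" and A: "\<forall>x. sym_bound (2 * K) m A \<phi> x" and \<alpha>: "length \<alpha> \<le> K"
    for \<phi> A \<alpha> and \<xi> :: "real^'n"
  proof -
    let ?N = "norm (iter_deriv \<alpha> (fourier \<phi>) \<xi>)"
    \<comment> \<open>Squaring makes the weight a polynomial in the squared norm of \<xi>, bounded
      by its extreme powers 0 and K. Hence only k = 0 and k = K Laplacians are needed.\<close>
    have "japanese \<xi> ^ K \<le> (japanese \<xi> ^ K)\<^sup>2"
      using japanese_ge_1[of \<xi>] by (simp add: self_le_power)
    also have "\<dots> = (1 + (norm \<xi>)\<^sup>2) ^ K"
      by (simp only: japanese_sq[symmetric] power_mult[symmetric] mult.commute)
    also have "\<dots> \<le> (2 * max 1 ((norm \<xi>)\<^sup>2)) ^ K"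
      by (intro power_mono) auto
    also have "\<dots> \<le> 2 ^ K * (1 + norm \<xi> ^ (2 * K))"
      by (simp add: power_mult_distrib max_def power_mult)
    finally have "japanese \<xi> ^ K * ?N \<le> 2 ^ K * (1 + norm \<xi> ^ (2 * K)) * ?N"
      by (intro mult_right_mono) auto
    also have "\<dots> = 2 ^ K * (norm \<xi> ^ (2 * 0) * ?N + norm \<xi> ^ (2 * K) * ?N)"
      by (simp add: algebra_simps)
    also have "\<dots> \<le> 2 ^ K * (c 0 * A + c K * A)"
      using *[OF \<phi> A \<alpha>, of 0 \<xi>] *[OF \<phi> A \<alpha>, of K \<xi>] by (intro mult_left_mono add_mono) auto
    finally show ?thesis by (simp add: algebra_simps)
  qed
  moreover have "0 \<le> 2 ^ K * (c 0 + c K)" using c0 by simp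
  ultimately show ?thesis by blast
qed

lemma schwartz_fourier:
  assumes \<phi>: "\<phi> \<in> schwartz_space"
  shows "fourier \<phi> \<in> schwartz_space"
  unfolding schwartz_space_def
proof (intro CollectI conjI allI smooth_on_fourier[OF \<phi>])
  fix k and \<alpha> :: "'a list"
  define K where "K = max k (length \<alpha>)"
  obtain C L m where C: "\<And>\<phi> A \<alpha> \<xi>. \<phi> \<in> schwartz_space \<Longrightarrow> \<forall>x. sym_bound L m A \<phi> x \<Longrightarrow> length \<alpha> \<le> K \<Longrightarrow>
     japanese \<xi> ^ K * norm (iter_deriv \<alpha> (fourier \<phi>) (\<xi>::real^'a)) \<le> C * A"
    using fourier_decay[of K] by blast
  obtain A where A: "\<And>x. sym_bound L m A \<phi> x" using schwartz_sym_bound[OF \<phi>] by blast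
  have "norm (japanese \<xi> ^ k * norm (iter_deriv \<alpha> (fourier \<phi>) \<xi>)) \<le> C * A" for \<xi>
  proof -
    have "japanese \<xi> ^ k * norm (iter_deriv \<alpha> (fourier \<phi>) \<xi>) \<le> japanese \<xi> ^ K * norm (iter_deriv \<alpha> (fourier \<phi>) \<xi>)"
      using japanese_ge_1[of \<xi>] by (intro mult_right_mono power_increasing) (auto simp: K_def)
    also have "\<dots> \<le> C * A"
      using C[OF \<phi>] A by (simp add: K_def)
    finally show ?thesis by simp
  qed
  then show "bounded (range (\<lambda>\<xi>. japanese \<xi> ^ k * norm (iter_deriv \<alpha> (fourier \<phi>) \<xi>)))"
    unfolding bounded_iff by blast
qed

section \<open>Fourier inversion\<close>

lemma borel_measurable_plane_wave [measurable]:
  assumes [measurable]: "f \<in> borel_measurable M" "g \<in> borel_measurable M"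
  shows "(\<lambda>x. plane_wave (f x) (g x)) \<in> borel_measurable M"
  unfolding plane_wave_def
proof -
  have [measurable]: "(\<lambda>x. f x \<bullet> g x) \<in> borel_measurable M"
    by measurable
  have e: "(exp :: complex \<Rightarrow> complex) \<in> borel_measurable borel"
    by (intro borel_measurable_continuous_onI continuous_intros)
  show "(\<lambda>x. exp (\<i> * complex_of_real (f x \<bullet> g x))) \<in> borel_measurable M"
    by (rule measurable_compose[OF _ e]) measurable
qed

text \<open>The multiplication formula. Fubini applies because plane waves have modulus 1, so that
  the double integrand is dominated by a product of integrable functions.\<close>

lemma fourier_swap:
  fixes \<phi> \<psi> :: "real^'n::finite \<Rightarrow> complex"
  assumes \<phi>: "\<phi> \<in> schwartz_space" and \<psi>: "\<psi> \<in> schwartz_space"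
  shows "(LINT \<xi>|lborel. fourier \<phi> \<xi> * \<psi> \<xi>) = (LINT x|lborel. \<phi> x * fourier \<psi> x)"
proof -
  note [measurable] = schwartz_borel[OF \<phi>] schwartz_borel[OF \<psi>]
  let ?f = "\<lambda>x \<xi>. plane_wave (- \<xi>) x * \<phi> x * \<psi> \<xi>"
  have 1: "integrable lborel (\<lambda>x. norm (\<phi> x))" "integrable lborel (\<lambda>x. norm (\<psi> x))"
    using integrable_schwartz \<phi> \<psi> by auto
  have "integrable (lborel \<Otimes>\<^sub>M lborel) (\<lambda>(x, \<xi>). ?f x \<xi>)"
  proof (rule lborel_pair.Fubini_integrable)
    show "(\<lambda>(x, \<xi>). ?f x \<xi>) \<in> borel_measurable (lborel \<Otimes>\<^sub>M lborel)"
      by measurable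
    show "integrable lborel (\<lambda>x. LINT \<xi>|lborel. norm (case (x, \<xi>) of (x, \<xi>) \<Rightarrow> ?f x \<xi>))"
      using 1 by (simp add: norm_mult)
    show "AE x in lborel. integrable lborel (\<lambda>\<xi>. case (x, \<xi>) of (x, \<xi>) \<Rightarrow> ?f x \<xi>)"
    proof (rule AE_I2)
      fix x
      have "integrable lborel (\<lambda>\<xi>. \<phi> x * (plane_wave (- x) \<xi> * \<psi> \<xi>))"
        by (intro integrable_mult_right integrable_schwartz_wave \<psi>)
      moreover have "plane_wave (- \<xi>) x = plane_wave (- x) \<xi>" for \<xi>
        by (simp add: plane_wave_def inner_commute)
      ultimately show "integrable lborel (\<lambda>\<xi>. case (x, \<xi>) of (x, \<xi>) \<Rightarrow> ?f x \<xi>)"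
        by (simp add: mult_ac)
    qed
  qed
  then have "(LINT \<xi>|lborel. LINT x|lborel. ?f x \<xi>) = (LINT x|lborel. LINT \<xi>|lborel. ?f x \<xi>)"
    by (rule lborel_pair.Fubini_integral)
  moreover have "(LINT x|lborel. ?f x \<xi>) = fourier \<phi> \<xi> * \<psi> \<xi>" for \<xi>
    by (simp add: fourier_plane_wave)
  moreover have "(LINT \<xi>|lborel. ?f x \<xi>) = \<phi> x * fourier \<psi> x" for x
  proof -
    have "(LINT \<xi>|lborel. ?f x \<xi>) = (LINT \<xi>|lborel. \<phi> x * (plane_wave (- x) \<xi> * \<psi> \<xi>))"
      by (intro Bochner_Integration.integral_cong) (auto simp: plane_wave_def inner_commute)
    then show ?thesis by (simp add: fourier_plane_wave)
  qed
  ultimately show ?thesis by (simp only:)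
qed

lemma fourier_scale:
  fixes \<phi> :: "real^'n::finite \<Rightarrow> complex"
  assumes \<phi>: "\<phi> \<in> schwartz_space" and c: "c \<noteq> 0"
  shows "fourier (\<lambda>x. \<phi> (c *\<^sub>R x)) \<xi> = of_real (1 / \<bar>c\<bar> ^ CARD('n)) * fourier \<phi> (\<xi> /\<^sub>R c)"
proof -
  have "fourier (\<lambda>x. \<phi> (c *\<^sub>R x)) \<xi>
      = (LINT x|lborel. plane_wave (- (\<xi> /\<^sub>R c)) (0 + c *\<^sub>R x) * \<phi> (0 + c *\<^sub>R x))"
  proof -
    have *: "(- (\<xi> /\<^sub>R c)) \<bullet> (0 + c *\<^sub>R x) = (- \<xi>) \<bullet> x" for x
      using c by simp
    show ?thesis unfolding fourier_plane_wave plane_wave_def * by simp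
  qed
  also have "\<dots> = of_real (1 / \<bar>c\<bar> ^ CARD('n)) * fourier \<phi> (\<xi> /\<^sub>R c)"
    unfolding fourier_plane_wave
    by (rule lborel_integral_affine[OF schwartz_borel[OF schwartz_plane_wave_mult[OF \<phi>]] c])
  finally show ?thesis .
qed

lemma fourier_translate:
  fixes \<phi> :: "real^'n::finite \<Rightarrow> complex"
  assumes \<phi>: "\<phi> \<in> schwartz_space"
  shows "fourier (\<lambda>x. \<phi> (x - b)) \<xi> = plane_wave (- \<xi>) b * fourier \<phi> \<xi>"
proof -
  have "fourier (\<lambda>x. \<phi> (x - b)) \<xi> = (LINT x|lborel. (\<lambda>x. plane_wave (- \<xi>) x * \<phi> (x - b)) (x + b))"
    unfolding fourier_plane_wave
    by (rule lborel_integral_translate[symmetric])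
      (intro schwartz_borel schwartz_plane_wave_mult schwartz_translate \<phi>)
  also have "\<dots> = (LINT x|lborel. plane_wave (- \<xi>) b * (plane_wave (- \<xi>) x * \<phi> x))"
    by (intro Bochner_Integration.integral_cong) (auto simp: plane_wave_add)
  finally show ?thesis by (simp add: fourier_plane_wave)
qed

lemma fourier_plane_wave_mult: "fourier (\<lambda>x. plane_wave b x * \<phi> x) \<xi> = fourier \<phi> (\<xi> - b)"
proof -
  have "plane_wave (- \<xi>) x * (plane_wave b x * \<phi> x) = plane_wave (- (\<xi> - b)) x * \<phi> x" for x
    using plane_wave_add_left[of "- \<xi>" b x] by (simp add: mult.assoc)
  then show ?thesis by (simp only: fourier_plane_wave)
qed

lemma fourier_reflect:
  fixes \<phi> :: "real^'n::finite \<Rightarrow> complex"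
  assumes "\<phi> \<in> schwartz_space"
  shows "fourier (\<lambda>x. \<phi> (- x)) \<xi> = fourier \<phi> (- \<xi>)"
  using fourier_scale[OF assms, of "-1" \<xi>] by simp

lemma cnj_fourier: "cnj (fourier \<phi> \<xi>) = fourier (\<lambda>x. cnj (\<phi> x)) (- \<xi>)"
  unfolding fourier_plane_wave Bochner_Integration.integral_cnj[symmetric]
  by (simp add: cnj_plane_wave del: Bochner_Integration.integral_cnj)

text \<open>Otherwise the function is nonzero on a nonempty open set, which cannot be a null
  set.\<close>

lemma continuous_nonneg_integral_0:
  fixes f :: "real^'n::finite \<Rightarrow> real"
  assumes "continuous_on UNIV f" "\<And>x. 0 \<le> f x" "integrable lborel f" "(LINT x|lborel. f x) = 0"
  shows "f x = 0"
proof (rule ccontr)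
  assume "f x \<noteq> 0"
  have "AE x in lborel. f x = 0"
    using assms integral_nonneg_eq_0_iff_AE[of lborel f] by auto
  then have ae: "{x. f x \<noteq> 0} \<in> null_sets lborel"
    using AE_iff_null_sets[of "{x. f x \<noteq> 0}" lborel] open_Collect_neq[OF assms(1) continuous_on_const[of _ 0]]
    by (simp add: borel_open)
  have "open {x. f x \<noteq> 0}"
    using open_Collect_neq[OF assms(1) continuous_on_const[of _ 0]] .
  moreover have "negligible {x. f x \<noteq> 0}"
    using ae by (simp add: negligible_iff_null_sets null_sets_completionI)
  ultimately show False
    using open_not_negligible[of "{x. f x \<noteq> 0}"] \<open>f x \<noteq> 0\<close> by blast
qed

text \<open>The same function serves three purposes: frequency truncation, the regularisation behind
  Fourier inversion, and, rescaled, the bump functions that localise in space.\<close>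

locale cutoff_function =
  fixes \<kappa> :: "real^'n::finite \<Rightarrow> complex"
  assumes test: "\<kappa> \<in> test_functions UNIV"
    and one: "norm \<xi> \<le> 1 \<Longrightarrow> \<kappa> \<xi> = 1"
    and zero: "2 \<le> norm \<xi> \<Longrightarrow> \<kappa> \<xi> = 0"
begin

lemma schwartz: "\<kappa> \<in> schwartz_space"
  using test by (rule test_functions_schwartz)

text \<open>The constant is $(2\pi)^n$, but only its being nonzero matters.\<close>

definition inv_const :: complex where
  "inv_const = (LINT x|lborel. fourier \<kappa> x)"

text \<open>The multiplication formula pairs \<open>fourier \<phi>\<close> with a dilated cutoff and
  \<open>fourier \<kappa>\<close> with a dilated \<open>\<phi>\<close>. As the dilations flatten
  out, dominated convergence gives the identity, and the cutoff contributes its value 1 at the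
  origin.\<close>

lemma integral_fourier:
  fixes \<phi> :: "real^'n \<Rightarrow> complex"
  assumes \<phi>: "\<phi> \<in> schwartz_space"
  shows "(LINT \<xi>|lborel. fourier \<phi> \<xi>) = inv_const * \<phi> 0"
proof -
  define \<epsilon> where "\<epsilon> n = 1 / (real n + 1)" for n
  have \<epsilon>: "\<epsilon> n \<noteq> 0" for n by (simp add: \<epsilon>_def)
  have \<epsilon>0: "\<epsilon> \<longlonglongrightarrow> 0"
    unfolding \<epsilon>_def using LIMSEQ_inverse_real_of_nat by (simp add: inverse_eq_divide add.commute)
  note F\<phi> = schwartz_fourier[OF \<phi>] and F\<kappa> = schwartz_fourier[OF schwartz]
  have cont: "(\<lambda>n. \<psi> (\<epsilon> n *\<^sub>R x)) \<longlonglongrightarrow> \<psi> 0" if "\<psi> \<in> schwartz_space" for \<psi> :: "real^'n \<Rightarrow> complex" and x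
  proof -
    have "(\<lambda>n. \<epsilon> n *\<^sub>R x) \<longlonglongrightarrow> 0 *\<^sub>R x" by (intro tendsto_intros \<epsilon>0)
    moreover have "isCont \<psi> (0 *\<^sub>R x)"
      using schwartz_continuous_on[OF that, of UNIV] by (simp add: continuous_on_eq_continuous_at)
    ultimately show ?thesis using isCont_tendsto_compose by fastforce
  qed
  have lim: "(\<lambda>n. LINT x|lborel. \<psi>' x * \<psi> (\<epsilon> n *\<^sub>R x)) \<longlonglongrightarrow> (LINT x|lborel. \<psi>' x * \<psi> 0)"
    if \<psi>: "\<psi> \<in> schwartz_space" and \<psi>': "\<psi>' \<in> schwartz_space" for \<psi> \<psi>' :: "real^'n \<Rightarrow> complex"
  proof -
    note [measurable] = schwartz_borel[OF \<psi>] schwartz_borel[OF \<psi>']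
    obtain A where A: "0 \<le> A" "\<And>x. norm (\<psi> x) \<le> A * japanese x powr 0"
      using schwartz_bound[OF \<psi>] by blast
    show ?thesis
    proof (rule integral_dominated_convergence[where w="\<lambda>x. norm (\<psi>' x) * A"])
      show "integrable lborel (\<lambda>x. norm (\<psi>' x) * A)"
        using integrable_schwartz[OF \<psi>'] by simp
      show "AE x in lborel. norm (\<psi>' x * \<psi> (\<epsilon> n *\<^sub>R x)) \<le> norm (\<psi>' x) * A" for n
        using A by (auto simp: norm_mult intro!: mult_left_mono)
      show "AE x in lborel. (\<lambda>n. \<psi>' x * \<psi> (\<epsilon> n *\<^sub>R x)) \<longlonglongrightarrow> \<psi>' x * \<psi> 0"
        using cont[OF \<psi>] by (auto intro!: tendsto_intros)
    qed measurable
  qed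
  \<comment> \<open>The Jacobian of the substitution cancels the power of \<epsilon> that
    \<open>fourier_scale\<close> produces.\<close>
  have eq: "(LINT \<xi>|lborel. fourier \<phi> \<xi> * \<kappa> (\<epsilon> n *\<^sub>R \<xi>)) = (LINT x|lborel. fourier \<kappa> x * \<phi> (\<epsilon> n *\<^sub>R x))" for n
  proof -
    let ?g = "\<lambda>\<xi>. fourier \<phi> (\<xi> /\<^sub>R \<epsilon> n) * \<kappa> \<xi>"
    have g: "?g \<in> borel_measurable borel"
      by (intro schwartz_borel schwartz_mult schwartz_scale F\<phi> schwartz) (use \<epsilon> in simp)
    have "(LINT x|lborel. fourier \<kappa> x * \<phi> (\<epsilon> n *\<^sub>R x)) = (LINT \<xi>|lborel. fourier (\<lambda>x. \<phi> (\<epsilon> n *\<^sub>R x)) \<xi> * \<kappa> \<xi>)"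
      using fourier_swap[OF schwartz_scale[OF \<phi> \<epsilon>] schwartz] by (simp add: mult.commute)
    also have "\<dots> = of_real (1 / \<bar>\<epsilon> n\<bar> ^ CARD('n)) * (LINT \<xi>|lborel. ?g \<xi>)"
      by (simp add: fourier_scale[OF \<phi> \<epsilon>] mult.assoc)
    also have "\<dots> = (LINT \<xi>|lborel. ?g (0 + \<epsilon> n *\<^sub>R \<xi>))"
      using lborel_integral_affine[OF g \<epsilon>, of 0 n] by simp
    also have "\<dots> = (LINT \<xi>|lborel. fourier \<phi> \<xi> * \<kappa> (\<epsilon> n *\<^sub>R \<xi>))"
      using \<epsilon>[of n] by simp
    finally show ?thesis by simp
  qed
  have "(LINT \<xi>|lborel. fourier \<phi> \<xi> * \<kappa> 0) = (LINT x|lborel. fourier \<kappa> x * \<phi> 0)"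
    using LIMSEQ_unique[OF lim[OF schwartz F\<phi>]] lim[OF \<phi> F\<kappa>] by (simp add: eq)
  then show ?thesis
    using one[of 0] by (simp add: inv_const_def)
qed

lemma fourier_fourier:
  fixes \<phi> :: "real^'n \<Rightarrow> complex"
  assumes \<phi>: "\<phi> \<in> schwartz_space"
  shows "fourier (fourier \<phi>) x = inv_const * \<phi> (- x)"
proof -
  have "fourier (fourier \<phi>) x = (LINT \<xi>|lborel. fourier (\<lambda>y. \<phi> (y - x)) \<xi>)"
    by (simp add: fourier_plane_wave[of "fourier \<phi>"] fourier_translate[OF \<phi>] plane_wave_def inner_commute)
  then show ?thesis
    using integral_fourier[OF schwartz_translate[OF \<phi>]] by simp
qed

text \<open>If the constant vanished, applying the transform twice would give zero. The
  multiplication formula would then annihilate the transform of every Schwartz function, in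
  particular the integral of the squared modulus of the cutoff.\<close>

lemma inv_const_neq_0: "inv_const \<noteq> 0"
proof
  assume 0: "inv_const = 0"
  have F0: "fourier \<phi> \<xi> = 0" if \<phi>: "\<phi> \<in> schwartz_space" for \<phi> :: "real^'n \<Rightarrow> complex" and \<xi>
  proof -
    \<comment> \<open>The reflected conjugate has the conjugate transform, which turns the
      multiplication formula into an integral of a squared modulus.\<close>
    let ?\<psi> = "\<lambda>x. cnj (\<phi> (- x))"
    have \<psi>: "?\<psi> \<in> schwartz_space" by (intro schwartz_cnj schwartz_reflect \<phi>)
    have cnj: "fourier ?\<psi> \<xi> = cnj (fourier \<phi> \<xi>)" for \<xi>
      using fourier_reflect[OF schwartz_cnj[OF \<phi>]] by (simp add: cnj_fourier)
    have "(LINT \<xi>|lborel. fourier \<phi> \<xi> * fourier ?\<psi> \<xi>) = (LINT x|lborel. \<phi> x * fourier (fourier ?\<psi>) x)"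
      by (rule fourier_swap[OF \<phi> schwartz_fourier[OF \<psi>]])
    also have "\<dots> = 0" by (simp add: fourier_fourier[OF \<psi>] 0)
    finally have "(LINT \<xi>|lborel. complex_of_real ((norm (fourier \<phi> \<xi>))\<^sup>2)) = 0"
      by (simp only: cnj complex_norm_square)
    then have "(LINT \<xi>|lborel. (norm (fourier \<phi> \<xi>))\<^sup>2) = 0"
      by (simp del: of_real_power)
    moreover have "integrable lborel (\<lambda>\<xi>. (norm (fourier \<phi> \<xi>))\<^sup>2)"
    proof -
      have "integrable lborel (\<lambda>\<xi>. norm (fourier \<phi> \<xi> * fourier \<phi> \<xi>))"
        by (intro integrable_norm integrable_schwartz schwartz_mult schwartz_fourier \<phi>)
      then show ?thesis by (simp add: norm_mult power2_eq_square)
    qed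
    moreover have "continuous_on UNIV (\<lambda>\<xi>. (norm (fourier \<phi> \<xi>))\<^sup>2)"
      by (intro continuous_intros schwartz_continuous_on[OF schwartz_fourier[OF \<phi>]])
    ultimately have "(norm (fourier \<phi> \<xi>))\<^sup>2 = 0"
      using continuous_nonneg_integral_0[of "\<lambda>\<xi>. (norm (fourier \<phi> \<xi>))\<^sup>2" \<xi>] by simp
    then show ?thesis by simp
  qed
  have s: "(\<lambda>x. \<kappa> x * cnj (\<kappa> x)) \<in> schwartz_space"
    by (intro schwartz_mult schwartz_cnj schwartz)
  have "(LINT x|lborel. \<kappa> x * cnj (\<kappa> x)) = 0"
    using F0[OF s, of 0] by (simp add: fourier_plane_wave plane_wave_def)
  then have "(LINT x|lborel. complex_of_real ((norm (\<kappa> x))\<^sup>2)) = 0"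
    by (simp only: complex_norm_square)
  then have "(LINT x|lborel. (norm (\<kappa> x))\<^sup>2) = 0"
    by (simp del: of_real_power)
  moreover have "integrable lborel (\<lambda>x. (norm (\<kappa> x))\<^sup>2)"
    using integrable_norm[OF integrable_schwartz[OF s]] by (simp add: norm_mult power2_eq_square)
  moreover have "continuous_on UNIV (\<lambda>x. (norm (\<kappa> x))\<^sup>2)"
    by (intro continuous_intros schwartz_continuous_on[OF schwartz])
  ultimately have "(norm (\<kappa> 0))\<^sup>2 = 0"
    using continuous_nonneg_integral_0[of "\<lambda>x. (norm (\<kappa> x))\<^sup>2" 0] by simp
  then show False using one[of 0] by simp
qed

lemma fourier_inversion:
  fixes \<phi> :: "real^'n \<Rightarrow> complex"
  assumes \<phi>: "\<phi> \<in> schwartz_space"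
  shows "fourier (\<lambda>\<xi>. fourier \<phi> (- \<xi>) / inv_const) = \<phi>"
proof
  fix x
  have "fourier (\<lambda>\<xi>. (1 / inv_const) * fourier \<phi> (- \<xi>)) x = (1 / inv_const) * fourier (fourier \<phi>) (- x)"
    by (simp add: fourier_cmult fourier_reflect[OF schwartz_fourier[OF \<phi>]] del: times_divide_eq_left)
  then show "fourier (\<lambda>\<xi>. fourier \<phi> (- \<xi>) / inv_const) x = \<phi> x"
    using inv_const_neq_0 by (simp add: fourier_fourier[OF \<phi>])
qed

lemma schwartz_inverse_transform:
  fixes \<phi> :: "real^'n \<Rightarrow> complex"
  assumes \<phi>: "\<phi> \<in> schwartz_space"
  shows "(\<lambda>\<xi>. fourier \<phi> (- \<xi>) / inv_const) \<in> schwartz_space"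
  using schwartz_cmult[OF schwartz_reflect[OF schwartz_fourier[OF \<phi>]], of "1 / inv_const"] by simp

lemma inj_on_fourier: "inj_on fourier (schwartz_space :: (real^'n \<Rightarrow> complex) set)"
proof (rule inj_onI)
  fix \<phi> \<psi> :: "real^'n \<Rightarrow> complex"
  assume \<phi>: "\<phi> \<in> schwartz_space" and \<psi>: "\<psi> \<in> schwartz_space" and eq: "fourier \<phi> = fourier \<psi>"
  have "inv_const * \<phi> (- x) = inv_const * \<psi> (- x)" for x
    using fourier_fourier[OF \<phi>, of x] fourier_fourier[OF \<psi>, of x] by (simp only: eq)
  then have "\<phi> x = \<psi> x" for x
    using inv_const_neq_0 by (metis minus_minus mult_left_cancel)
  then show "\<phi> = \<psi>" by blast
qed

text \<open>\<open>inv_fourier\<close> is defined by choice of a preimage; injectivity together with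
  an explicit preimage determines it.\<close>

lemma inv_fourier_eq:
  fixes \<phi> :: "real^'n \<Rightarrow> complex"
  assumes \<phi>: "\<phi> \<in> schwartz_space"
  shows "inv_fourier \<phi> = (\<lambda>\<xi>. fourier \<phi> (- \<xi>) / inv_const)"
  unfolding inv_fourier_def
  by (rule inv_into_f_eq[OF inj_on_fourier schwartz_inverse_transform[OF \<phi>]]) (rule fourier_inversion[OF \<phi>])

lemma schwartz_inv_fourier: "(\<phi> :: real^'n \<Rightarrow> complex) \<in> schwartz_space \<Longrightarrow> inv_fourier \<phi> \<in> schwartz_space"
  by (simp add: inv_fourier_eq schwartz_inverse_transform)

lemma fourier_inv_fourier: "(\<phi> :: real^'n \<Rightarrow> complex) \<in> schwartz_space \<Longrightarrow> fourier (inv_fourier \<phi>) = \<phi>"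
  by (simp add: inv_fourier_eq fourier_inversion)

lemma inv_fourier_fourier: "(\<phi> :: real^'n \<Rightarrow> complex) \<in> schwartz_space \<Longrightarrow> inv_fourier (fourier \<phi>) = \<phi>"
  unfolding inv_fourier_def by (rule inv_into_f_f[OF inj_on_fourier])

end

section \<open>Tempered distributions\<close>

lemma tempered_add:
  "u \<in> tempered_distributions \<Longrightarrow> \<phi> \<in> schwartz_space \<Longrightarrow> \<psi> \<in> schwartz_space \<Longrightarrow>
    u (\<lambda>x. \<phi> x + \<psi> x) = u \<phi> + u \<psi>"
  by (simp add: tempered_distributions_def)

lemma tempered_cmult:
  "u \<in> tempered_distributions \<Longrightarrow> \<phi> \<in> schwartz_space \<Longrightarrow> u (\<lambda>x. c * \<phi> x) = c * u \<phi>"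
  by (simp add: tempered_distributions_def)

lemma tempered_diff:
  assumes "u \<in> tempered_distributions" "\<phi> \<in> schwartz_space" "\<psi> \<in> schwartz_space"
  shows "u (\<lambda>x. \<phi> x - \<psi> x) = u \<phi> - u \<psi>"
  using tempered_add[OF assms(1,2) schwartz_cmult[OF assms(3), of "-1"]]
    tempered_cmult[OF assms(1,3), of "-1"] by simp

lemma tempered_zero: "u \<in> tempered_distributions \<Longrightarrow> u (\<lambda>_. 0) = 0"
  using tempered_cmult[OF _ schwartz_zero, of u 0] by simp

lemma tempered_sum:
  assumes "u \<in> tempered_distributions" "\<And>i. i \<in> I \<Longrightarrow> \<phi> i \<in> schwartz_space"
  shows "u (\<lambda>x. \<Sum>i\<in>I. \<phi> i x) = (\<Sum>i\<in>I. u (\<phi> i))"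
  using assms(2)
  by (induction I rule: infinite_finite_induct)
    (simp_all add: tempered_zero[OF assms(1)] tempered_add[OF assms(1)] schwartz_sum)

text \<open>Trades the double sum of seminorms for one weighted bound with the same K for weights
  and derivatives. The constant counts the summands.\<close>

lemma tempered_bound:
  fixes u :: "(real^'n::finite \<Rightarrow> complex) \<Rightarrow> complex"
  assumes u: "u \<in> tempered_distributions"
  obtains C K where "0 \<le> C"
    "\<And>\<phi> A. \<phi> \<in> schwartz_space \<Longrightarrow>
       (\<And>\<alpha> x. length \<alpha> \<le> K \<Longrightarrow> japanese x ^ K * norm (iter_deriv \<alpha> \<phi> x) \<le> A) \<Longrightarrow> norm (u \<phi>) \<le> C * A"
proof -
  obtain C K where C: "\<And>\<phi>. \<phi> \<in> schwartz_space \<Longrightarrow>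
      norm (u \<phi>) \<le> C * (\<Sum>k\<le>K. \<Sum>\<alpha> | length \<alpha> \<le> K. schwartz_seminorm k \<alpha> \<phi>)"
    using u unfolding tempered_distributions_def by blast
  define M where "M = real (K + 1) * real (card {\<alpha> :: 'n list. length \<alpha> \<le> K})"
  show thesis
  proof (rule that[of "\<bar>C\<bar> * M" K])
    show "0 \<le> \<bar>C\<bar> * M" by (simp add: M_def)
    fix \<phi> :: "real^'n \<Rightarrow> complex" and A :: real
    assume \<phi>: "\<phi> \<in> schwartz_space"
      and A: "\<And>\<alpha> x. length \<alpha> \<le> K \<Longrightarrow> japanese x ^ K * norm (iter_deriv \<alpha> \<phi> x) \<le> A"
    have le: "schwartz_seminorm k \<alpha> \<phi> \<le> A" if "k \<le> K" "length \<alpha> \<le> K" for k and \<alpha> :: "'n list"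
      unfolding schwartz_seminorm_def
    proof (rule cSUP_least)
      fix x :: "real^'n"
      have "japanese x ^ k * norm (iter_deriv \<alpha> \<phi> x) \<le> japanese x ^ K * norm (iter_deriv \<alpha> \<phi> x)"
        using that japanese_ge_1 by (intro mult_right_mono power_increasing) auto
      then show "japanese x ^ k * norm (iter_deriv \<alpha> \<phi> x) \<le> A"
        using A[OF that(2), of x] by linarith
    qed simp
    have nonneg: "0 \<le> schwartz_seminorm k \<alpha> \<phi>" for k and \<alpha> :: "'n list"
    proof -
      have "bdd_above (range (\<lambda>x. japanese x ^ k * norm (iter_deriv \<alpha> \<phi> x)))"
        using \<phi> by (auto simp: schwartz_space_def intro!: bounded_imp_bdd_above)
      then have "japanese (0::real^'n) ^ k * norm (iter_deriv \<alpha> \<phi> 0) \<le> schwartz_seminorm k \<alpha> \<phi>"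
        unfolding schwartz_seminorm_def
        using cSUP_upper[of "0::real^'n" UNIV "\<lambda>x. japanese x ^ k * norm (iter_deriv \<alpha> \<phi> x)"] by simp
      moreover have "0 \<le> japanese (0::real^'n) ^ k * norm (iter_deriv \<alpha> \<phi> 0)" by simp
      ultimately show ?thesis by linarith
    qed
    let ?S = "\<Sum>k\<le>K. \<Sum>\<alpha> | length \<alpha> \<le> K. schwartz_seminorm k (\<alpha> :: 'n list) \<phi>"
    have "?S \<le> (\<Sum>k\<le>K. real (card {\<alpha> :: 'n list. length \<alpha> \<le> K}) * A)"
      using le by (intro sum_mono sum_bounded_above) auto
    then have S: "?S \<le> M * A"
      by (simp add: M_def mult.assoc)
    have "norm (u \<phi>) \<le> C * ?S" by (rule C[OF \<phi>])
    \<comment> \<open>The constant in the definition may be negative. Nonnegativity of a seminorm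
      uses that its supremum is over a bounded set.\<close>
    also have "\<dots> \<le> \<bar>C\<bar> * ?S"
      using nonneg by (intro mult_right_mono sum_nonneg) auto
    also have "\<dots> \<le> \<bar>C\<bar> * (M * A)"
      by (intro mult_left_mono S) auto
    finally show "norm (u \<phi>) \<le> \<bar>C\<bar> * M * A" by simp
  qed
qed

text \<open>The transform of \<open>u\<close> is tempered, in the only form needed: its values are
  controlled by symbol bounds of some order.\<close>

lemma tempered_fourier_bound:
  fixes u :: "(real^'n::finite \<Rightarrow> complex) \<Rightarrow> complex"
  assumes u: "u \<in> tempered_distributions"
  obtains C L m where "0 \<le> C"
    "\<And>\<phi> A. \<phi> \<in> schwartz_space \<Longrightarrow> (\<And>x. sym_bound L m A \<phi> x) \<Longrightarrow> norm (u (fourier \<phi>)) \<le> C * A"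
proof -
  obtain C K where C: "0 \<le> C" and uC: "\<And>\<phi> A. \<phi> \<in> schwartz_space \<Longrightarrow>
       (\<And>\<alpha> x. length \<alpha> \<le> K \<Longrightarrow> japanese x ^ K * norm (iter_deriv \<alpha> \<phi> x) \<le> A) \<Longrightarrow> norm (u \<phi>) \<le> C * A"
    using tempered_bound[OF u] by metis
  obtain C' L m where C': "0 \<le> C'" and dec: "\<forall>\<phi>\<in>schwartz_space. \<forall>A. (\<forall>x. sym_bound L m A \<phi> x) \<longrightarrow>
    (\<forall>\<alpha> \<xi>. length \<alpha> \<le> K \<longrightarrow> japanese \<xi> ^ K * norm (iter_deriv \<alpha> (fourier \<phi>) (\<xi>::real^'n)) \<le> C' * A)"
    using fourier_decay[where K=K and 'n='n] by blast
  show thesis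
  proof (rule that[of "C * C'" L m])
    show "0 \<le> C * C'" using C C' by simp
    fix \<phi> :: "real^'n \<Rightarrow> complex" and A
    assume \<phi>: "\<phi> \<in> schwartz_space" and A: "\<And>x. sym_bound L m A \<phi> x"
    have "norm (u (fourier \<phi>)) \<le> C * (C' * A)"
      by (rule uC[OF schwartz_fourier[OF \<phi>]]) (use dec \<phi> A in blast)
    then show "norm (u (fourier \<phi>)) \<le> C * C' * A" by simp
  qed
qed

text \<open>Up to a constant, the value at \<open>x\<close> of the smooth function \<open>a(D) u\<close>, for a Schwartz symbol \<open>a\<close>.\<close>

definition wave_value ::
  "((real^'n::finite \<Rightarrow> complex) \<Rightarrow> complex) \<Rightarrow> (real^'n \<Rightarrow> complex) \<Rightarrow> real^'n \<Rightarrow> complex" where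
  "wave_value u a x = u (fourier (\<lambda>\<xi>. plane_wave x \<xi> * a \<xi>))"

section \<open>Smooth dependence of wave values on the point\<close>

lemma wave_value_diff:
  assumes u: "u \<in> tempered_distributions" and a: "a \<in> schwartz_space" and b: "b \<in> schwartz_space"
  shows "wave_value u (\<lambda>\<xi>. a \<xi> - b \<xi>) x = wave_value u a x - wave_value u b x"
proof -
  note s = schwartz_plane_wave_mult[OF a, of x] schwartz_plane_wave_mult[OF b, of x]
  have "fourier (\<lambda>\<xi>. plane_wave x \<xi> * (a \<xi> - b \<xi>))
      = (\<lambda>y. fourier (\<lambda>\<xi>. plane_wave x \<xi> * a \<xi>) y - fourier (\<lambda>\<xi>. plane_wave x \<xi> * b \<xi>) y)"
    using fourier_diff[OF s] by (auto simp: right_diff_distrib)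
  then show ?thesis
    using tempered_diff[OF u schwartz_fourier[OF s(1)] schwartz_fourier[OF s(2)]] by (simp add: wave_value_def)
qed

lemma iter_deriv_fourier_shift:
  fixes a :: "real^'n::finite \<Rightarrow> complex"
  assumes a: "a \<in> schwartz_space"
  shows "iter_deriv \<alpha> (fourier (\<lambda>\<xi>. plane_wave x \<xi> * a \<xi>)) y = iter_deriv \<alpha> (fourier a) (y - x)"
proof -
  have "(\<lambda>\<xi>. monomial (- \<i>) \<alpha> \<xi> * (plane_wave x \<xi> * a \<xi>)) = (\<lambda>\<xi>. plane_wave x \<xi> * (monomial (- \<i>) \<alpha> \<xi> * a \<xi>))"
    by (auto simp: mult_ac)
  then show ?thesis
    by (simp add: iter_deriv_fourier[OF schwartz_plane_wave_mult[OF a]] iter_deriv_fourier[OF a] fourier_plane_wave_mult)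
qed

lemma schwartz_i_coord_mult:
  "a \<in> schwartz_space \<Longrightarrow> (\<lambda>\<xi>. \<i> * of_real (\<xi> $ i) * a \<xi>) \<in> schwartz_space"
  using schwartz_monomial_mult[of \<i> a "[i]"] by simp

text \<open>Multiplying the symbol by a plane wave translates its kernel. The increment minus the
  proposed derivative is \<open>u\<close> applied to a Taylor remainder of the kernel, which is
  quadratic in \<open>h\<close> in the seminorm that bounds \<open>u\<close>.\<close>

lemma has_derivative_wave_value:
  fixes a :: "real^'n::finite \<Rightarrow> complex"
  assumes u: "u \<in> tempered_distributions" and a: "a \<in> schwartz_space"
  shows "(wave_value u a has_derivative
     (\<lambda>h. \<Sum>i\<in>UNIV. h $ i *\<^sub>R wave_value u (\<lambda>\<xi>. \<i> * of_real (\<xi> $ i) * a \<xi>) x)) (at x)"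
proof -
  let ?D = "\<lambda>h. \<Sum>i\<in>UNIV. h $ i *\<^sub>R wave_value u (\<lambda>\<xi>. \<i> * of_real (\<xi> $ i) * a \<xi>) x"
  obtain C K where C: "0 \<le> C" and uC: "\<And>\<phi> A. \<phi> \<in> schwartz_space \<Longrightarrow>
       (\<And>\<alpha> x. length \<alpha> \<le> K \<Longrightarrow> japanese x ^ K * norm (iter_deriv \<alpha> \<phi> x) \<le> A) \<Longrightarrow> norm (u \<phi>) \<le> C * A"
    using tempered_bound[OF u] by metis
  \<comment> \<open>The seminorm of \<open>u\<close> takes K derivatives and the Taylor remainder
    two more; order -K matches the weight of the seminorm.\<close>
  obtain A where A: "\<And>z. sym_bound (K + 2) (- real K) A (fourier a) z"
    using schwartz_sym_bound[OF schwartz_fourier[OF a]] by blast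
  have A0: "0 \<le> A" using sym_bound_nonneg[OF A] .
  define M where "M = (real CARD('n))\<^sup>2 * (A * (4 powr real K * (2 * japanese x) powr real K))"
  show ?thesis
  proof (rule has_derivative_quadratic[where C="C * M"])
    show "bounded_linear ?D"
      by (intro bounded_linear_sum bounded_linear_scaleR_left[THEN bounded_linear_compose] bounded_linear_vec_nth)
    fix h :: "real^'n" assume h: "norm h \<le> 1"
    \<comment> \<open>The symbol is kept variable because differentiating
      \<open>fourier (G a)\<close> replaces \<open>a\<close> by a monomial times \<open>a\<close>.
      Every derivative of the remainder is thus again such a remainder.\<close>
    define G where "G b \<xi> = plane_wave (x + h) \<xi> * b \<xi> - plane_wave x \<xi> * b \<xi>
       - (\<Sum>i\<in>UNIV. of_real (h $ i) * (plane_wave x \<xi> * (\<i> * of_real (\<xi> $ i) * b \<xi>)))"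
      for b :: "real^'n \<Rightarrow> complex" and \<xi>
    have Gs: "G b \<in> schwartz_space" if "b \<in> schwartz_space" for b
      unfolding G_def by (intro schwartz_diff schwartz_sum schwartz_plane_wave_mult schwartz_cmult schwartz_i_coord_mult that)
    have FG: "fourier (G b) = (\<lambda>y. fourier (\<lambda>\<xi>. plane_wave (x + h) \<xi> * b \<xi>) y - fourier (\<lambda>\<xi>. plane_wave x \<xi> * b \<xi>) y
       - (\<Sum>i\<in>UNIV. of_real (h $ i) * fourier (\<lambda>\<xi>. plane_wave x \<xi> * (\<i> * of_real (\<xi> $ i) * b \<xi>)) y))"
      if b: "b \<in> schwartz_space" for b
      unfolding G_def
      by (intro ext, subst fourier_diff, intro schwartz_diff schwartz_plane_wave_mult b,
          intro schwartz_sum schwartz_cmult schwartz_plane_wave_mult schwartz_i_coord_mult b,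
          subst fourier_diff, (intro schwartz_plane_wave_mult b)+, subst fourier_sum,
          intro schwartz_cmult schwartz_plane_wave_mult schwartz_i_coord_mult b, simp add: fourier_cmult)
    have "u (fourier (G a)) = wave_value u a (x + h) - wave_value u a x - ?D h"
    proof -
      have s: "fourier (\<lambda>\<xi>. plane_wave x \<xi> * (\<i> * of_real (\<xi> $ i) * a \<xi>)) \<in> schwartz_space" for i
        by (intro schwartz_fourier schwartz_plane_wave_mult schwartz_i_coord_mult a)
      have s': "fourier (\<lambda>\<xi>. plane_wave x \<xi> * a \<xi>) \<in> schwartz_space" for x
        by (intro schwartz_fourier schwartz_plane_wave_mult a)
      have "u (\<lambda>y. \<Sum>i\<in>UNIV. of_real (h $ i) * fourier (\<lambda>\<xi>. plane_wave x \<xi> * (\<i> * of_real (\<xi> $ i) * a \<xi>)) y)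
        = ?D h"
        using s by (subst tempered_sum[OF u])
          (auto simp: wave_value_def scaleR_conv_of_real tempered_cmult[OF u] intro!: schwartz_cmult)
      moreover have "(\<lambda>y. \<Sum>i\<in>UNIV. of_real (h $ i) * fourier (\<lambda>\<xi>. plane_wave x \<xi> * (\<i> * of_real (\<xi> $ i) * a \<xi>)) y) \<in> schwartz_space"
        by (intro schwartz_sum schwartz_cmult s)
      ultimately show ?thesis
        unfolding FG[OF a]
        by (simp add: tempered_diff[OF u] schwartz_diff s' wave_value_def)
    qed
    moreover have "norm (u (fourier (G a))) \<le> C * (M * (norm h)\<^sup>2)"
    proof (rule uC[OF schwartz_fourier[OF Gs[OF a]]])
      fix \<alpha> :: "'n list" and y :: "real^'n" assume \<alpha>: "length \<alpha> \<le> K"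
      define b where "b \<xi> = monomial (- \<i>) \<alpha> \<xi> * a \<xi>" for \<xi>
      have b: "b \<in> schwartz_space" unfolding b_def by (rule schwartz_monomial_mult[OF _ a]) simp
      let ?k = "fourier b"
      have kb: "?k = iter_deriv \<alpha> (fourier a)"
        by (simp add: iter_deriv_fourier[OF a] b_def[abs_def])
      have "(\<lambda>\<xi>. monomial (- \<i>) \<alpha> \<xi> * G a \<xi>) = G b"
        by (auto simp: G_def b_def right_diff_distrib sum_distrib_left mult_ac)
      then have "iter_deriv \<alpha> (fourier (G a)) y = fourier (G b) y"
        by (simp add: iter_deriv_fourier[OF Gs[OF a]])
      also have "\<dots> = ?k (y - (x + h)) - ?k (y - x) - (\<Sum>i\<in>UNIV. ((y - (x + h)) - (y - x)) $ i *\<^sub>R partial_deriv i ?k (y - x))"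
      proof -
        have "fourier (\<lambda>\<xi>. \<i> * of_real (\<xi> $ i) * b \<xi>) (y - x) = - partial_deriv i ?k (y - x)" for i
          using iter_deriv_fourier[OF b, of "[i]"] fourier_cmult[of "-1" "\<lambda>\<xi>. \<i> * of_real (\<xi> $ i) * b \<xi>"] by simp
        then show ?thesis
          by (simp add: FG[OF b] fourier_plane_wave_mult scaleR_conv_of_real sum_negf)
      qed
      also have "norm \<dots> \<le> (real CARD('n))\<^sup>2 * (A * (4 powr real K * ((2 * japanese x) powr real K * japanese y powr - real K)))
         * (norm ((y - (x + h)) - (y - x)))\<^sup>2"
      proof (rule smooth_taylor[OF smooth_on_fourier[OF b] convex_cball[of "y - x" 1]])
        fix i j z assume z: "z \<in> cball (y - x) 1"
        have "norm (partial_deriv i (partial_deriv j ?k) z) \<le> A * japanese z powr (- real K - real (length (i # j # \<alpha>)))"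
          using sym_boundD[OF A, of "i # j # \<alpha>" z] \<alpha> by (simp add: kb)
        also have "\<dots> \<le> A * japanese z powr - real K"
          by (intro mult_left_mono japanese_powr_mono A0) auto
        also have "\<dots> \<le> A * (4 powr real K * japanese (y - x) powr - real K)"
          using z by (intro mult_left_mono japanese_powr_near A0) (auto simp: dist_norm)
        also have "\<dots> \<le> A * (4 powr real K * ((2 * japanese x) powr real K * japanese y powr - real K))"
          using japanese_powr_shift[of "real K" "y - x" y]
          by (intro mult_left_mono A0) auto
        finally show "norm (partial_deriv i (partial_deriv j ?k) z)
          \<le> A * (4 powr real K * ((2 * japanese x) powr real K * japanese y powr - real K))" .
      qed (use h in \<open>auto simp: dist_norm\<close>)
      finally have "norm (iter_deriv \<alpha> (fourier (G a)) y) \<le> M * (norm h)\<^sup>2 * japanese y powr - real K"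
        by (simp add: M_def mult_ac)
      then show "japanese y ^ K * norm (iter_deriv \<alpha> (fourier (G a)) y) \<le> M * (norm h)\<^sup>2"
        by (simp add: powr_minus powr_realpow field_simps)
    qed
    ultimately show "norm (wave_value u a (x + h) - wave_value u a x - ?D h) \<le> C * M * (norm h)\<^sup>2"
      by simp
  qed
qed

lemma iter_deriv_wave_value:
  assumes u: "u \<in> tempered_distributions" and a: "a \<in> schwartz_space"
  shows "iter_deriv \<alpha> (wave_value u a) = wave_value u (\<lambda>\<xi>. monomial \<i> \<alpha> \<xi> * a \<xi>)"
proof (induction \<alpha>)
  case (Cons i \<alpha>)
  have "(\<lambda>\<xi>. monomial \<i> \<alpha> \<xi> * a \<xi>) \<in> schwartz_space"
    by (rule schwartz_monomial_mult[OF _ a]) simp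
  then show ?case
    by (intro ext) (simp add: Cons partial_deriv_eq[OF has_derivative_wave_value[OF u]] sum_axis_scaleR mult.assoc)
qed simp

lemma smooth_on_wave_value:
  assumes u: "u \<in> tempered_distributions" and a: "a \<in> schwartz_space"
  shows "smooth_on UNIV (wave_value u a)"
  unfolding smooth_on_def iter_deriv_wave_value[OF u a] differentiable_def
  by (intro allI ballI exI, rule has_derivative_wave_value[OF u schwartz_monomial_mult[OF _ a]]) simp

section \<open>Exchanging a distribution with an integral\<close>

lemma fourier_mult_reflected_fourier:
  fixes a \<phi> :: "real^'n::finite \<Rightarrow> complex"
  assumes a: "a \<in> schwartz_space" and \<phi>: "\<phi> \<in> schwartz_space"
  shows "fourier (\<lambda>\<xi>. a \<xi> * fourier \<phi> (- \<xi>)) y = (LINT x|lborel. \<phi> x * fourier a (y - x))"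
proof -
  have "fourier (\<lambda>\<xi>. a \<xi> * fourier \<phi> (- \<xi>)) y
      = (LINT \<xi>|lborel. fourier (\<lambda>x. \<phi> (- x)) \<xi> * (plane_wave (- y) \<xi> * a \<xi>))"
    by (simp add: fourier_plane_wave[of "\<lambda>\<xi>. a \<xi> * fourier \<phi> (- \<xi>)"] fourier_reflect[OF \<phi>] mult_ac)
  also have "\<dots> = (LINT x|lborel. \<phi> (- x) * fourier (\<lambda>\<xi>. plane_wave (- y) \<xi> * a \<xi>) x)"
    by (intro fourier_swap schwartz_reflect schwartz_plane_wave_mult \<phi> a)
  also have "\<dots> = (LINT x|lborel. (\<lambda>x. \<phi> x * fourier a (y - x)) (- x))"
    by (simp add: fourier_plane_wave_mult add.commute)
  also have "\<dots> = (LINT x|lborel. \<phi> x * fourier a (y - x))"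
  proof (rule lborel_integral_uminus)
    have "(\<lambda>x. fourier a ((- 1) *\<^sub>R x + y)) \<in> schwartz_space"
      by (intro schwartz_affine schwartz_fourier a) simp
    then show "(\<lambda>x. \<phi> x * fourier a (y - x)) \<in> borel_measurable borel"
      using schwartz_mult[OF \<phi>] by (intro schwartz_borel) simp
  qed
  finally show ?thesis .
qed

text \<open>Stated with a given division and an oscillation bound, so that one division can serve
  the limit integral and all kernel integrals simultaneously.\<close>

lemma riemann_sum_bound:
  fixes f :: "'a::euclidean_space \<Rightarrow> 'b::euclidean_space"
  assumes D: "D tagged_division_of cbox a b" and fine: "(\<lambda>x. ball x \<delta>) fine D"
    and f: "f integrable_on cbox a b" and e: "0 \<le> e"
    and osc: "\<And>x y. x \<in> cbox a b \<Longrightarrow> y \<in> cbox a b \<Longrightarrow> dist x y < \<delta> \<Longrightarrow> norm (f x - f y) \<le> e"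
  shows "norm (integral (cbox a b) f - (\<Sum>(x, k)\<in>D. measure lborel k *\<^sub>R f x)) \<le> e * measure lborel (cbox a b)"
proof -
  have "integral (cbox a b) f - (\<Sum>(x, k)\<in>D. measure lborel k *\<^sub>R f x)
      = (\<Sum>p\<in>D. integral (snd p) f - measure lborel (snd p) *\<^sub>R f (fst p))"
    unfolding sum_subtractf integral_combine_tagged_division_topdown[OF f D] split_def by (rule refl)
  also have "norm \<dots> \<le> (\<Sum>p\<in>D. e * measure lborel (snd p))"
  proof (rule sum_norm_le)
    fix p assume pD: "p \<in> D"
    obtain x k where p: "p = (x, k)" by (cases p)
    have xk: "(x, k) \<in> D" using pD p by simp
    note t = tagged_division_ofD[OF D]
    obtain c d where k: "k = cbox c d" using t(4)[OF xk] by blast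
    have sub: "k \<subseteq> cbox a b" and x: "x \<in> k" using t(2,3)[OF xk] by auto
    have "f integrable_on cbox c d"
      using integrable_on_subcbox[OF f] sub by (simp add: k)
    then have "((\<lambda>y. f y - f x) has_integral (integral k f - measure lborel k *\<^sub>R f x)) (cbox c d)"
      unfolding k by (intro has_integral_diff has_integral_const integrable_integral)
    moreover have "norm (f y - f x) \<le> e" if "y \<in> cbox c d" for y
    proof -
      have "y \<in> ball x \<delta>" using fineD[OF fine xk] that k by auto
      then show ?thesis using osc[of y x] that k sub x by (auto simp: dist_commute)
    qed
    ultimately have "norm (integral k f - measure lborel k *\<^sub>R f x) \<le> e * measure lborel k"
      unfolding k using has_integral_bound[OF e] by blast
    then show "norm (integral (snd p) f - measure lborel (snd p) *\<^sub>R f (fst p)) \<le> e * measure lborel (snd p)"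
      by (simp add: p)
  qed
  also have "\<dots> = e * measure lborel (cbox a b)"
    unfolding sum_distrib_left[symmetric]
    using additive_content_tagged_division[OF D] by (simp add: split_def)
  finally show ?thesis .
qed


lemma lborel_integral_eq_integral_cbox:
  fixes f :: "'a::euclidean_space \<Rightarrow> complex"
  assumes "integrable lborel f" "\<And>x. x \<notin> cbox a b \<Longrightarrow> f x = 0"
  shows "f integrable_on cbox a b" "integral (cbox a b) f = (LINT x|lborel. f x)"
proof -
  have "(\<lambda>x. if x \<in> cbox a b then f x else 0) = f"
    using assms(2) by auto
  then have "((\<lambda>x. if x \<in> cbox a b then f x else 0) has_integral (LINT x|lborel. f x)) UNIV"
    using has_integral_integral_lborel[OF assms(1)] by simp
  then have "(f has_integral (LINT x|lborel. f x)) (cbox a b)"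
    by (simp only: has_integral_restrict_UNIV)
  then show "f integrable_on cbox a b" "integral (cbox a b) f = (LINT x|lborel. f x)"
    by (auto simp: integrable_on_def integral_unique)
qed

text \<open>The Riemann sums of \<open>\<integral> \<phi>(x) (F a)(y - x) dx\<close> converge in every Schwartz seminorm.\<close>

lemma tempered_integral_interchange:
  fixes a \<phi> :: "real^'n::finite \<Rightarrow> complex"
  assumes u: "u \<in> tempered_distributions" and a: "a \<in> schwartz_space" and \<phi>: "\<phi> \<in> test_functions UNIV"
  shows "u (fourier (\<lambda>\<xi>. a \<xi> * fourier \<phi> (- \<xi>))) = (LINT x|lborel. \<phi> x * wave_value u a x)"
proof -
  have s\<phi>: "\<phi> \<in> schwartz_space" by (rule test_functions_schwartz[OF \<phi>])
  have "bounded (closure {x. \<phi> x \<noteq> 0})"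
    using \<phi> by (auto simp: test_functions_def compact_imp_bounded)
  then obtain c d where cd: "closure {x. \<phi> x \<noteq> 0} \<subseteq> cbox c d"
    using bounded_subset_cbox_symmetric by blast
  have \<phi>0: "\<phi> x = 0" if "x \<notin> cbox c d" for x
    using that cd closure_subset[of "{x. \<phi> x \<noteq> 0}"] by blast
  obtain C K where C: "0 \<le> C" and uC: "\<And>\<phi> A. \<phi> \<in> schwartz_space \<Longrightarrow>
       (\<And>\<alpha> x. length \<alpha> \<le> K \<Longrightarrow> japanese x ^ K * norm (iter_deriv \<alpha> \<phi> x) \<le> A) \<Longrightarrow> norm (u \<phi>) \<le> C * A"
    using tempered_bound[OF u] by metis
  define k where "k = fourier a"
  have sk: "k \<in> schwartz_space" unfolding k_def by (rule schwartz_fourier[OF a])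
  obtain A where A: "\<And>z. sym_bound (K + 1) (- real K) A k z"
    using schwartz_sym_bound[OF sk] by blast
  have A0: "0 \<le> A" using sym_bound_nonneg[OF A] .
  obtain B where B: "\<And>z. sym_bound 1 1 B \<phi> z"
    using schwartz_sym_bound[OF s\<phi>] by blast
  have B0: "0 \<le> B" using sym_bound_nonneg[OF B] .
  have "bounded (japanese ` cbox c d)"
    by (intro compact_imp_bounded compact_continuous_image continuous_on_japanese compact_cbox)
  then obtain J where "\<forall>z\<in>japanese ` cbox c d. norm z \<le> J"
    unfolding bounded_iff by blast
  then have J: "japanese x \<le> J" if "x \<in> cbox c d" for x
    using that by auto
  obtain B' where B': "0 \<le> B'" "\<And>x. norm (\<phi> x) \<le> B' * japanese x powr 0"
    using schwartz_bound[OF s\<phi>] by blast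
  \<comment> \<open>The two summands belong to the two terms of the product rule. On the box the
    weight is at most \<open>J\<close>, so Peetre's inequality transfers the kernel's decay to
    \<open>y\<close>.\<close>
  define M where "M = (B + B') * (A * (2 * J) powr real K)"
  define g where "g \<alpha> y x = \<phi> x * iter_deriv \<alpha> k ((- 1) *\<^sub>R x + y)" for \<alpha> y x
  have sg: "g \<alpha> y \<in> schwartz_space" for \<alpha> y
    unfolding g_def by (intro schwartz_mult s\<phi> schwartz_affine schwartz_iter_deriv sk) simp
  \<comment> \<open>The Lipschitz constant in the integration variable decays like the inverse K-th
    power of the weight of \<open>y\<close>, which is what the seminorm of \<open>u\<close> requires
    of the Riemann error.\<close>
  have osc: "norm (g \<alpha> y x - g \<alpha> y x') \<le> real CARD('n) * (M * japanese y powr - real K) * norm (x - x')"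
    if \<alpha>: "length \<alpha> \<le> K" and x: "x \<in> cbox c d" "x' \<in> cbox c d" for \<alpha> y x x'
  proof (rule smooth_lipschitz[OF schwartz_smooth[OF sg] convex_box(1) x])
    fix i z assume z: "z \<in> cbox c d"
    let ?h = "iter_deriv \<alpha> k"
    have sh: "?h \<in> schwartz_space" by (rule schwartz_iter_deriv[OF sk])
    let ?y = "(- 1) *\<^sub>R z + y"
    have near: "A * japanese ?y powr - real K \<le> A * (2 * J) powr real K * japanese y powr - real K"
    proof -
      have "japanese ?y powr - real K \<le> (2 * japanese z) powr real K * japanese y powr - real K"
        using japanese_powr_shift[of "real K" "?y" y] by (simp add: algebra_simps)
      also have "\<dots> \<le> (2 * J) powr real K * japanese y powr - real K"
        using J[OF z] by (intro mult_right_mono powr_mono2) auto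
      finally show ?thesis using A0 by (simp add: mult.assoc mult_left_mono)
    qed
    have h: "norm (iter_deriv \<beta> k ?y) \<le> A * (2 * J) powr real K * japanese y powr - real K" if "length \<beta> \<le> K + 1" for \<beta>
    proof -
      have "norm (iter_deriv \<beta> k ?y) \<le> A * japanese ?y powr (- real K - real (length \<beta>))"
        by (rule sym_boundD[OF A that])
      also have "\<dots> \<le> A * japanese ?y powr - real K"
        by (intro mult_left_mono japanese_powr_mono A0) auto
      finally show ?thesis using near by linarith
    qed
    have d\<phi>: "norm (partial_deriv i \<phi> z) \<le> B" and n\<phi>: "norm (\<phi> z) \<le> B'"
      using sym_boundD[OF B, of "[i]" z] B'(2)[of z] by simp_all
    have "partial_deriv i (\<lambda>x. ?h ((- 1) *\<^sub>R x + y)) z = of_real (- 1) * partial_deriv i ?h ?y"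
      by (intro partial_deriv_affine) (use smooth_on_differentiable[OF schwartz_smooth[OF sh], of _ "[]"] in simp)
    then have "partial_deriv i (g \<alpha> y) z = \<phi> z * (of_real (- 1) * partial_deriv i ?h ?y) + partial_deriv i \<phi> z * ?h ?y"
      using iter_deriv_mult[OF open_UNIV schwartz_smooth[OF s\<phi>] schwartz_smooth[OF schwartz_affine[OF sh, of "- 1" y]] UNIV_I, of "[i]" z]
      by (simp add: g_def[abs_def])
    also have "norm \<dots> \<le> B' * (A * (2 * J) powr real K * japanese y powr - real K)
        + B * (A * (2 * J) powr real K * japanese y powr - real K)"
      using h[of "i # \<alpha>"] h[of \<alpha>] \<alpha> d\<phi> n\<phi> B0 B'(1)
      by (intro order.trans[OF norm_triangle_ineq] add_mono) (auto simp: norm_mult intro!: mult_mono)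
    finally show "norm (partial_deriv i (g \<alpha> y) z) \<le> M * japanese y powr - real K"
      by (simp add: M_def algebra_simps)
  qed
  define T where "T = fourier (\<lambda>\<xi>. a \<xi> * fourier \<phi> (- \<xi>))"
  have sT': "(\<lambda>\<xi>. a \<xi> * fourier \<phi> (- \<xi>)) \<in> schwartz_space"
    by (intro schwartz_mult schwartz_reflect schwartz_fourier s\<phi> a)
  have sT: "T \<in> schwartz_space"
    unfolding T_def by (rule schwartz_fourier[OF sT'])
  have dT: "iter_deriv \<alpha> T y = integral (cbox c d) (g \<alpha> y)" for \<alpha> y
  proof -
    have "iter_deriv \<alpha> T y = fourier (\<lambda>\<xi>. (monomial (- \<i>) \<alpha> \<xi> * a \<xi>) * fourier \<phi> (- \<xi>)) y"
      unfolding T_def iter_deriv_fourier[OF sT'] by (simp add: mult.assoc)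
    also have "\<dots> = (LINT x|lborel. \<phi> x * fourier (\<lambda>\<xi>. monomial (- \<i>) \<alpha> \<xi> * a \<xi>) (y - x))"
      by (intro fourier_mult_reflected_fourier schwartz_monomial_mult a s\<phi>) simp
    also have "\<dots> = (LINT x|lborel. g \<alpha> y x)"
      by (simp add: g_def k_def iter_deriv_fourier[OF a])
    also have "\<dots> = integral (cbox c d) (g \<alpha> y)"
      by (rule lborel_integral_eq_integral_cbox(2)[OF integrable_schwartz[OF sg], symmetric])
        (simp add: g_def \<phi>0)
    finally show ?thesis .
  qed
  have gi: "g \<alpha> y integrable_on cbox c d" for \<alpha> y
    by (rule lborel_integral_eq_integral_cbox(1)[OF integrable_schwartz[OF sg]]) (simp add: g_def \<phi>0)
  define F where "F x = \<phi> x * wave_value u a x" for x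
  have cF: "continuous_on UNIV F"
    unfolding F_def
    by (intro continuous_intros schwartz_continuous_on[OF s\<phi>]
        smooth_on_continuous_on[OF smooth_on_wave_value[OF u a], of "[]", simplified])
  have Fi: "F integrable_on cbox c d"
    by (rule integrable_continuous[OF continuous_on_subset[OF cF]]) simp
  have Fe: "(LINT x|lborel. F x) = integral (cbox c d) F"
  proof -
    have F0: "F x = 0" if "x \<notin> cbox c d" for x using \<phi>0[OF that] by (simp add: F_def)
    have "integrable lborel (\<lambda>x. indicator (cbox c d) x *\<^sub>R F x)"
      using borel_integrable_compact[OF compact_cbox continuous_on_subset[OF cF]] by (simp add: set_integrable_def)
    moreover have "(\<lambda>x. indicator (cbox c d) x *\<^sub>R F x) = F"
      using F0 by (auto simp: indicator_def)
    ultimately have "integrable lborel F" by simp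
    from lborel_integral_eq_integral_cbox(2)[OF this F0] show ?thesis by simp
  qed
  define V where "V = measure lborel (cbox c d)"
  have main: "norm (u T - integral (cbox c d) F) \<le> \<epsilon> * (C * (real CARD('n) * M * V) + V)" if \<epsilon>: "0 < \<epsilon>" for \<epsilon>
  proof -
    have "uniformly_continuous_on (cbox c d) F"
      by (intro compact_uniformly_continuous continuous_on_subset[OF cF]) auto
    then obtain \<delta>0 where \<delta>0: "0 < \<delta>0" "\<And>x x'. x \<in> cbox c d \<Longrightarrow> x' \<in> cbox c d \<Longrightarrow> dist x' x < \<delta>0 \<Longrightarrow> dist (F x') (F x) < \<epsilon>"
      unfolding uniformly_continuous_on_def using \<epsilon> by metis
    \<comment> \<open>\<open>F\<close> is treated by uniform continuity alone, which gives
      \<delta>0; the kernels are Lipschitz, for which a mesh of size \<epsilon> suffices.\<close>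
    define \<delta> where "\<delta> = min \<delta>0 \<epsilon>"
    have \<delta>: "0 < \<delta>" using \<delta>0 \<epsilon> by (simp add: \<delta>_def)
    obtain D where D: "D tagged_division_of cbox c d" "(\<lambda>x. ball x \<delta>) fine D"
      using fine_division_exists[OF gauge_ball[OF \<delta>]] .
    have 1: "norm (integral (cbox c d) F - (\<Sum>(x, l)\<in>D. measure lborel l *\<^sub>R F x)) \<le> \<epsilon> * V"
      unfolding V_def
    proof (rule riemann_sum_bound[OF D Fi])
      fix x y assume "x \<in> cbox c d" "y \<in> cbox c d" "dist x y < \<delta>"
      then show "norm (F x - F y) \<le> \<epsilon>"
        using \<delta>0(2)[of y x] by (simp add: \<delta>_def dist_norm)
    qed (use \<epsilon> in simp)
    \<comment> \<open>The Riemann sum for \<open>T\<close>. It is a finite combination of translated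
      kernels, so \<open>u\<close> passes through it by linearity and yields the Riemann sum of
      \<open>F\<close> for the same division.\<close>
    define S where "S y = (\<Sum>p\<in>D. of_real (measure lborel (snd p)) * (\<phi> (fst p) * fourier (\<lambda>\<xi>. plane_wave (fst p) \<xi> * a \<xi>) y))" for y
    have ss: "fourier (\<lambda>\<xi>. plane_wave x \<xi> * a \<xi>) \<in> schwartz_space" for x
      by (intro schwartz_fourier schwartz_plane_wave_mult a)
    have sS: "S \<in> schwartz_space"
      unfolding S_def by (intro schwartz_sum schwartz_cmult ss)
    have uS: "u S = (\<Sum>(x, l)\<in>D. measure lborel l *\<^sub>R F x)"
    proof -
      have "u S = (\<Sum>p\<in>D. u (\<lambda>y. of_real (measure lborel (snd p)) * (\<phi> (fst p) * fourier (\<lambda>\<xi>. plane_wave (fst p) \<xi> * a \<xi>) y)))"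
        unfolding S_def[abs_def] by (intro tempered_sum[OF u] schwartz_cmult ss)
      also have "\<dots> = (\<Sum>p\<in>D. of_real (measure lborel (snd p)) * (\<phi> (fst p) * wave_value u a (fst p)))"
        by (intro sum.cong refl) (simp add: tempered_cmult[OF u] schwartz_cmult ss wave_value_def)
      also have "\<dots> = (\<Sum>(x, l)\<in>D. measure lborel l *\<^sub>R F x)"
        by (simp add: F_def case_prod_unfold scaleR_conv_of_real)
      finally show ?thesis .
    qed
    have "norm (u (\<lambda>y. T y - S y)) \<le> C * (real CARD('n) * M * \<epsilon> * V)"
    proof (rule uC[OF schwartz_diff[OF sT sS]])
      fix \<alpha> :: "'n list" and y :: "real^'n" assume \<alpha>: "length \<alpha> \<le> K"
      have dS: "iter_deriv \<alpha> S y = (\<Sum>(x, l)\<in>D. measure lborel l *\<^sub>R g \<alpha> y x)"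
      proof -
        have "iter_deriv \<alpha> S y = (\<Sum>p\<in>D. iter_deriv \<alpha> (\<lambda>y. of_real (measure lborel (snd p)) * (\<phi> (fst p) * fourier (\<lambda>\<xi>. plane_wave (fst p) \<xi> * a \<xi>) y)) y)"
          unfolding S_def[abs_def] by (intro iter_deriv_sum[OF open_UNIV] schwartz_smooth schwartz_cmult ss) simp
        also have "\<dots> = (\<Sum>p\<in>D. of_real (measure lborel (snd p)) * (\<phi> (fst p) * iter_deriv \<alpha> k (y - fst p)))"
        proof (intro sum.cong refl)
          fix p
          show "iter_deriv \<alpha> (\<lambda>y. of_real (measure lborel (snd p)) * (\<phi> (fst p) * fourier (\<lambda>\<xi>. plane_wave (fst p) \<xi> * a \<xi>) y)) y
            = of_real (measure lborel (snd p)) * (\<phi> (fst p) * iter_deriv \<alpha> k (y - fst p))"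
            by (simp add: iter_deriv_cmult[OF open_UNIV schwartz_smooth[OF schwartz_cmult[OF ss]] UNIV_I]
                iter_deriv_cmult[OF open_UNIV schwartz_smooth[OF ss] UNIV_I] iter_deriv_fourier_shift[OF a] k_def)
        qed
        also have "\<dots> = (\<Sum>(x, l)\<in>D. measure lborel l *\<^sub>R g \<alpha> y x)"
          by (simp add: g_def case_prod_unfold scaleR_conv_of_real)
        finally show ?thesis .
      qed
      have "norm (iter_deriv \<alpha> (\<lambda>y. T y - S y) y) \<le> (real CARD('n) * (M * japanese y powr - real K) * \<epsilon>) * V"
        unfolding iter_deriv_diff[OF open_UNIV schwartz_smooth[OF sT] schwartz_smooth[OF sS] UNIV_I] dT dS V_def
      proof (rule riemann_sum_bound[OF D gi])
        have M0: "0 \<le> M" using A0 B0 B' by (simp add: M_def)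
        then show "0 \<le> real CARD('n) * (M * japanese y powr - real K) * \<epsilon>" using \<epsilon> by simp
        fix x x' assume x: "x \<in> cbox c d" "x' \<in> cbox c d" and "dist x x' < \<delta>"
        then have "norm (x - x') \<le> \<epsilon>" by (simp add: \<delta>_def dist_norm)
        then show "norm (g \<alpha> y x - g \<alpha> y x') \<le> real CARD('n) * (M * japanese y powr - real K) * \<epsilon>"
          using M0 by (intro order.trans[OF osc[OF \<alpha> x]] mult_left_mono) auto
      qed
      then show "japanese y ^ K * norm (iter_deriv \<alpha> (\<lambda>y. T y - S y) y) \<le> real CARD('n) * M * \<epsilon> * V"
        by (simp add: powr_minus powr_realpow field_simps)
    qed
    then have 2: "norm (u T - u S) \<le> C * (real CARD('n) * M * \<epsilon> * V)"
      by (simp add: tempered_diff[OF u sT sS])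
    have "u T - integral (cbox c d) F = (u T - u S) - (integral (cbox c d) F - u S)" by simp
    also have "norm \<dots> \<le> C * (real CARD('n) * M * \<epsilon> * V) + \<epsilon> * V"
      by (rule order.trans[OF norm_triangle_ineq4 add_mono[OF 2 1[folded uS]]])
    finally show ?thesis by (simp add: algebra_simps)
  qed
  then have "u T - integral (cbox c d) F = 0" by (rule eq_0_if_norm_le_mult)
  then show ?thesis using Fe by (simp add: T_def F_def)
qed

section \<open>Localisation\<close>

lemma sym_bound_diff:
  assumes "open S" "smooth_on S f" "smooth_on S g" "x \<in> S"
    and f: "sym_bound L m A f x" and g: "sym_bound L m B g x"
  shows "sym_bound L m (A + B) (\<lambda>x. f x - g x) x"
  using sym_bound_add[OF assms(1,2) smooth_on_cmult[OF assms(1,3), of "-1"] assms(4) f]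
    sym_bound_cmult[OF assms(1,3,4) g, of "-1"] by simp

lemma test_functions_mono: "W \<subseteq> W' \<Longrightarrow> test_functions W \<subseteq> test_functions W'"
  by (auto simp: test_functions_def)

text \<open>\<open>v\<close> is smooth only on \<open>W\<close>. The product is glued from its
  smooth restriction to \<open>W\<close> and zero off the support of \<open>\<eta>\<close>; the two
  open sets cover the space.\<close>

lemma test_functions_mult:
  fixes v \<eta> :: "real^'n::finite \<Rightarrow> complex"
  assumes W: "open W" and v: "smooth_on W v" and \<eta>: "\<eta> \<in> test_functions W"
  shows "(\<lambda>x. v x * \<eta> x) \<in> test_functions W"
proof -
  let ?K = "closure {x. \<eta> x \<noteq> 0}"
  have \<eta>': "smooth_on UNIV \<eta>" "compact ?K" "?K \<subseteq> W"
    using \<eta> by (auto simp: test_functions_def)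
  have "smooth_on W (\<lambda>x. v x * \<eta> x)"
    by (intro smooth_on_mult W v smooth_on_subset[OF \<eta>'(1)]) auto
  moreover have "smooth_on (- ?K) (\<lambda>x. v x * \<eta> x)"
    using closure_subset[of "{x. \<eta> x \<noteq> 0}"]
    by (intro smooth_on_cong[OF _ _ smooth_on_const[of _ 0]]) auto
  moreover have "W \<union> - ?K = UNIV" using \<eta>'(3) by auto
  ultimately have s: "smooth_on UNIV (\<lambda>x. v x * \<eta> x)"
    using smooth_on_Un by metis
  have sub: "closure {x. v x * \<eta> x \<noteq> 0} \<subseteq> ?K"
    by (intro closure_mono) auto
  then have "compact (closure {x. v x * \<eta> x \<noteq> 0})"
    using bounded_subset[OF compact_imp_bounded[OF \<eta>'(2)] sub] by (simp add: compact_eq_bounded_closed)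
  then show ?thesis using s sub \<eta>'(3) by (auto simp: test_functions_def)
qed

text \<open>Where the symbol does not vanish identically nearby, the weight is at least \<rho>, so
  one of its powers can be exchanged for 1/\<rho>. The symbol estimate is needed only there.\<close>

lemma sym_bound_gain:
  fixes a :: "real^'n::finite \<Rightarrow> complex"
  assumes a0: "\<And>\<xi>. norm \<xi> < \<rho> \<Longrightarrow> a \<xi> = 0" and \<rho>: "0 < \<rho>" and A: "0 \<le> A"
    and b: "\<And>\<xi>. \<rho> \<le> norm \<xi> \<Longrightarrow> sym_bound L m A a \<xi>"
  shows "sym_bound L (m + 1) (A / \<rho>) a \<xi>"
proof (cases "norm \<xi> < \<rho>")
  case True
  have "sym_bound L (m + 1) (A / \<rho>) (\<lambda>_. 0) \<xi>"
    using A \<rho> by (intro sym_bound_zero) simp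
  then show ?thesis
    using sym_bound_cong_open[of "ball 0 \<rho>" \<xi> a "\<lambda>_. 0"] a0 True by (simp add: dist_norm)
next
  case False
  then have le: "\<rho> \<le> japanese \<xi>" using norm_le_japanese[of \<xi>] by linarith
  show ?thesis
    unfolding sym_bound_def
  proof (intro allI impI)
    fix \<alpha> :: "'n list" assume \<alpha>: "length \<alpha> \<le> L"
    have "norm (iter_deriv \<alpha> a \<xi>) \<le> A * japanese \<xi> powr (m - real (length \<alpha>))"
      using False by (intro sym_boundD[OF b \<alpha>]) simp
    also have "\<dots> = A * (1 / japanese \<xi>) * japanese \<xi> powr (m + 1 - real (length \<alpha>))"
    proof -
      have "japanese \<xi> powr (m + 1 - real (length \<alpha>)) = japanese \<xi> powr (m - real (length \<alpha>)) * japanese \<xi> powr 1"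
        by (subst powr_add[symmetric]) (simp add: algebra_simps)
      then show ?thesis by simp
    qed
    also have "\<dots> \<le> A * (1 / \<rho>) * japanese \<xi> powr (m + 1 - real (length \<alpha>))"
      using le \<rho> A by (intro mult_right_mono mult_left_mono frac_le) auto
    finally show "norm (iter_deriv \<alpha> a \<xi>) \<le> A / \<rho> * japanese \<xi> powr (m + 1 - real (length \<alpha>))" by simp
  qed
qed

section \<open>Bump functions, pseudolocality and uniqueness of representatives\<close>

context cutoff_function
begin

text \<open>The cutoff rescaled to be 1 within distance \<open>d\<close> of \<open>x0\<close> and
  supported within 2d. The affine form is the one covered by the differentiation rule for affine
  substitutions.\<close>

definition bump :: "real^'n \<Rightarrow> real \<Rightarrow> real^'n \<Rightarrow> complex" where
  "bump x0 d y = \<kappa> ((1 / d) *\<^sub>R y + (- (1 / d)) *\<^sub>R x0)"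

lemma bump_norm: "0 < d \<Longrightarrow> norm ((1 / d) *\<^sub>R y + (- (1 / d)) *\<^sub>R x0) = norm (y - x0) / d"
  by (simp add: scaleR_diff_right[symmetric])

lemma bump_eq_1: "0 < d \<Longrightarrow> norm (y - x0) \<le> d \<Longrightarrow> bump x0 d y = 1"
  unfolding bump_def by (rule one) (simp only: bump_norm, simp)

lemma bump_test_function:
  assumes "0 < d" "cball x0 (2 * d) \<subseteq> W"
  shows "bump x0 d \<in> test_functions W"
proof -
  have "smooth_on UNIV (bump x0 d)"
    unfolding bump_def using test by (intro smooth_on_affine) (auto simp: test_functions_def)
  moreover have "{y. bump x0 d y \<noteq> 0} \<subseteq> cball x0 (2 * d)"
  proof
    fix y assume "y \<in> {y. bump x0 d y \<noteq> 0}"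
    then have "\<not> 2 \<le> norm (y - x0) / d"
      using zero bump_norm[OF assms(1), of y x0] by (fastforce simp: bump_def)
    then show "y \<in> cball x0 (2 * d)"
      using assms(1) by (simp add: dist_norm norm_minus_commute field_simps)
  qed
  then have "closure {y. bump x0 d y \<noteq> 0} \<subseteq> cball x0 (2 * d)"
    by (rule closure_minimal) simp
  moreover from this have "compact (closure {y. bump x0 d y \<noteq> 0})"
    using bounded_subset[OF bounded_cball] by (simp add: compact_eq_bounded_closed)
  ultimately show ?thesis
    using assms(2) by (auto simp: test_functions_def)
qed

text \<open>The order \<open>M\<close> is arbitrary, while \<open>L\<close> and \<open>C\<close> do
  not depend on \<open>b\<close> or \<open>x\<close>. Near \<open>x0\<close> the growth of
  \<open>b\<close> is absorbed by the transform of a test function, away from it by sufficiently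
  many Laplacians.\<close>

lemma pseudolocality:
  fixes f :: "(real^'n \<Rightarrow> complex) \<Rightarrow> complex"
  assumes f: "f \<in> tempered_distributions" and v: "represents_on W v f"
    and d: "0 < d" and sub: "cball x0 (2 * d) \<subseteq> W"
  shows "\<exists>L C. \<forall>b\<in>schwartz_space. \<forall>A. (\<forall>\<xi>. sym_bound L M A b \<xi>) \<longrightarrow>
    (\<forall>x\<in>ball x0 (d / 2). norm (wave_value f b x) \<le> C * A)"
proof -
  obtain C0 K where C0: "0 \<le> C0" and fC: "\<And>\<phi> A. \<phi> \<in> schwartz_space \<Longrightarrow>
       (\<And>\<alpha> x. length \<alpha> \<le> K \<Longrightarrow> japanese x ^ K * norm (iter_deriv \<alpha> \<phi> x) \<le> A) \<Longrightarrow> norm (f \<phi>) \<le> C0 * A"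
    using tempered_bound[OF f] by metis
  define \<eta> where "\<eta> = bump x0 d"
  have \<eta>: "\<eta> \<in> test_functions W" unfolding \<eta>_def by (rule bump_test_function[OF d sub])
  have s\<eta>: "\<eta> \<in> schwartz_space" by (rule test_functions_schwartz[OF \<eta>])
  have W: "open W" and sv: "smooth_on W v" and rep: "\<And>\<phi>. \<phi> \<in> test_functions W \<Longrightarrow> f \<phi> = (LINT x|lborel. v x * \<phi> x)"
    using v by (auto simp: represents_on_def)
  define h where "h x = v x * \<eta> x" for x
  have sh: "h \<in> schwartz_space"
    unfolding h_def by (rule test_functions_schwartz[OF test_functions_mult[OF W sv \<eta>]])
  define n2 where "n2 = real CARD('n) + 2"
  \<comment> \<open>The decay beats the growth of a symbol of order \<open>M\<close> and leaves an
    integrable power.\<close>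
  obtain H where H: "0 \<le> H" "\<And>\<xi>. norm (fourier h \<xi>) \<le> H * japanese \<xi> powr (- n2 - M)"
    using schwartz_bound[OF schwartz_fourier[OF sh]] by blast
  define J where "J = (LINT x|lborel. japanese (x::real^'n) powr (- n2))"
  have J0: "0 \<le> J" unfolding J_def by (intro integral_nonneg_AE) auto
  have s1: "smooth_on UNIV (\<lambda>y. 1 - \<eta> y)"
    by (intro smooth_on_diff open_UNIV smooth_on_const schwartz_smooth[OF s\<eta>])
  obtain E0 where "\<And>y. sym_bound K 0 E0 \<eta> y" using schwartz_sym_bound[OF s\<eta>] by blast
  then have E: "sym_bound K 0 (1 + E0) (\<lambda>y. 1 - \<eta> y) y" for y
    using sym_bound_diff[OF open_UNIV smooth_on_const schwartz_smooth[OF s\<eta>] UNIV_I sym_bound_const[of K 1]] by simp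
  obtain k0 :: nat where "(M + real K + n2) / 2 \<le> real k0"
    using real_arch_simple by blast
  then have k0: "M + real K + n2 \<le> 2 * real k0" by simp
  \<comment> \<open>\<open>k0\<close> Laplacians make the transform integral converge after K
    derivatives; \<open>k\<close> at least K lets the power 2k of the distance also absorb the
    weight of the seminorm.\<close>
  define k where "k = max k0 K"
  have k: "M + real K - 2 * real k \<le> - n2" "K \<le> 2 * k"
    using k0 by (auto simp: k_def)
  define c where "c = real CARD('n) ^ k * 2 ^ (2 * k) * 2 ^ (2 * k * K) * J"
  have c0: "0 \<le> c" using J0 by (simp add: c_def)
  \<comment> \<open>Chosen so that \<open>japanese y\<close> is at most \<open>q\<close> times the
    distance from \<open>y\<close> to \<open>x\<close> once this distance is at least d/2.\<close>
  define q where "q = (1 + norm x0 + d / 2) / (d / 2) + 1"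
  have q: "0 \<le> q" using d by (simp add: q_def add_nonneg_nonneg)
  define C where "C = H * J + C0 * (2 ^ K * ((1 + E0) * (q ^ (2 * k) * c)))"
  have "norm (wave_value f b x) \<le> C * A"
    if b: "b \<in> schwartz_space" and A: "\<And>\<xi>. sym_bound (2 * k) M A b \<xi>" and x: "x \<in> ball x0 (d / 2)" for b A x
  proof -
    have A0: "0 \<le> A" using sym_bound_nonneg[OF A] .
    define G where "G = fourier (\<lambda>\<xi>. plane_wave x \<xi> * b \<xi>)"
    have sb: "(\<lambda>\<xi>. plane_wave x \<xi> * b \<xi>) \<in> schwartz_space" by (rule schwartz_plane_wave_mult[OF b])
    have sG: "G \<in> schwartz_space"
      unfolding G_def by (rule schwartz_fourier[OF sb])
    have s\<eta>G: "(\<lambda>y. \<eta> y * G y) \<in> schwartz_space" by (rule schwartz_mult[OF s\<eta> sG])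
    have sG': "(\<lambda>y. (1 - \<eta> y) * G y) \<in> schwartz_space"
      using schwartz_diff[OF sG s\<eta>G] by (simp add: algebra_simps)
    have split: "f G = f (\<lambda>y. \<eta> y * G y) + f (\<lambda>y. (1 - \<eta> y) * G y)"
      using tempered_add[OF f s\<eta>G sG'] by (simp add: algebra_simps)
    have near: "norm (f (\<lambda>y. \<eta> y * G y)) \<le> H * A * J"
    proof -
      have "(\<lambda>y. G y * \<eta> y) \<in> test_functions W"
        by (intro test_functions_mult W \<eta> smooth_on_subset[OF schwartz_smooth[OF sG]]) auto
      \<comment> \<open>On \<open>W\<close> the distribution is the function \<open>v\<close>. The
        multiplication formula then moves the integral to the frequency side, where \<open>b\<close>
        itself appears instead of its kernel.\<close>
      then have "f (\<lambda>y. \<eta> y * G y) = (LINT y|lborel. h y * G y)"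
        using rep by (simp add: h_def mult_ac)
      also have "\<dots> = (LINT \<xi>|lborel. fourier h \<xi> * (plane_wave x \<xi> * b \<xi>))"
        unfolding G_def by (rule fourier_swap[OF sh sb, symmetric])
      also have "norm \<dots> \<le> H * A * J"
        unfolding J_def n2_def
      proof (rule norm_integral_decay[OF _ _ order.refl])
        show "(\<lambda>\<xi>. fourier h \<xi> * (plane_wave x \<xi> * b \<xi>)) \<in> borel_measurable borel"
          by (intro schwartz_borel schwartz_mult schwartz_fourier sh sb)
        fix \<xi> :: "real^'n"
        have "norm (b \<xi>) \<le> A * japanese \<xi> powr M" using sym_boundD[OF A, of "[]" \<xi>] by simp
        then have "norm (fourier h \<xi> * (plane_wave x \<xi> * b \<xi>))
            \<le> (H * japanese \<xi> powr (- n2 - M)) * (A * japanese \<xi> powr M)"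
          using H by (auto simp: norm_mult intro!: mult_mono)
        also have "\<dots> = H * A * (japanese \<xi> powr (- n2 - M) * japanese \<xi> powr M)" by simp
        also have "\<dots> = H * A * japanese \<xi> powr (- (real CARD('n) + 2))"
          by (simp only: powr_add[symmetric]) (simp add: n2_def)
        finally show "norm (fourier h \<xi> * (plane_wave x \<xi> * b \<xi>)) \<le> H * A * japanese \<xi> powr (- (real CARD('n) + 2))" .
      qed
      finally show ?thesis .
    qed
    have away: "norm (f (\<lambda>y. (1 - \<eta> y) * G y)) \<le> C0 * (2 ^ K * ((1 + E0) * (q ^ (2 * k) * (c * A))))"
    proof (rule fC[OF sG'])
      fix \<alpha> :: "'n list" and y :: "real^'n" assume \<alpha>: "length \<alpha> \<le> K"
      have E00: "0 \<le> 1 + E0" using sym_bound_nonneg[OF E] .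
      show "japanese y ^ K * norm (iter_deriv \<alpha> (\<lambda>y. (1 - \<eta> y) * G y) y)
          \<le> 2 ^ K * ((1 + E0) * (q ^ (2 * k) * (c * A)))"
      proof (cases "norm (y - x0) < d")
        case True
        have "iter_deriv \<alpha> (\<lambda>y. (1 - \<eta> y) * G y) y = iter_deriv \<alpha> (\<lambda>_. 0) y"
          using True d by (intro iter_deriv_cong_open[of "ball x0 d"])
            (auto simp: dist_norm norm_minus_commute \<eta>_def bump_eq_1)
        then show ?thesis
          using E00 q c0 A0 by (simp add: iter_deriv_const)
      next
        case False
        \<comment> \<open>\<open>y\<close> is at least \<open>d\<close> away from \<open>x0\<close>
          and \<open>x\<close> less than d/2, so the kernel is evaluated away from its singularity
          at the origin.\<close>
        have far: "d / 2 \<le> norm (y - x)"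
          using False x norm_triangle_ineq[of "y - x" "x - x0"] by (simp add: dist_norm norm_minus_commute)
        have "japanese y \<le> q * norm (y - x)"
        proof -
          have "japanese y \<le> 1 + norm y"
            unfolding japanese_def by (rule real_le_lsqrt) (auto simp: power2_sum)
          also have "norm y \<le> norm x0 + d / 2 + norm (y - x)"
            using x norm_triangle_ineq[of "y - x" x] norm_triangle_ineq[of "x - x0" x0]
            by (simp add: dist_norm norm_minus_commute)
          also have "1 + (norm x0 + d / 2 + norm (y - x)) \<le> q * norm (y - x)"
          proof -
            define X where "X = 1 + norm x0 + d / 2"
            have "0 \<le> X / (d / 2)" using d by (simp add: X_def)
            then have "X / (d / 2) * (d / 2) \<le> X / (d / 2) * norm (y - x)"
              by (intro mult_left_mono far)
            moreover have "X / (d / 2) * (d / 2) = X" using d by simp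
            ultimately have "X \<le> X / (d / 2) * norm (y - x)" by linarith
            then show ?thesis
              by (simp only: q_def X_def[symmetric] distrib_right) (simp add: X_def)
          qed
          finally show ?thesis by simp
        qed
        then have "japanese y ^ (2 * k) \<le> (q * norm (y - x)) ^ (2 * k)"
          by (intro power_mono) auto
        moreover have "japanese y ^ K \<le> japanese y ^ (2 * k)"
          using k(2) japanese_ge_1 by (intro power_increasing) auto
        ultimately have yK: "japanese y ^ K \<le> q ^ (2 * k) * norm (y - x) ^ (2 * k)"
          by (simp add: power_mult_distrib)
        have Gb: "japanese y ^ K * norm (iter_deriv \<gamma> G y) \<le> q ^ (2 * k) * (c * A)" if \<gamma>: "length \<gamma> \<le> K" for \<gamma>
        proof -
          have "norm (y - x) ^ (2 * k) * norm (iter_deriv \<gamma> (fourier b) (y - x))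
            \<le> real CARD('n) ^ k * 2 ^ (2 * k) * 2 ^ (2 * k * length \<gamma>) * J * A"
            unfolding J_def n2_def
            by (rule fourier_deriv_bound[OF b A]) (use k(1) \<gamma> in \<open>simp add: n2_def\<close>)
          also have "\<dots> \<le> c * A"
            unfolding c_def using \<gamma> A0 J0 by (intro mult_right_mono mult_left_mono power_increasing) auto
          finally have 1: "norm (y - x) ^ (2 * k) * norm (iter_deriv \<gamma> (fourier b) (y - x)) \<le> c * A" .
          have "japanese y ^ K * norm (iter_deriv \<gamma> G y)
              \<le> q ^ (2 * k) * norm (y - x) ^ (2 * k) * norm (iter_deriv \<gamma> (fourier b) (y - x))"
            unfolding G_def iter_deriv_fourier_shift[OF b] using yK by (intro mult_right_mono) auto
          also have "\<dots> \<le> q ^ (2 * k) * (c * A)"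
            using 1 q by (simp add: mult.assoc mult_left_mono)
          finally show ?thesis .
        qed
        have "norm (iter_deriv \<alpha> (\<lambda>y. (1 - \<eta> y) * G y) y)
          \<le> real (length (splits \<alpha>)) * ((1 + E0) * (q ^ (2 * k) * (c * A)) / japanese y ^ K)"
          unfolding iter_deriv_mult[OF open_UNIV s1 schwartz_smooth[OF sG] UNIV_I]
        proof (intro norm_sum_list_le, safe)
          fix \<beta> \<gamma> assume *: "(\<beta>, \<gamma>) \<in> set (splits \<alpha>)"
          have len: "length \<beta> \<le> K" "length \<gamma> \<le> K" using splits_length[OF *] \<alpha> by auto
          have "norm (iter_deriv \<beta> (\<lambda>y. 1 - \<eta> y) y) \<le> (1 + E0) * japanese y powr (0 - real (length \<beta>))"
            by (rule sym_boundD[OF E len(1)])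
          also have "\<dots> \<le> (1 + E0) * japanese y powr 0"
            using E00 by (intro mult_left_mono japanese_powr_mono) auto
          finally have 1: "norm (iter_deriv \<beta> (\<lambda>y. 1 - \<eta> y) y) \<le> 1 + E0" by simp
          have 2: "norm (iter_deriv \<gamma> G y) \<le> (q ^ (2 * k) * (c * A)) / japanese y ^ K"
            using Gb[OF len(2)] by (simp add: field_simps)
          show "norm (iter_deriv \<beta> (\<lambda>y. 1 - \<eta> y) y * iter_deriv \<gamma> G y)
             \<le> (1 + E0) * (q ^ (2 * k) * (c * A)) / japanese y ^ K"
            using mult_mono[OF 1 2] E00 by (simp add: norm_mult)
        qed
        also have "\<dots> \<le> 2 ^ K * ((1 + E0) * (q ^ (2 * k) * (c * A)) / japanese y ^ K)"
          using \<alpha> E00 q c0 A0 by (intro mult_right_mono) (auto simp: length_splits)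
        finally show ?thesis
          by (simp add: field_simps)
      qed
    qed
    have "norm (f G) \<le> H * A * J + C0 * (2 ^ K * ((1 + E0) * (q ^ (2 * k) * (c * A))))"
      unfolding split by (rule order.trans[OF norm_triangle_ineq add_mono[OF near away]])
    then show ?thesis
      by (simp add: wave_value_def G_def C_def algebra_simps)
  qed
  then show ?thesis by blast
qed

text \<open>Localise the difference of the representatives by a bump and test with its conjugate:
  the pairing becomes the integral of a squared modulus, which must vanish.\<close>

lemma represents_on_unique:
  fixes u :: "(real^'n \<Rightarrow> complex) \<Rightarrow> complex"
  assumes r: "represents_on W v u" and r': "represents_on W' v' u" and x: "x \<in> W" "x \<in> W'"
  shows "v x = v' x"
proof -
  define V where "V = W \<inter> W'"
  have V: "open V" "x \<in> V" using r r' x by (auto simp: represents_on_def V_def)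
  have sv: "smooth_on V v" "smooth_on V v'"
    using r r' by (auto simp: represents_on_def V_def intro: smooth_on_subset)
  obtain e where e: "0 < e" "cball x e \<subseteq> V" using V by (auto simp: open_contains_cball)
  define \<eta> where "\<eta> = bump x (e / 2)"
  have \<eta>: "\<eta> \<in> test_functions V"
    unfolding \<eta>_def using e by (intro bump_test_function) auto
  define w where "w y = (v y - v' y) * \<eta> y" for y
  have w: "w \<in> test_functions V"
    unfolding w_def by (intro test_functions_mult V \<eta> smooth_on_diff sv)
  have sw: "w \<in> schwartz_space" by (rule test_functions_schwartz[OF w])
  \<comment> \<open>The second bump supplies the factor that completes (v - v') times the conjugate
    of \<open>w\<close> to the squared modulus of \<open>w\<close>.\<close>
  define \<phi> where "\<phi> y = cnj (w y) * \<eta> y" for y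
  have \<phi>: "\<phi> \<in> test_functions V"
    unfolding \<phi>_def by (intro test_functions_mult V \<eta> smooth_on_subset[OF schwartz_smooth[OF schwartz_cnj[OF sw]]]) auto
  have "test_functions V \<subseteq> test_functions W" "test_functions V \<subseteq> test_functions W'"
    by (simp_all add: V_def test_functions_mono)
  then have eq: "(LINT y|lborel. v y * \<phi> y) = (LINT y|lborel. v' y * \<phi> y)"
    using r r' \<phi> unfolding represents_on_def by (metis subsetD)
  have "(LINT y|lborel. complex_of_real ((norm (w y))\<^sup>2)) = (LINT y|lborel. v y * \<phi> y - v' y * \<phi> y)"
    unfolding complex_norm_square by (intro Bochner_Integration.integral_cong) (auto simp: w_def \<phi>_def algebra_simps)
  also have "\<dots> = 0"
  proof -
    have "integrable lborel (\<lambda>y. v y * \<phi> y)" "integrable lborel (\<lambda>y. v' y * \<phi> y)"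
      by (intro integrable_schwartz test_functions_schwartz[OF test_functions_mult[OF V(1) _ \<phi>]] sv)+
    then show ?thesis using eq by simp
  qed
  finally have "(LINT y|lborel. (norm (w y))\<^sup>2) = 0"
    by (simp del: of_real_power)
  moreover have "integrable lborel (\<lambda>y. (norm (w y))\<^sup>2)"
    using integrable_norm[OF integrable_schwartz[OF schwartz_mult[OF sw sw]]] by (simp add: norm_mult power2_eq_square)
  moreover have "continuous_on UNIV (\<lambda>y. (norm (w y))\<^sup>2)"
    by (intro continuous_intros schwartz_continuous_on[OF sw])
  ultimately have "(norm (w x))\<^sup>2 = 0"
    using continuous_nonneg_integral_0[of "\<lambda>y. (norm (w y))\<^sup>2" x] by simp
  then show ?thesis
    using bump_eq_1[of "e / 2" x x] e by (simp add: w_def \<eta>_def)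
qed

lemma dist_value_eq:
  fixes u :: "(real^'n \<Rightarrow> complex) \<Rightarrow> complex"
  assumes "represents_on W v u" "x \<in> W"
  shows "dist_value u x = v x"
  unfolding dist_value_def
  by (rule the_equality) (use assms represents_on_unique in blast)+

text \<open>Each derivative brings a factor 1/\<rho>, and for \<rho> at least 1 the weight of \<xi>
  is at most \<rho> times that of the rescaled frequency. The order zero bound is therefore uniform
  in \<rho>.\<close>

lemma sym_bound_cutoff_scaled:
  obtains B where "\<And>\<rho> \<xi>. 1 \<le> \<rho> \<Longrightarrow> sym_bound L 0 B (\<lambda>\<xi>. \<kappa> (\<xi> /\<^sub>R \<rho>)) \<xi>"
proof -
  obtain A where A: "\<And>\<xi>. sym_bound L 0 A \<kappa> \<xi>" using schwartz_sym_bound[OF schwartz] by blast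
  have A0: "0 \<le> A" using sym_bound_nonneg[OF A] .
  have "sym_bound L 0 A (\<lambda>\<xi>. \<kappa> (\<xi> /\<^sub>R \<rho>)) \<xi>" if \<rho>: "1 \<le> \<rho>" for \<rho> and \<xi> :: "real^'n"
    unfolding sym_bound_def
  proof (intro allI impI)
    fix \<alpha> :: "'n list" assume \<alpha>: "length \<alpha> \<le> L"
    let ?l = "length \<alpha>"
    have it: "iter_deriv \<alpha> (\<lambda>\<xi>. \<kappa> (\<xi> /\<^sub>R \<rho>)) \<xi> = of_real (inverse \<rho>) ^ ?l * iter_deriv \<alpha> \<kappa> (\<xi> /\<^sub>R \<rho>)"
      using iter_deriv_affine[OF schwartz_smooth[OF schwartz], of \<alpha> "inverse \<rho>" 0] by simp
    have le: "japanese \<xi> \<le> \<rho> * japanese (\<xi> /\<^sub>R \<rho>)"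
    proof (rule power2_le_imp_le)
      have "(\<rho> * japanese (\<xi> /\<^sub>R \<rho>))\<^sup>2 = \<rho>\<^sup>2 + (norm \<xi>)\<^sup>2"
        using \<rho> by (simp add: power_mult_distrib japanese_sq field_simps)
      moreover have "1 \<le> \<rho>\<^sup>2" using \<rho> by simp
      ultimately show "(japanese \<xi>)\<^sup>2 \<le> (\<rho> * japanese (\<xi> /\<^sub>R \<rho>))\<^sup>2" by (simp add: japanese_sq)
      show "0 \<le> \<rho> * japanese (\<xi> /\<^sub>R \<rho>)" using \<rho> by simp
    qed
    have "norm (iter_deriv \<alpha> \<kappa> (\<xi> /\<^sub>R \<rho>)) \<le> A * inverse (japanese (\<xi> /\<^sub>R \<rho>) ^ ?l)"
      using sym_boundD[OF A \<alpha>, of "\<xi> /\<^sub>R \<rho>"] by (simp add: powr_minus powr_realpow)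
    then have "norm (iter_deriv \<alpha> (\<lambda>\<xi>. \<kappa> (\<xi> /\<^sub>R \<rho>)) \<xi>) \<le> inverse \<rho> ^ ?l * (A * inverse (japanese (\<xi> /\<^sub>R \<rho>) ^ ?l))"
      unfolding it norm_mult norm_power using \<rho> by (intro mult_mono) (auto simp: norm_inverse)
    also have "\<dots> = A * inverse ((\<rho> * japanese (\<xi> /\<^sub>R \<rho>)) ^ ?l)"
      by (simp add: power_mult_distrib power_inverse)
    also have "\<dots> \<le> A * inverse (japanese \<xi> ^ ?l)"
      using le A0 by (intro mult_left_mono le_imp_inverse_le power_mono) auto
    also have "\<dots> = A * japanese \<xi> powr (0 - real ?l)"
      by (simp add: powr_minus powr_realpow)
    finally show "norm (iter_deriv \<alpha> (\<lambda>\<xi>. \<kappa> (\<xi> /\<^sub>R \<rho>)) \<xi>) \<le> A * japanese \<xi> powr (0 - real ?l)" .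
  qed
  then show thesis by (rule that)
qed

lemma scaled_eq_1: "0 < \<rho> \<Longrightarrow> norm \<xi> \<le> \<rho> \<Longrightarrow> \<kappa> (\<xi> /\<^sub>R \<rho>) = 1"
  and scaled_eq_0: "0 < \<rho> \<Longrightarrow> 2 * \<rho> \<le> norm \<xi> \<Longrightarrow> \<kappa> (\<xi> /\<^sub>R \<rho>) = 0"
  by (auto intro!: one zero simp: field_simps)

lemma scaled_test_function:
  assumes "0 < \<rho>"
  shows "(\<lambda>\<xi>. \<kappa> (\<xi> /\<^sub>R \<rho>)) \<in> test_functions UNIV"
  using bump_test_function[OF assms, of 0 UNIV] by (simp add: bump_def[abs_def] divide_inverse)

lemma scaled_schwartz: "0 < \<rho> \<Longrightarrow> (\<lambda>\<xi>. \<kappa> (\<xi> /\<^sub>R \<rho>)) \<in> schwartz_space"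
  by (rule test_functions_schwartz[OF scaled_test_function])

text \<open>The difference of the two symbols vanishes below \<rho> and hence has a bound of size
  1/\<rho> after losing one order.\<close>

lemma tempered_cutoff_tendsto:
  fixes u :: "(real^'n \<Rightarrow> complex) \<Rightarrow> complex"
  assumes u: "u \<in> tempered_distributions" and \<psi>: "\<psi> \<in> schwartz_space"
  shows "((\<lambda>\<rho>. u (fourier (\<lambda>\<xi>. \<kappa> (\<xi> /\<^sub>R \<rho>) * \<psi> \<xi>))) \<longlongrightarrow> u (fourier \<psi>)) at_top"
proof -
  obtain C L m where C: "0 \<le> C" and uC:
    "\<And>\<phi> A. \<phi> \<in> schwartz_space \<Longrightarrow> (\<And>x. sym_bound L m A \<phi> x) \<Longrightarrow> norm (u (fourier \<phi>)) \<le> C * A"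
    using tempered_fourier_bound[OF u] by metis
  obtain B where B: "\<And>\<rho> \<xi>. 1 \<le> \<rho> \<Longrightarrow> sym_bound L 0 B (\<lambda>\<xi>. \<kappa> (\<xi> /\<^sub>R \<rho>)) \<xi>"
    using sym_bound_cutoff_scaled by blast
  \<comment> \<open>One order below the order \<open>m\<close> that controls \<open>u\<close>,
    because the gain of 1/\<rho> raises the order by one.\<close>
  obtain A where A: "\<And>\<xi>. sym_bound L (m - 1) A \<psi> \<xi>" using schwartz_sym_bound[OF \<psi>] by blast
  define D where "D = 2 ^ L * (B + 1) * A"
  have D0: "0 \<le> D"
    using sym_bound_nonneg[OF A] sym_bound_nonneg[OF B[of 1]] by (simp add: D_def)
  have le: "norm (u (fourier (\<lambda>\<xi>. \<kappa> (\<xi> /\<^sub>R \<rho>) * \<psi> \<xi>)) - u (fourier \<psi>)) \<le> C * (D / \<rho>)" if \<rho>: "1 \<le> \<rho>" for \<rho>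
  proof -
    note s = scaled_schwartz[of \<rho>]
    have ss: "(\<lambda>\<xi>. \<kappa> (\<xi> /\<^sub>R \<rho>) * \<psi> \<xi>) \<in> schwartz_space" using s \<psi> \<rho> by (intro schwartz_mult) auto
    have s1: "smooth_on UNIV (\<lambda>\<xi>. \<kappa> (\<xi> /\<^sub>R \<rho>) - 1)"
      using s \<rho> by (intro smooth_on_diff open_UNIV schwartz_smooth smooth_on_const) auto
    have b: "sym_bound L (0 + (m - 1)) D (\<lambda>\<xi>. (\<kappa> (\<xi> /\<^sub>R \<rho>) - 1) * \<psi> \<xi>) \<xi>" for \<xi>
      unfolding D_def
    proof (rule sym_bound_mult[OF open_UNIV s1 schwartz_smooth[OF \<psi>] UNIV_I _ A])
      show "sym_bound L 0 (B + 1) (\<lambda>\<xi>. \<kappa> (\<xi> /\<^sub>R \<rho>) - 1) \<xi>"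
        using sym_bound_diff[OF open_UNIV schwartz_smooth[OF s] smooth_on_const UNIV_I B[OF \<rho>] sym_bound_const[of L 1]] \<rho>
        by simp
    qed
    have "sym_bound L (0 + (m - 1) + 1) (D / \<rho>) (\<lambda>\<xi>. (\<kappa> (\<xi> /\<^sub>R \<rho>) - 1) * \<psi> \<xi>) \<xi>" for \<xi>
      using \<rho> D0 b by (intro sym_bound_gain) (auto simp: scaled_eq_1)
    then have b': "sym_bound L m (D / \<rho>) (\<lambda>\<xi>. \<kappa> (\<xi> /\<^sub>R \<rho>) * \<psi> \<xi> - \<psi> \<xi>) \<xi>" for \<xi>
      by (simp add: algebra_simps)
    have "u (fourier (\<lambda>\<xi>. \<kappa> (\<xi> /\<^sub>R \<rho>) * \<psi> \<xi>)) - u (fourier \<psi>) = u (fourier (\<lambda>\<xi>. \<kappa> (\<xi> /\<^sub>R \<rho>) * \<psi> \<xi> - \<psi> \<xi>))"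
    proof -
      have "fourier (\<lambda>\<xi>. \<kappa> (\<xi> /\<^sub>R \<rho>) * \<psi> \<xi> - \<psi> \<xi>)
          = (\<lambda>y. fourier (\<lambda>\<xi>. \<kappa> (\<xi> /\<^sub>R \<rho>) * \<psi> \<xi>) y - fourier \<psi> y)"
        by (rule ext) (rule fourier_diff[OF ss \<psi>])
      then show ?thesis
        by (simp add: tempered_diff[OF u schwartz_fourier[OF ss] schwartz_fourier[OF \<psi>]])
    qed
    then show ?thesis
      using uC[OF schwartz_diff[OF ss \<psi>] b'] by simp
  qed
  have "((\<lambda>\<rho>. C * (D / \<rho>)) \<longlongrightarrow> C * 0) at_top"
    by (intro tendsto_intros tendsto_divide_0[OF tendsto_const] filterlim_at_top_imp_at_infinity filterlim_ident)
  then have lim: "((\<lambda>\<rho>. C * (D / \<rho>)) \<longlongrightarrow> 0) at_top" by simp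
  have "\<forall>\<^sub>F \<rho> in at_top. norm (u (fourier (\<lambda>\<xi>. \<kappa> (\<xi> /\<^sub>R \<rho>) * \<psi> \<xi>)) - u (fourier \<psi>)) \<le> C * (D / \<rho>)"
    by (rule eventually_at_top_linorderI[of 1]) (rule le)
  from Lim_null_comparison[OF this lim]
  have "((\<lambda>\<rho>. u (fourier (\<lambda>\<xi>. \<kappa> (\<xi> /\<^sub>R \<rho>) * \<psi> \<xi>)) - u (fourier \<psi>)) \<longlongrightarrow> 0) at_top" .
  then show ?thesis by (rule LIM_zero_cancel)
qed

end

section \<open>Convergence of the truncated solutions\<close>

text \<open>Completeness along \<open>R + n\<close> gives a pointwise limit. For any fixed \<rho>,
  comparison with later terms of this sequence passes to the limit with the rate unchanged and
  uniform in the point.\<close>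

lemma uniform_limit_of_cauchy_rate:
  fixes w :: "real \<Rightarrow> 'a \<Rightarrow> 'b::banach"
  assumes cauchy: "\<And>\<rho> \<rho>' x. R \<le> \<rho> \<Longrightarrow> \<rho> \<le> \<rho>' \<Longrightarrow> x \<in> V \<Longrightarrow> norm (w \<rho>' x - w \<rho> x) \<le> C / \<rho>"
    and R: "1 \<le> R"
  obtains G where "\<And>\<rho> x. R \<le> \<rho> \<Longrightarrow> x \<in> V \<Longrightarrow> norm (w \<rho> x - G x) \<le> C / \<rho>"
proof -
  have "\<exists>l. \<forall>\<rho>\<ge>R. norm (w \<rho> x - l) \<le> C / \<rho>" if x: "x \<in> V" for x
  proof -
    have C: "0 \<le> C"
    proof -
      have "0 \<le> C / R" using cauchy[of R R x] x by simp
      then show ?thesis using R by (simp add: zero_le_divide_iff)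
    qed
    define s where "s n = w (R + real n) x" for n
    have "Cauchy s"
      unfolding Cauchy_altdef dist_norm
    proof (intro allI impI)
      fix e :: real assume e: "0 < e"
      obtain M where M: "C / e < real M" using reals_Archimedean2 by blast
      have "norm (s m - s n) < e" if "M \<le> m" "m < n" for m n
      proof -
        have pos: "0 < R + real m" using R by linarith
        have "norm (s m - s n) \<le> C / (R + real m)"
          unfolding s_def using cauchy[of "R + real m" "R + real n" x] that x by (simp add: norm_minus_commute)
        also have "\<dots> < e"
        proof -
          have "C < e * real M" using M e by (simp add: divide_less_eq mult.commute)
          also have "\<dots> \<le> e * (R + real m)" using that R e by (intro mult_left_mono) auto
          finally show ?thesis using pos by (simp add: divide_less_eq)
        qed
        finally show ?thesis .
      qed
      then show "\<exists>M. \<forall>m\<ge>M. \<forall>n>m. norm (s m - s n) < e" by blast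
    qed
    then obtain l where l: "s \<longlonglongrightarrow> l" using Cauchy_convergent_iff convergent_def by blast
    have "norm (w \<rho> x - l) \<le> C / \<rho>" if \<rho>: "R \<le> \<rho>" for \<rho>
    proof (rule LIMSEQ_le_const2)
      show "(\<lambda>n. norm (w \<rho> x - s n)) \<longlonglongrightarrow> norm (w \<rho> x - l)" by (intro tendsto_intros l)
      obtain N :: nat where "\<rho> \<le> real N" using real_arch_simple by blast
      then have "norm (w \<rho> x - s n) \<le> C / \<rho>" if "N \<le> n" for n
        unfolding s_def using that R cauchy[OF \<rho>, of "R + real n" x] x by (simp add: norm_minus_commute)
      then show "\<exists>N. \<forall>n\<ge>N. norm (w \<rho> x - s n) \<le> C / \<rho>" by blast
    qed
    then show ?thesis by blast
  qed
  then obtain G where "\<And>x. x \<in> V \<Longrightarrow> \<forall>\<rho>\<ge>R. norm (w \<rho> x - G x) \<le> C / \<rho>" by metis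
  then show thesis by (intro that) auto
qed

section \<open>Multiplier operators and frequency bands\<close>

context cutoff_function
begin

lemma multiplier_op_apply:
  fixes u :: "(real^'n \<Rightarrow> complex) \<Rightarrow> complex"
  assumes "\<phi> \<in> schwartz_space" "(\<lambda>\<xi>. a \<xi> * inv_fourier \<phi> \<xi>) \<in> schwartz_space"
  shows "multiplier_op a u \<phi> = u (fourier (\<lambda>\<xi>. a \<xi> * inv_fourier \<phi> \<xi>))"
  using assms schwartz_inv_fourier[OF assms(1)]
  by (simp add: multiplier_op_def inv_fourier_dist_def mult_dist_def fourier_dist_def)

text \<open>Here the exchange of \<open>u\<close> with an integral is used: it shows that the
  truncated solution, defined by duality, is integration against wave values.\<close>

lemma represents_on_multiplier_op:
  fixes u :: "(real^'n \<Rightarrow> complex) \<Rightarrow> complex"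
  assumes u: "u \<in> tempered_distributions" and a: "a \<in> schwartz_space"
  shows "represents_on UNIV (\<lambda>x. (1 / inv_const) * wave_value u a x) (multiplier_op a u)"
  unfolding represents_on_def
proof (intro conjI ballI smooth_on_cmult open_UNIV smooth_on_wave_value[OF u a])
  fix \<phi> :: "real^'n \<Rightarrow> complex" assume \<phi>: "\<phi> \<in> test_functions UNIV"
  have s\<phi>: "\<phi> \<in> schwartz_space" by (rule test_functions_schwartz[OF \<phi>])
  have s: "(\<lambda>\<xi>. a \<xi> * fourier \<phi> (- \<xi>)) \<in> schwartz_space"
    by (intro schwartz_mult schwartz_reflect schwartz_fourier s\<phi> a)
  have eq: "(\<lambda>\<xi>. a \<xi> * inv_fourier \<phi> \<xi>) = (\<lambda>\<xi>. (1 / inv_const) * (a \<xi> * fourier \<phi> (- \<xi>)))"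
    by (simp add: inv_fourier_eq[OF s\<phi>])
  have "multiplier_op a u \<phi> = u (fourier (\<lambda>\<xi>. (1 / inv_const) * (a \<xi> * fourier \<phi> (- \<xi>))))"
    by (subst multiplier_op_apply[OF s\<phi>]) (simp_all only: eq schwartz_cmult[OF s])
  also have "fourier (\<lambda>\<xi>. (1 / inv_const) * (a \<xi> * fourier \<phi> (- \<xi>)))
      = (\<lambda>y. (1 / inv_const) * fourier (\<lambda>\<xi>. a \<xi> * fourier \<phi> (- \<xi>)) y)"
    by (intro ext fourier_cmult)
  also have "u \<dots> = (1 / inv_const) * (LINT x|lborel. \<phi> x * wave_value u a x)"
    by (simp only: tempered_cmult[OF u schwartz_fourier[OF s]] tempered_integral_interchange[OF u a \<phi>])
  also have "\<dots> = (LINT x|lborel. (1 / inv_const) * (\<phi> x * wave_value u a x))"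
    by (simp only: integral_mult_right_zero)
  also have "\<dots> = (LINT x|lborel. (1 / inv_const) * wave_value u a x * \<phi> x)"
    by (simp only: mult_ac)
  finally show "multiplier_op a u \<phi> = (LINT x|lborel. (1 / inv_const) * wave_value u a x * \<phi> x)" .
qed

text \<open>Transposition: testing P u with the kernel of \<open>b\<close> is testing
  \<open>u\<close> with the kernel of \<open>p\<close> times \<open>b\<close>. This is how
  information on the right-hand side reaches \<open>u\<close>.\<close>

lemma wave_value_multiplier_op:
  fixes u :: "(real^'n \<Rightarrow> complex) \<Rightarrow> complex"
  assumes p: "p \<in> symbol_class \<mu>" and b: "b \<in> schwartz_space"
  shows "wave_value (multiplier_op p u) b x = wave_value u (\<lambda>\<xi>. p \<xi> * b \<xi>) x"
proof -
  have s: "(\<lambda>\<xi>. plane_wave x \<xi> * b \<xi>) \<in> schwartz_space" by (rule schwartz_plane_wave_mult[OF b])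
  show ?thesis
    using multiplier_op_apply[OF schwartz_fourier[OF s], of p u] schwartz_mult_symbol_class[OF p s]
    by (simp add: wave_value_def inv_fourier_fourier[OF s] mult.left_commute)
qed

text \<open>Ellipticity writes the frequency band between \<open>\<rho>\<close> and \<open>\<rho>'\<close> of \<open>u\<close> as \<open>b(D) f\<close> with
  \<open>b = \<xi>\<^sup>\<beta> (\<kappa>(\<xi>/\<rho>') - \<kappa>(\<xi>/\<rho>)) / p(\<xi>)\<close>; these symbols are \<open>O(1/\<rho>)\<close> in a fixed symbol class, one order
  above their natural one.\<close>

lemma frequency_band_bound:
  fixes u :: "(real^'n \<Rightarrow> complex) \<Rightarrow> complex"
  assumes p: "p \<in> symbol_class \<mu>" and ell: "elliptic \<mu> p" and u: "u \<in> tempered_distributions"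
    and Pu: "multiplier_op p u \<in> tempered_distributions"
    and v: "represents_on W v (multiplier_op p u)" and d: "0 < d" and sub: "cball x0 (2 * d) \<subseteq> W"
  shows "\<exists>C R. 1 \<le> R \<and> (\<forall>\<rho>\<ge>R. \<forall>\<rho>'\<ge>\<rho>. \<forall>x\<in>ball x0 (d / 2).
    norm (wave_value u (\<lambda>\<xi>. monomial \<i> \<beta> \<xi> * \<kappa> (\<xi> /\<^sub>R \<rho>')) x
        - wave_value u (\<lambda>\<xi>. monomial \<i> \<beta> \<xi> * \<kappa> (\<xi> /\<^sub>R \<rho>)) x) \<le> C / \<rho>)"
proof -
  obtain c R0 where c: "0 < c" and R0: "0 < R0" and low: "\<And>\<xi>. R0 \<le> norm \<xi> \<Longrightarrow> c * japanese \<xi> powr \<mu> \<le> norm (p \<xi>)"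
    using ell unfolding elliptic_def by blast
  \<comment> \<open>The strict inequality makes the set open, as the calculus for 1/p
    requires.\<close>
  define S where "S = {\<xi>::real^'n. R0 < norm \<xi>}"
  have S: "open S" unfolding S_def by (intro open_Collect_less continuous_intros)
  have lowS: "c * japanese \<xi> powr \<mu> \<le> norm (p \<xi>)" if "\<xi> \<in> S" for \<xi>
    using low that by (simp add: S_def)
  have nz: "p \<xi> \<noteq> 0" if "\<xi> \<in> S" for \<xi>
  proof -
    have "0 < c * japanese \<xi> powr \<mu>" using c by (intro mult_pos_pos) auto
    then show ?thesis using lowS[OF that] by auto
  qed
  have sp: "smooth_on S p" using smooth_on_symbol_class[OF p] smooth_on_subset by blast
  define M where "M = real (length \<beta>) + (0 + - \<mu>) + 1"
  obtain L C where LC: "\<And>b A x. b \<in> schwartz_space \<Longrightarrow> (\<And>\<xi>. sym_bound L M A b \<xi>) \<Longrightarrow> x \<in> ball x0 (d / 2) \<Longrightarrow>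
      norm (wave_value (multiplier_op p u) b x) \<le> C * A"
    using pseudolocality[OF Pu v d sub, of M] by blast
  obtain Ap where Ap: "\<And>\<xi>. sym_bound L \<mu> Ap p \<xi>" using symbol_class_sym_bound[OF p] by blast
  obtain Q where Q: "\<And>\<xi>. \<xi> \<in> S \<Longrightarrow> sym_bound L (- \<mu>) Q (\<lambda>\<xi>. inverse (p \<xi>)) \<xi>"
    using sym_bound_inverse[OF S sp c lowS Ap] by blast
  obtain B where B: "\<And>\<rho> \<xi>. 1 \<le> \<rho> \<Longrightarrow> sym_bound L 0 B (\<lambda>\<xi>. \<kappa> (\<xi> /\<^sub>R \<rho>)) \<xi>"
    using sym_bound_cutoff_scaled by blast
  define T where "T = 2 ^ L * 2 ^ (L * length \<beta>) * (2 ^ L * (B + B) * Q)"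
  \<comment> \<open>From \<open>R\<close> on the scaled cutoffs obey the uniform bound, and \<rho>
    exceeds \<open>R0\<close>, so that \<open>S\<close> and the ball of radius \<rho> cover the
    whole space.\<close>
  define R where "R = max 1 (R0 + 1)"
  have "norm (wave_value u (\<lambda>\<xi>. monomial \<i> \<beta> \<xi> * \<kappa> (\<xi> /\<^sub>R \<rho>')) x
        - wave_value u (\<lambda>\<xi>. monomial \<i> \<beta> \<xi> * \<kappa> (\<xi> /\<^sub>R \<rho>)) x) \<le> C * T / \<rho>"
    if \<rho>: "R \<le> \<rho>" "\<rho> \<le> \<rho>'" and x: "x \<in> ball x0 (d / 2)" for \<rho> \<rho>' x
  proof -
    have pos: "1 \<le> \<rho>" "1 \<le> \<rho>'" "0 < \<rho>" "0 < \<rho>'" "R0 < \<rho>" using \<rho> by (auto simp: R_def)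
    have sk: "(\<lambda>\<xi>. \<kappa> (\<xi> /\<^sub>R \<rho>')) \<in> schwartz_space" "(\<lambda>\<xi>. \<kappa> (\<xi> /\<^sub>R \<rho>)) \<in> schwartz_space"
      using scaled_schwartz pos by auto
    define D where "D \<xi> = \<kappa> (\<xi> /\<^sub>R \<rho>') - \<kappa> (\<xi> /\<^sub>R \<rho>)" for \<xi>
    have sD: "D \<in> schwartz_space" unfolding D_def by (rule schwartz_diff[OF sk])
    have D0: "D \<xi> = 0" if "norm \<xi> < \<rho>" for \<xi>
      using that \<rho> pos by (simp add: D_def scaled_eq_1)
    have D0': "D \<xi> = 0" if "2 * \<rho>' \<le> norm \<xi>" for \<xi>
      using that \<rho> pos by (simp add: D_def scaled_eq_0)
    \<comment> \<open>Outside \<open>S\<close> the symbol \<open>p\<close> may vanish and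
      \<open>inverse\<close> then takes its default value 0. This does no harm, since
      \<open>D\<close> is zero for all frequencies below \<rho>. The larger cutoff makes the support
      compact.\<close>
    define b where "b \<xi> = monomial \<i> \<beta> \<xi> * (D \<xi> * inverse (p \<xi>))" for \<xi>
    have sub_smooth: "smooth_on S f" if "smooth_on UNIV f" for f :: "real^'n \<Rightarrow> complex"
      using smooth_on_subset[OF that] by blast
    have smS: "smooth_on S (\<lambda>\<xi>. D \<xi> * inverse (p \<xi>))"
      by (intro smooth_on_mult S sub_smooth[OF schwartz_smooth[OF sD]] smooth_on_inverse[OF S sp nz])
    have b0: "b \<xi> = 0" if "norm \<xi> < \<rho>" for \<xi> using D0[OF that] by (simp add: b_def)
    have "smooth_on S b"
      unfolding b_def by (intro smooth_on_mult S sub_smooth[OF smooth_on_monomial] smS)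
    moreover have "smooth_on (ball 0 \<rho>) b"
      by (intro smooth_on_cong[OF _ _ smooth_on_const[of _ 0]]) (auto simp: b0 dist_norm)
    moreover have "S \<union> ball 0 \<rho> = UNIV" using pos by (auto simp: S_def dist_norm)
    ultimately have smb: "smooth_on UNIV b" using smooth_on_Un by metis
    have supp: "closure {\<xi>. b \<xi> \<noteq> 0} \<subseteq> cball 0 (2 * \<rho>')"
    proof (rule closure_minimal)
      show "{\<xi>. b \<xi> \<noteq> 0} \<subseteq> cball 0 (2 * \<rho>')"
      proof
        fix \<xi> assume "\<xi> \<in> {\<xi>. b \<xi> \<noteq> 0}"
        then have "\<not> 2 * \<rho>' \<le> norm \<xi>" using D0'[of \<xi>] by (auto simp: b_def)
        then show "\<xi> \<in> cball 0 (2 * \<rho>')" by simp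
      qed
    qed simp
    have "compact (closure {\<xi>. b \<xi> \<noteq> 0})"
      using bounded_subset[OF bounded_cball supp] by (simp add: compact_eq_bounded_closed)
    then have sb: "b \<in> schwartz_space"
      using smb by (intro test_functions_schwartz[of _ UNIV]) (simp add: test_functions_def)
    have bT: "sym_bound L (real (length \<beta>) + (0 + - \<mu>)) T b \<xi>" if "\<rho> \<le> norm \<xi>" for \<xi>
    proof -
      have \<xi>: "\<xi> \<in> S" using that pos by (simp add: S_def)
      have 1: "sym_bound L 0 (B + B) D \<xi>"
        unfolding D_def using pos
        by (intro sym_bound_diff[OF open_UNIV schwartz_smooth[OF sk(1)] schwartz_smooth[OF sk(2)] UNIV_I] B)
      have 2: "sym_bound L (0 + - \<mu>) (2 ^ L * (B + B) * Q) (\<lambda>\<xi>. D \<xi> * inverse (p \<xi>)) \<xi>"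
        by (rule sym_bound_mult[OF S sub_smooth[OF schwartz_smooth[OF sD]] smooth_on_inverse[OF S sp nz] \<xi> 1 Q[OF \<xi>]])
      show ?thesis
        unfolding b_def T_def
        by (rule sym_bound_mult[OF S sub_smooth[OF smooth_on_monomial] smS \<xi> sym_bound_monomial 2]) simp
    qed
    have T0: "0 \<le> T"
    proof -
      obtain \<xi> :: "real^'n" where "norm \<xi> = \<rho>" using vector_choose_size[of \<rho>] pos by auto
      then show ?thesis using sym_bound_nonneg[OF bT[of \<xi>]] by simp
    qed
    have bM: "sym_bound L M (T / \<rho>) b \<xi>" for \<xi>
      unfolding M_def by (rule sym_bound_gain[OF b0 pos(3) T0 bT])
    have pb: "(\<lambda>\<xi>. p \<xi> * b \<xi>) = (\<lambda>\<xi>. monomial \<i> \<beta> \<xi> * \<kappa> (\<xi> /\<^sub>R \<rho>') - monomial \<i> \<beta> \<xi> * \<kappa> (\<xi> /\<^sub>R \<rho>))"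
    proof
      fix \<xi>
      have "p \<xi> * b \<xi> = monomial \<i> \<beta> \<xi> * D \<xi>"
      proof (cases "\<xi> \<in> S")
        case True
        then show ?thesis using nz[OF True] by (simp add: b_def)
      next
        case False
        then have "D \<xi> = 0" using pos by (intro D0) (simp add: S_def)
        then show ?thesis by (simp add: b_def)
      qed
      then show "p \<xi> * b \<xi> = monomial \<i> \<beta> \<xi> * \<kappa> (\<xi> /\<^sub>R \<rho>') - monomial \<i> \<beta> \<xi> * \<kappa> (\<xi> /\<^sub>R \<rho>)"
        by (simp add: D_def right_diff_distrib)
    qed
    have "wave_value (multiplier_op p u) b x
      = wave_value u (\<lambda>\<xi>. monomial \<i> \<beta> \<xi> * \<kappa> (\<xi> /\<^sub>R \<rho>')) x - wave_value u (\<lambda>\<xi>. monomial \<i> \<beta> \<xi> * \<kappa> (\<xi> /\<^sub>R \<rho>)) x"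
      unfolding wave_value_multiplier_op[OF p sb] pb
      by (intro wave_value_diff u schwartz_monomial_mult sk) simp_all
    then show ?thesis using LC[OF sb bM x] by simp
  qed
  moreover have "1 \<le> R" by (simp add: R_def)
  ultimately show ?thesis by blast
qed

text \<open>Limits exist for every monomial, that is, for all derivatives of the truncated
  solutions. They fit together as the derivatives of one smooth function, and the weak limit shows
  that this function, up to the constant, represents \<open>u\<close>.\<close>

lemma dist_value_locally_uniform:
  fixes u :: "(real^'n \<Rightarrow> complex) \<Rightarrow> complex"
  assumes p: "p \<in> symbol_class \<mu>" and ell: "elliptic \<mu> p" and u: "u \<in> tempered_distributions"
    and Pu: "multiplier_op p u \<in> tempered_distributions" and x0: "x0 \<notin> singular_support (multiplier_op p u)"
  shows "\<exists>\<delta>>0. uniform_limit (ball x0 \<delta>) (\<lambda>\<rho> x. (1 / inv_const) * wave_value u (\<lambda>\<xi>. \<kappa> (\<xi> /\<^sub>R \<rho>)) x)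
    (dist_value u) at_top"
proof -
  obtain W v where v: "represents_on W v (multiplier_op p u)" and "x0 \<in> W"
    using x0 unfolding singular_support_def by blast
  moreover have "open W" using v by (simp add: represents_on_def)
  ultimately obtain e where e: "0 < e" "cball x0 e \<subseteq> W" by (auto simp: open_contains_cball)
  define d where "d = e / 2"
  have d: "0 < d" "cball x0 (2 * d) \<subseteq> W" using e by (auto simp: d_def)
  define V where "V = ball x0 (d / 2)"
  have V: "open V" "convex V" "x0 \<in> V" using d by (auto simp: V_def)
  \<comment> \<open>Prepending \<open>i\<close> to the index list multiplies the symbol by \<i>
    times the i-th coordinate, which is differentiation in direction \<open>i\<close>.\<close>
  define w where "w \<beta> \<rho> = wave_value u (\<lambda>\<xi>. monomial \<i> \<beta> \<xi> * \<kappa> (\<xi> /\<^sub>R \<rho>))" for \<beta> \<rho>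
  have "\<exists>G C R. 1 \<le> R \<and> (\<forall>\<rho>\<ge>R. \<forall>x\<in>V. norm (w \<beta> \<rho> x - G x) \<le> C / \<rho>)" for \<beta>
  proof -
    obtain C R where R: "1 \<le> R" and CR: "\<And>\<rho> \<rho>' x. R \<le> \<rho> \<Longrightarrow> \<rho> \<le> \<rho>' \<Longrightarrow> x \<in> V \<Longrightarrow> norm (w \<beta> \<rho>' x - w \<beta> \<rho> x) \<le> C / \<rho>"
      using frequency_band_bound[OF p ell u Pu v d, of \<beta>] unfolding w_def V_def by blast
    show ?thesis using uniform_limit_of_cauchy_rate[of R V "w \<beta>" C, OF CR R] R by metis
  qed
  then obtain G C R where R: "\<And>\<beta>. 1 \<le> R \<beta>"
    and G: "\<And>\<beta> \<rho> x. R \<beta> \<le> \<rho> \<Longrightarrow> x \<in> V \<Longrightarrow> norm (w \<beta> \<rho> x - G \<beta> x) \<le> C \<beta> / \<rho>"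
    by metis
  have G': "norm (w \<beta> \<rho> x - G \<beta> x) \<le> \<bar>C \<beta>\<bar> / \<rho>" if "R \<beta> \<le> \<rho>" "x \<in> V" for \<beta> \<rho> x
    using R[of \<beta>] that by (intro order.trans[OF G[OF that]] divide_right_mono) auto
  have dw: "(w \<beta> \<rho> has_derivative (\<lambda>h. \<Sum>i\<in>UNIV. h $ i *\<^sub>R w (i # \<beta>) \<rho> x)) (at x)" if "0 < \<rho>" for \<beta> \<rho> x
    using has_derivative_wave_value[OF u schwartz_monomial_mult[OF _ scaled_schwartz[OF that]], of \<i> \<beta> x]
    by (simp add: w_def mult.assoc)
  have lim: "(\<lambda>n. w \<beta> (real n + 1) x) \<longlonglongrightarrow> G \<beta> x" if x: "x \<in> V" for \<beta> x
  proof (rule LIM_zero_cancel, rule Lim_null_comparison)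
    obtain N :: nat where N: "R \<beta> \<le> real N" using real_arch_simple by blast
    show "\<forall>\<^sub>F n in sequentially. norm (w \<beta> (real n + 1) x - G \<beta> x) \<le> C \<beta> * inverse (real (Suc n))"
      using G[OF _ x, of \<beta>] N
      by (intro eventually_sequentiallyI[of N]) (simp add: divide_inverse add.commute)
    show "(\<lambda>n. C \<beta> * inverse (real (Suc n))) \<longlonglongrightarrow> 0"
      using tendsto_mult_right_zero[OF LIMSEQ_inverse_real_of_nat, of "C \<beta>"] by simp
  qed
  have dG: "(G \<beta> has_derivative (\<lambda>h. \<Sum>i\<in>UNIV. h $ i *\<^sub>R G (i # \<beta>) x)) (at x)" if x: "x \<in> V" for \<beta> x
  proof -
    have "\<exists>g. \<forall>x\<in>V. (\<lambda>n. w \<beta> (real n + 1) x) \<longlonglongrightarrow> g x \<and>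
        (g has_derivative (\<lambda>h. \<Sum>i\<in>UNIV. h $ i *\<^sub>R G (i # \<beta>) x)) (at x within V)"
    proof (rule has_derivative_sequence[where f="\<lambda>n. w \<beta> (real n + 1)"
          and f'="\<lambda>n x h. \<Sum>i\<in>UNIV. h $ i *\<^sub>R w (i # \<beta>) (real n + 1) x"
          and g'="\<lambda>x h. \<Sum>i\<in>UNIV. h $ i *\<^sub>R G (i # \<beta>) x", OF V(2) _ _ V(3) lim[OF V(3)]])
      show "(w \<beta> (real n + 1) has_derivative (\<lambda>h. \<Sum>i\<in>UNIV. h $ i *\<^sub>R w (i # \<beta>) (real n + 1) x)) (at x within V)" for n x
        by (rule has_derivative_at_withinI, rule dw) simp
      fix \<epsilon> :: real assume \<epsilon>: "0 < \<epsilon>"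
      define Z where "Z = (\<Sum>i\<in>UNIV. \<bar>C (i # \<beta>)\<bar>)"
      \<comment> \<open>The sum of the thresholds exceeds each of them, so one index works for all
        partials; Z/\<epsilon> makes the total error at most \<epsilon> times the norm of
        \<open>h\<close>.\<close>
      obtain N :: nat where N: "(\<Sum>i\<in>UNIV. \<bar>R (i # \<beta>)\<bar>) + Z / \<epsilon> \<le> real N" using real_arch_simple by blast
      have Z0: "0 \<le> Z" by (simp add: Z_def sum_nonneg)
      show "\<forall>\<^sub>F n in sequentially. \<forall>x\<in>V. \<forall>h. norm ((\<Sum>i\<in>UNIV. h $ i *\<^sub>R w (i # \<beta>) (real n + 1) x)
          - (\<Sum>i\<in>UNIV. h $ i *\<^sub>R G (i # \<beta>) x)) \<le> \<epsilon> * norm h"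
      proof (rule eventually_sequentiallyI[of N], intro ballI allI)
        fix n x and h :: "real^'n" assume n: "N \<le> n" and x: "x \<in> V"
        have Rn: "R (i # \<beta>) \<le> real n + 1" for i
        proof -
          have "\<bar>R (i # \<beta>)\<bar> \<le> (\<Sum>i\<in>UNIV. \<bar>R (i # \<beta>)\<bar>)"
            by (rule member_le_sum) auto
          moreover have "0 \<le> Z / \<epsilon>" using Z0 \<epsilon> by simp
          ultimately show ?thesis using N n by linarith
        qed
        have "(\<Sum>i\<in>UNIV. h $ i *\<^sub>R w (i # \<beta>) (real n + 1) x) - (\<Sum>i\<in>UNIV. h $ i *\<^sub>R G (i # \<beta>) x)
          = (\<Sum>i\<in>UNIV. h $ i *\<^sub>R (w (i # \<beta>) (real n + 1) x - G (i # \<beta>) x))"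
          by (simp add: sum_subtractf scaleR_diff_right)
        also have "norm \<dots> \<le> (\<Sum>i\<in>UNIV. norm h * (\<bar>C (i # \<beta>)\<bar> / (real n + 1)))"
        proof (rule sum_norm_le)
          fix i
          show "norm (h $ i *\<^sub>R (w (i # \<beta>) (real n + 1) x - G (i # \<beta>) x)) \<le> norm h * (\<bar>C (i # \<beta>)\<bar> / (real n + 1))"
            unfolding norm_scaleR by (intro mult_mono component_le_norm_cart G' Rn x) auto
        qed
        also have "\<dots> = Z / (real n + 1) * norm h"
          by (simp add: Z_def sum_distrib_left[symmetric] sum_divide_distrib[symmetric])
        also have "\<dots> \<le> \<epsilon> * norm h"
        proof (intro mult_right_mono)
          have "0 \<le> (\<Sum>i\<in>UNIV. \<bar>R (i # \<beta>)\<bar>)" by (intro sum_nonneg) auto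
          then have "Z / \<epsilon> \<le> real n + 1" using N n by linarith
          then show "Z / (real n + 1) \<le> \<epsilon>" using \<epsilon> by (simp add: field_simps)
        qed simp
        finally show "norm ((\<Sum>i\<in>UNIV. h $ i *\<^sub>R w (i # \<beta>) (real n + 1) x)
          - (\<Sum>i\<in>UNIV. h $ i *\<^sub>R G (i # \<beta>) x)) \<le> \<epsilon> * norm h" .
      qed
    qed
    then obtain g where g: "\<And>x. x \<in> V \<Longrightarrow> (\<lambda>n. w \<beta> (real n + 1) x) \<longlonglongrightarrow> g x"
      and dg: "\<And>x. x \<in> V \<Longrightarrow> (g has_derivative (\<lambda>h. \<Sum>i\<in>UNIV. h $ i *\<^sub>R G (i # \<beta>) x)) (at x within V)"
      by blast
    have eq: "g y = G \<beta> y" if "y \<in> V" for y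
      using LIMSEQ_unique[OF g[OF that] lim[OF that]] .
    have "(g has_derivative (\<lambda>h. \<Sum>i\<in>UNIV. h $ i *\<^sub>R G (i # \<beta>) x)) (at x)"
      using dg[OF x] by (simp only: at_within_open[OF x V(1)])
    then show ?thesis
      using has_derivative_cong_open[of V x g "G \<beta>"] V(1) x eq by blast
  qed
  have itG: "iter_deriv \<beta> (G []) x = G \<beta> x" if "x \<in> V" for \<beta> x
    using that
  proof (induction \<beta> arbitrary: x)
    case (Cons i \<beta>)
    have "iter_deriv (i # \<beta>) (G []) x = partial_deriv i (G \<beta>) x"
      unfolding iter_deriv.simps by (rule partial_deriv_cong_open[OF V(1) Cons.prems]) (rule Cons.IH)
    then show ?case
      by (simp add: partial_deriv_eq[OF dG[OF Cons.prems]] sum_axis_scaleR)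
  qed simp
  have sG: "smooth_on V (G [])"
    unfolding smooth_on_def
  proof (intro allI ballI)
    fix \<beta> x assume x: "x \<in> V"
    have "G \<beta> differentiable (at x)" using dG[OF x] by (auto simp: differentiable_def)
    then show "iter_deriv \<beta> (G []) differentiable (at x)"
      using differentiable_cong_open[of V x "iter_deriv \<beta> (G [])" "G \<beta>"] V(1) x itG by blast
  qed
  have w0: "w [] \<rho> = wave_value u (\<lambda>\<xi>. \<kappa> (\<xi> /\<^sub>R \<rho>))" for \<rho> by (simp add: w_def)
  have rep: "represents_on V (\<lambda>x. (1 / inv_const) * G [] x) u"
    unfolding represents_on_def
  proof (intro conjI ballI V(1) smooth_on_cmult sG)
    fix \<phi> assume \<phi>: "\<phi> \<in> test_functions V"
    have s\<phi>: "\<phi> \<in> schwartz_space" by (rule test_functions_schwartz[OF \<phi>])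
    have \<phi>': "\<phi> \<in> test_functions UNIV" using \<phi> test_functions_mono[of V UNIV] by blast
    have out: "\<phi> x = 0" if "x \<notin> V" for x
      using \<phi> that closure_subset[of "{x. \<phi> x \<noteq> 0}"] by (auto simp: test_functions_def)
    define r where "r n = R [] + real n" for n
    have r: "R [] \<le> r n" "0 < r n" for n using R[of "[]"] by (auto simp: r_def)
    have r_top: "filterlim r at_top sequentially"
      unfolding r_def by (intro filterlim_tendsto_add_at_top[OF tendsto_const filterlim_real_sequentially])
    define s where "s n x = (1 / inv_const) * w [] (r n) x * \<phi> x" for n x
    define g where "g x = (1 / inv_const) * G [] x * \<phi> x" for x
    define Z where "Z = norm (1 / inv_const) * \<bar>C []\<bar>"
    have ss: "s n \<in> schwartz_space" for n
      unfolding s_def w0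
      by (intro test_functions_schwartz[OF test_functions_mult[OF open_UNIV _ \<phi>']] smooth_on_cmult open_UNIV
          smooth_on_wave_value u scaled_schwartz r)
    have sg: "g \<in> schwartz_space"
      unfolding g_def by (intro test_functions_schwartz[OF test_functions_mult[OF V(1) _ \<phi>]] smooth_on_cmult V(1) sG)
    have le: "norm ((LINT x|lborel. s n x) - (LINT x|lborel. g x)) \<le> Z * (LINT x|lborel. norm (\<phi> x)) / r n" for n
    proof -
      have "norm (s n x - g x) \<le> Z / r n * norm (\<phi> x)" for x
      proof (cases "x \<in> V")
        case True
        have "norm (s n x - g x) = norm (1 / inv_const) * norm (w [] (r n) x - G [] x) * norm (\<phi> x)"
          unfolding s_def g_def norm_mult[symmetric] by (simp add: algebra_simps)
        also have "\<dots> \<le> norm (1 / inv_const) * (\<bar>C []\<bar> / r n) * norm (\<phi> x)"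
          by (intro mult_right_mono mult_left_mono G' r(1) True) auto
        finally show ?thesis by (simp add: Z_def)
      next
        case False
        then show ?thesis by (simp add: s_def g_def out)
      qed
      then have "(LINT x|lborel. norm (s n x - g x)) \<le> (LINT x|lborel. Z / r n * norm (\<phi> x))"
        using integrable_schwartz[OF schwartz_diff[OF ss sg]] integrable_schwartz[OF s\<phi>]
        by (intro integral_mono integrable_norm integrable_mult_right) auto
      then show ?thesis
        using integral_norm_bound[of lborel "\<lambda>x. s n x - g x"]
        by (simp add: Bochner_Integration.integral_diff integrable_schwartz ss sg)
    qed
    \<comment> \<open>The same numbers are the pairings of the truncated solutions with
      \<open>\<phi>\<close>, which tend to \<open>u \<phi>\<close>; the two limits must
      agree.\<close>
    have "(\<lambda>n. LINT x|lborel. s n x) \<longlonglongrightarrow> (LINT x|lborel. g x)"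
    proof (rule LIM_zero_cancel, rule Lim_null_comparison)
      show "(\<lambda>n. Z * (LINT x|lborel. norm (\<phi> x)) / r n) \<longlonglongrightarrow> 0"
        by (intro tendsto_divide_0[OF tendsto_const] filterlim_at_top_imp_at_infinity r_top)
    qed (use le in \<open>simp add: always_eventually\<close>)
    moreover have "(LINT x|lborel. s n x) = u (fourier (\<lambda>\<xi>. \<kappa> (\<xi> /\<^sub>R r n) * inv_fourier \<phi> \<xi>))" for n
    proof -
      note sk = scaled_schwartz[OF r(2)[of n]]
      have "multiplier_op (\<lambda>\<xi>. \<kappa> (\<xi> /\<^sub>R r n)) u \<phi> = (LINT x|lborel. s n x)"
        using represents_on_multiplier_op[OF u sk] \<phi>' unfolding represents_on_def s_def w0 by blast
      moreover have "multiplier_op (\<lambda>\<xi>. \<kappa> (\<xi> /\<^sub>R r n)) u \<phi> = u (fourier (\<lambda>\<xi>. \<kappa> (\<xi> /\<^sub>R r n) * inv_fourier \<phi> \<xi>))"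
        by (intro multiplier_op_apply schwartz_mult sk s\<phi> schwartz_inv_fourier)
      ultimately show ?thesis by simp
    qed
    moreover have "(\<lambda>n. u (fourier (\<lambda>\<xi>. \<kappa> (\<xi> /\<^sub>R r n) * inv_fourier \<phi> \<xi>))) \<longlonglongrightarrow> u \<phi>"
      using filterlim_compose[OF tempered_cutoff_tendsto[OF u schwartz_inv_fourier[OF s\<phi>]] r_top]
      by (simp add: fourier_inv_fourier[OF s\<phi>])
    ultimately show "u \<phi> = (LINT x|lborel. (1 / inv_const) * G [] x * \<phi> x)"
      using LIMSEQ_unique by (simp add: g_def)
  qed
  have "uniform_limit V (\<lambda>\<rho> x. (1 / inv_const) * wave_value u (\<lambda>\<xi>. \<kappa> (\<xi> /\<^sub>R \<rho>)) x) (dist_value u) at_top"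
  proof (rule uniform_limitI)
    fix \<epsilon> :: real assume \<epsilon>: "0 < \<epsilon>"
    define Z where "Z = norm (1 / inv_const) * \<bar>C []\<bar>"
    have Z0: "0 \<le> Z" by (simp add: Z_def)
    show "\<forall>\<^sub>F \<rho> in at_top. \<forall>x\<in>V. dist ((1 / inv_const) * wave_value u (\<lambda>\<xi>. \<kappa> (\<xi> /\<^sub>R \<rho>)) x) (dist_value u x) < \<epsilon>"
    \<comment> \<open>Because \<open>R []\<close> is at least 1, Z/\<epsilon> is strictly below
      \<rho>, as the strict inequality requires.\<close>
    proof (rule eventually_at_top_linorderI[of "R [] + Z / \<epsilon>"], intro ballI)
      fix \<rho> x assume \<rho>: "R [] + Z / \<epsilon> \<le> \<rho>" and x: "x \<in> V"
      have "0 \<le> Z / \<epsilon>" using Z0 \<epsilon> by simp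
      then have \<rho>': "R [] \<le> \<rho>" "Z / \<epsilon> < \<rho>" "0 < \<rho>" using \<rho> R[of "[]"] by linarith+
      have "norm ((1 / inv_const) * (w [] \<rho> x - G [] x)) \<le> norm (1 / inv_const) * (\<bar>C []\<bar> / \<rho>)"
        unfolding norm_mult by (intro mult_left_mono G' \<rho>' x) auto
      also have "\<dots> = Z / \<rho>" by (simp add: Z_def)
      also have "\<dots> < \<epsilon>" using \<rho>' \<epsilon> by (simp add: field_simps)
      finally show "dist ((1 / inv_const) * wave_value u (\<lambda>\<xi>. \<kappa> (\<xi> /\<^sub>R \<rho>)) x) (dist_value u x) < \<epsilon>"
        unfolding dist_value_eq[OF rep x] dist_norm by (simp only: w0 right_diff_distrib)
    qed
  qed
  then show ?thesis using d by (intro exI[of _ "d / 2"]) (simp add: V_def)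
qed

end

section \<open>Passage to the Fourier coefficients on the circle\<close>

theorem lemma1:
  fixes p g cutoff :: "real^'n \<Rightarrow> complex"
    and u f :: "(real^'n \<Rightarrow> complex) \<Rightarrow> complex"
    and r :: "nat \<Rightarrow> real" and q :: "nat \<Rightarrow> nat" and N :: nat
    and \<mu> R :: real and e1 e2 :: "real^'n" and m :: int
  assumes "CARD('n) \<ge> 2"
    and "p \<in> symbol_class \<mu>" and "elliptic \<mu> p"
    and "\<forall>j\<in>{1..N}. 0 < r j" and "strict_mono_on {1..N} r"
    and "\<forall>j\<in>{1..N}. 0 < q j"
    and "smooth_on (UNIV - {0}) g"
    and "\<exists>c>0. \<forall>\<xi>. \<xi> \<noteq> 0 \<longrightarrow> c \<le> norm (g \<xi>)"
    and "\<exists>C. \<forall>\<^sub>F \<xi> in at 0. norm (g \<xi>) \<le> C"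
    and "\<exists>C k. \<forall>\<^sub>F \<xi> in at_infinity. norm (g \<xi>) \<le> C * norm \<xi> ^ k"
    and "\<forall>\<xi>. \<xi> \<noteq> 0 \<longrightarrow> p \<xi> = g \<xi> * (\<Prod>j=1..N. of_real (norm \<xi> - r j) ^ q j)"
    and "norm e1 = 1" and "norm e2 = 1" and "e1 \<bullet> e2 = 0" and "R > 0"
    and "cutoff \<in> test_functions UNIV"
    and "\<forall>\<xi>. norm \<xi> \<le> 1 \<longrightarrow> cutoff \<xi> = 1" and "\<forall>\<xi>. norm \<xi> \<ge> 2 \<longrightarrow> cutoff \<xi> = 0"
    and "u \<in> tempered_distributions"
    and "f \<in> compactly_supported_distributions"
    and "multiplier_op p u = f"
    and "circle_in e1 e2 R \<inter> singular_support f = {}"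
  shows "((\<lambda>\<rho>. circle_coeff e1 e2 R m (multiplier_op (\<lambda>\<xi>. cutoff (\<xi> /\<^sub>R \<rho>)) u))
            \<longlongrightarrow> circle_coeff e1 e2 R m u) at_top"
proof -
  interpret cutoff_function cutoff
    using assms by unfold_locales auto
  define w where "w \<rho> x = (1 / inv_const) * wave_value u (\<lambda>\<xi>. cutoff (\<xi> /\<^sub>R \<rho>)) x" for \<rho> x
  define K where "K = circle_in e1 e2 R"
  have f: "f \<in> tempered_distributions"
    using assms by (simp add: compactly_supported_distributions_def)
  have cp: "continuous_on S (circle_point e1 e2 R)" for S
    unfolding circle_point_def by (intro continuous_intros)
  have K: "compact K"
    unfolding K_def circle_in_def by (intro compact_continuous_image cp) simp
  have "\<exists>\<delta>>0. uniform_limit (ball x \<delta>) w (dist_value u) at_top" if "x \<in> K" for x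
    unfolding w_def
    by (rule dist_value_locally_uniform[of p \<mu>]) (use assms f that in \<open>auto simp: K_def\<close>)
  then obtain \<delta> where \<delta>: "\<And>x. x \<in> K \<Longrightarrow> 0 < \<delta> x"
      "\<And>x. x \<in> K \<Longrightarrow> uniform_limit (ball x (\<delta> x)) w (dist_value u) at_top"
    by metis
  \<comment> \<open>The radii depend on the centre; compactness of the circle turns local into
    global uniform convergence.\<close>
  have "K \<subseteq> (\<Union>x\<in>K. ball x (\<delta> x))" using \<delta>(1) by auto
  then obtain T where T: "T \<subseteq> K" "finite T" "K \<subseteq> (\<Union>x\<in>T. ball x (\<delta> x))"
    using compactE_image[OF K, of K "\<lambda>x. ball x (\<delta> x)"] by auto
  have "uniform_limit (\<Union>x\<in>T. ball x (\<delta> x)) w (dist_value u) at_top"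
    using T \<delta>(2) by (intro uniform_limit_on_UNION) auto
  then have ul: "uniform_limit K w (dist_value u) at_top"
    using T(3) uniform_limit_on_subset by blast
  \<comment> \<open>Integration of the uniform limit requires continuity for every real \<rho>. The
    maximum with 1 provides it without affecting the limit; at \<rho> = 0 the scaled cutoff would be
    the constant 1, which is not a Schwartz function.\<close>
  define h where "h \<rho> \<theta> = exp (- (\<i> * of_int m * of_real \<theta>)) * w (max 1 \<rho>) (circle_point e1 e2 R \<theta>)" for \<rho> \<theta>
  define h0 where "h0 \<theta> = exp (- (\<i> * of_int m * of_real \<theta>)) * dist_value u (circle_point e1 e2 R \<theta>)" for \<theta>
  have ulh: "uniform_limit {0..2 * pi} h h0 at_top"
  proof (rule uniform_limitI)
    fix e :: real assume "0 < e"
    with ul have "\<forall>\<^sub>F \<rho> in at_top. \<forall>x\<in>K. dist (w \<rho> x) (dist_value u x) < e"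
      by (rule uniform_limitD)
    then have "\<forall>\<^sub>F \<rho> in at_top. 1 \<le> \<rho> \<and> (\<forall>x\<in>K. dist (w \<rho> x) (dist_value u x) < e)"
      by (intro eventually_conj eventually_ge_at_top)
    then show "\<forall>\<^sub>F \<rho> in at_top. \<forall>\<theta>\<in>{0..2 * pi}. dist (h \<rho> \<theta>) (h0 \<theta>) < e"
    proof (rule eventually_mono, intro ballI)
      fix \<rho> \<theta> :: real
      assume *: "1 \<le> \<rho> \<and> (\<forall>x\<in>K. dist (w \<rho> x) (dist_value u x) < e)" and \<theta>: "\<theta> \<in> {0..2 * pi}"
      let ?x = "circle_point e1 e2 R \<theta>"
      have "norm (exp (- (\<i> * of_int m * of_real \<theta>))) = 1"
        by (simp add: norm_exp_eq_Re)
      then have "dist (h \<rho> \<theta>) (h0 \<theta>) = dist (w \<rho> ?x) (dist_value u ?x)"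
        using * by (simp add: h_def h0_def dist_norm norm_mult flip: right_diff_distrib)
      moreover have "?x \<in> K" using \<theta> by (simp add: K_def circle_in_def)
      ultimately show "dist (h \<rho> \<theta>) (h0 \<theta>) < e" using * by simp
    qed
  qed
  have ch: "continuous_on {0..2 * pi} (h \<rho>)" for \<rho>
  proof -
    have "continuous_on UNIV (w (max 1 \<rho>))"
      unfolding w_def using smooth_on_continuous_on[OF smooth_on_wave_value[OF assms(19) scaled_schwartz[of "max 1 \<rho>"]], of "[]"]
      by (intro continuous_intros) simp
    then show ?thesis
      unfolding h_def by (intro continuous_intros continuous_on_compose2[OF _ cp]) auto
  qed
  obtain I J where I: "\<And>\<rho>. (h \<rho> has_integral I \<rho>) {0..2 * pi}"
    and J: "(h0 has_integral J) {0..2 * pi}" and IJ: "(I \<longlongrightarrow> J) at_top"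
    by (rule uniform_limit_integral[OF ulh ch trivial_limit_at_top_linorder]) blast
  have "circle_coeff e1 e2 R m u = J"
    using J by (simp add: circle_coeff_def h0_def[abs_def] integral_unique)
  moreover have "\<forall>\<^sub>F \<rho> in at_top. I \<rho> = circle_coeff e1 e2 R m (multiplier_op (\<lambda>\<xi>. cutoff (\<xi> /\<^sub>R \<rho>)) u)"
  proof (rule eventually_at_top_linorderI[of 1])
    fix \<rho> :: real assume \<rho>: "1 \<le> \<rho>"
    \<comment> \<open>The truncated solution is represented on the whole space, so its pointwise
      value is determined everywhere.\<close>
    have "dist_value (multiplier_op (\<lambda>\<xi>. cutoff (\<xi> /\<^sub>R \<rho>)) u) x = w \<rho> x" for x
      unfolding w_def using \<rho> assms(19)
      by (intro dist_value_eq[OF represents_on_multiplier_op UNIV_I] scaled_schwartz) auto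
    then show "I \<rho> = circle_coeff e1 e2 R m (multiplier_op (\<lambda>\<xi>. cutoff (\<xi> /\<^sub>R \<rho>)) u)"
      using I[of \<rho>] \<rho> by (simp add: circle_coeff_def h_def[abs_def] integral_unique max_def)
  qed
  ultimately show ?thesis
    using Lim_transform_eventually[OF IJ] by simp
qed

end
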